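(* Let $r=\Lambda+s=\sum_i x_i\otimes y_i$ be a quasitriangular $r$-matrix on a Lie algebra $\mathfrak g$, with $\Lambda\in\wedge^2\mathfrak g$ and $s\in(S^2\mathfrak g)^{\mathfrak g}$. Under the equivalence of categories $$\mathcal P(\mathfrak g,\delta_r)\longleftrightarrow\mathcal{QP}(\mathfrak g,\phi_s),\qquad (Y,\pi_Y,\lambda)\longleftrightarrow(Y,\,Q_Y=\pi_Y+\lambda(\Lambda),\,\lambda)$$ (identity on morphisms), the fusion product in $\mathcal P(\mathfrak g,\delta_r)$ corresponds to the fusion product in $\mathcal{QP}(\mathfrak g,\phi_s)$. That is, for $n\ge2$, if $(Y_j,\pi_j,\lambda_j)\in\mathcal P(\mathfrak g,\delta_r)$ corresponds to $(Y_j,Q_j,\lambda_j)\in\mathcal{QP}(\mathfrak g,\phi_s)$ for $1\le j\le n$, then the fusion product of the $(Y_j,\pi_j,\lambda_j)$ corresponds to the fusion product of the $(Y_j,Q_j,\lambda_j)$.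
   Context: Everything is over $\mathbf k=\mathbb R$ (smooth) or $\mathbb C$ (holomorphic), finite dimensional; $u\wedge v=u\otimes v-v\otimes u$. $r\in\mathfrak g\otimes\mathfrak g$ is a quasitriangular $r$-matrix if its symmetric part is ad-invariant and $\mathrm{CYB}(r)=[r_{12},r_{13}]+[r_{12},r_{23}]+[r_{13},r_{23}]=0$; $\delta_r(x)=\mathrm{ad}_xr$. $\phi_s=-2\,\mathrm{CYB}(s)\in(\wedge^3\mathfrak g)^{\mathfrak g}$ (which equals the Schouten bracket $[\Lambda,\Lambda]$). A left action is a Lie algebra anti-homomorphism $\lambda$ from $\mathfrak g$ to vector fields on $Y$, extended multiplicatively to tensors. A left $(\mathfrak g,\delta_r)$-Poisson space is $(Y,\pi_Y,\lambda)$ with $\pi_Y$ Poisson, $\lambda$ a left action and $[\lambda(x),\pi_Y]=\lambda(\delta_r(x))$. A $(\mathfrak g,\phi_s)$-quasi-Poisson space is $(Y,Q_Y,\lambda)$ with $\lambda$ a left action of $\mathfrak g$ and $Q_Y$ a $\mathfrak g$-invariant bivector field with $[Q_Y,Q_Y]=\lambda(\phi_s)$. $\mathcal P(\mathfrak g,\delta_r)$ and $\mathcal{QP}(\mathfrak g,\phi_s)$ are the categories of these, with $\mathfrak g$-equivariant maps respecting the bivector fields as morphisms. For $X\in\mathfrak g$, $(X)_j\in\mathfrak g^n$ is its image in the $j$-th summand. For $a=\sum_iu_i\otimes v_i\in\mathfrak g\otimes\mathfrak g$, $\mathrm{Mix}^n(a)=\sum_{1\le j<k\le n}\sum_i(v_i)_j\wedge(u_i)_k\in\wedge^2(\mathfrak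 g^n)$. Given actions $\lambda_j$ on $Y_j$, let $Y=Y_1\times\cdots\times Y_n$, $\lambda=(\lambda_1,\ldots,\lambda_n)$ the direct product action of $\mathfrak g^n$, and $\lambda_{\rm diag}(x)=\lambda(x,\ldots,x)$ for $x\in\mathfrak g$. On a product, $(A_1,\ldots,A_n)$ is the sum of the bivector fields $A_j$ on the factors. Fusion product in $\mathcal P(\mathfrak g,\delta_r)$ of $(Y_j,\pi_j,\lambda_j)$: $(Y,\ (\pi_1,\ldots,\pi_n)+\lambda(\mathrm{Mix}^n(r)),\ \lambda_{\rm diag})$. Fusion product in $\mathcal{QP}(\mathfrak g,\phi_s)$ of $(Y_j,Q_j,\lambda_j)$: $(Y,\ (Q_1,\ldots,Q_n)+\lambda(\mathrm{Mix}^n(s)),\ \lambda_{\rm diag})$. *)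

theory Defs
  imports "HOL-Analysis.Analysis" "HOL-Library.Function_Algebras"
begin

text \<open>
  The ground field is a type of class \<open>{real_normed_field, euclidean_space}\<close>. Such a type is a
  finite-dimensional field extension of the reals, so up to isomorphism there are exactly two of
  them: \<^typ>\<open>real\<close> (the smooth setting) and \<^typ>\<open>complex\<close> (the holomorphic setting, derivatives
  being derivatives over the ground field).

  Function spaces carry the pointwise addition of \<^theory>\<open>HOL-Library.Function_Algebras\<close>.
\<close>


section \<open>Lie algebras and tensors\<close>

locale lie_algebra = vector_space scl
  for scl :: "'k::field \<Rightarrow> 'g::ab_group_add \<Rightarrow> 'g" +
  fixes brk :: "'g \<Rightarrow> 'g \<Rightarrow> 'g"
  assumes finite_dim: "\<exists>B. finite B \<and> span B = UNIV"
    and brk_add_left: "brk (x + y) z = brk x z + brk y z"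
    and brk_add_right: "brk x (y + z) = brk x y + brk x z"
    and brk_scale_left: "brk (scl c x) y = scl c (brk x y)"
    and brk_scale_right: "brk x (scl c y) = scl c (brk x y)"
    and brk_self: "brk x x = 0"
    and jacobi: "brk x (brk y z) + brk y (brk z x) + brk z (brk x y) = 0"

text \<open>
  A finite-dimensional space \<open>V\<close> has \<open>V \<otimes> V\<close> canonically embedded into the bilinear forms on the
  dual space, \<open>u \<otimes> v\<close> being \<open>(\<xi>, \<eta>) \<mapsto> \<xi>(u) \<eta>(v)\<close>; likewise for three factors. The dual space is
  a set of functions, so tensors are functions on all of \<open>V \<Rightarrow> 'k\<close>, and they are made unique by
  giving them the value 0 on arguments that are not linear.
\<close>

abbreviation linear_form :: "('k::field \<Rightarrow> 'v::ab_group_add \<Rightarrow> 'v) \<Rightarrow> ('v \<Rightarrow> 'k) \<Rightarrow> bool" where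
  "linear_form scl \<xi> \<equiv> Vector_Spaces.linear scl (*) \<xi>"

type_synonym ('v, 'k) tensor2 = "('v \<Rightarrow> 'k) \<Rightarrow> ('v \<Rightarrow> 'k) \<Rightarrow> 'k"
type_synonym ('v, 'k) tensor3 = "('v \<Rightarrow> 'k) \<Rightarrow> ('v \<Rightarrow> 'k) \<Rightarrow> ('v \<Rightarrow> 'k) \<Rightarrow> 'k"

definition tens2 :: "('k::field \<Rightarrow> 'v::ab_group_add \<Rightarrow> 'v) \<Rightarrow> 'v \<Rightarrow> 'v \<Rightarrow> ('v, 'k) tensor2" where
  "tens2 scl u v = (\<lambda>\<xi> \<eta>. if linear_form scl \<xi> \<and> linear_form scl \<eta> then \<xi> u * \<eta> v else 0)"

definition tens3 :: "('k::field \<Rightarrow> 'v::ab_group_add \<Rightarrow> 'v) \<Rightarrow> 'v \<Rightarrow> 'v \<Rightarrow> 'v \<Rightarrow> ('v, 'k) tensor3" where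
  "tens3 scl u v w = (\<lambda>\<xi> \<eta> \<zeta>. if linear_form scl \<xi> \<and> linear_form scl \<eta> \<and> linear_form scl \<zeta>
     then \<xi> u * \<eta> v * \<zeta> w else 0)"

definition wedge :: "('k::field \<Rightarrow> 'v::ab_group_add \<Rightarrow> 'v) \<Rightarrow> 'v \<Rightarrow> 'v \<Rightarrow> ('v, 'k) tensor2" where
  "wedge scl u v = tens2 scl u v - tens2 scl v u"

definition tensor_square :: "('k::field \<Rightarrow> 'v::ab_group_add \<Rightarrow> 'v) \<Rightarrow> ('v, 'k) tensor2 set" where
  "tensor_square scl = {\<Sum>i<m. tens2 scl (u i) (v i) | (m::nat) u v. True}"

definition flip :: "('v, 'k) tensor2 \<Rightarrow> ('v, 'k) tensor2" where
  "flip a = (\<lambda>\<xi> \<eta>. a \<eta> \<xi>)"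

definition exterior_square :: "('k::field \<Rightarrow> 'v::ab_group_add \<Rightarrow> 'v) \<Rightarrow> ('v, 'k) tensor2 set" where
  "exterior_square scl = {a \<in> tensor_square scl. flip a = - a}"

definition symmetric_square :: "('k::field \<Rightarrow> 'v::ab_group_add \<Rightarrow> 'v) \<Rightarrow> ('v, 'k) tensor2 set" where
  "symmetric_square scl = {a \<in> tensor_square scl. flip a = a}"

definition sym_part :: "('v, 'k::field) tensor2 \<Rightarrow> ('v, 'k) tensor2" where
  "sym_part a = (\<lambda>\<xi> \<eta>. (a \<xi> \<eta> + a \<eta> \<xi>) / 2)"

text \<open>The linear map \<open>L \<otimes> L'\<close>, for linear maps \<open>L\<close>, \<open>L'\<close> into the space with scaling \<open>scl'\<close>.\<close>

definition tens_map ::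
    "('k::field \<Rightarrow> 'w::ab_group_add \<Rightarrow> 'w) \<Rightarrow> ('v \<Rightarrow> 'w) \<Rightarrow> ('v \<Rightarrow> 'w) \<Rightarrow> ('v, 'k) tensor2 \<Rightarrow> ('w, 'k) tensor2" where
  "tens_map scl' L L' a =
     (\<lambda>\<xi> \<eta>. if linear_form scl' \<xi> \<and> linear_form scl' \<eta> then a (\<xi> \<circ> L) (\<eta> \<circ> L') else 0)"

definition ad2 ::
    "('k::field \<Rightarrow> 'g::ab_group_add \<Rightarrow> 'g) \<Rightarrow> ('g \<Rightarrow> 'g \<Rightarrow> 'g) \<Rightarrow> 'g \<Rightarrow> ('g, 'k) tensor2 \<Rightarrow> ('g, 'k) tensor2" where
  "ad2 scl brk x a = tens_map scl (brk x) id a + tens_map scl id (brk x) a"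

definition ad_invariant ::
    "('k::field \<Rightarrow> 'g::ab_group_add \<Rightarrow> 'g) \<Rightarrow> ('g \<Rightarrow> 'g \<Rightarrow> 'g) \<Rightarrow> ('g, 'k) tensor2 \<Rightarrow> bool" where
  "ad_invariant scl brk a \<longleftrightarrow> (\<forall>x. ad2 scl brk x a = 0)"

text \<open>
  \<open>CYB(r) = [r\<^sub>1\<^sub>2, r\<^sub>1\<^sub>3] + [r\<^sub>1\<^sub>2, r\<^sub>2\<^sub>3] + [r\<^sub>1\<^sub>3, r\<^sub>2\<^sub>3]\<close>, contracted with three linear forms so that no
  presentation \<open>r = \<Sum>\<^sub>i x\<^sub>i \<otimes> y\<^sub>i\<close> has to be chosen; lemma \<open>CYB_sum\<close> below gives the
  expression in terms of such a presentation.
\<close>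

definition CYB ::
    "('k::field \<Rightarrow> 'g::ab_group_add \<Rightarrow> 'g) \<Rightarrow> ('g \<Rightarrow> 'g \<Rightarrow> 'g) \<Rightarrow> ('g, 'k) tensor2 \<Rightarrow> ('g, 'k) tensor3" where
  "CYB scl brk r = (\<lambda>\<xi> \<eta> \<zeta>.
     if linear_form scl \<xi> \<and> linear_form scl \<eta> \<and> linear_form scl \<zeta> then
       r (\<lambda>x. r (\<lambda>x'. \<xi> (brk x x')) \<zeta>) \<eta>
     + r \<xi> (\<lambda>y. r (\<lambda>x. \<eta> (brk y x)) \<zeta>)
     + r \<xi> (\<lambda>y. r \<eta> (\<lambda>y'. \<zeta> (brk y y')))
     else 0)"

definition quasitriangular ::
    "('k::field \<Rightarrow> 'g::ab_group_add \<Rightarrow> 'g) \<Rightarrow> ('g \<Rightarrow> 'g \<Rightarrow> 'g) \<Rightarrow> ('g, 'k) tensor2 \<Rightarrow> bool" where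
  "quasitriangular scl brk r \<longleftrightarrow>
     r \<in> tensor_square scl \<and> ad_invariant scl brk (sym_part r) \<and> CYB scl brk r = 0"

definition delta ::
    "('k::field \<Rightarrow> 'g::ab_group_add \<Rightarrow> 'g) \<Rightarrow> ('g \<Rightarrow> 'g \<Rightarrow> 'g) \<Rightarrow> ('g, 'k) tensor2 \<Rightarrow> 'g \<Rightarrow> ('g, 'k) tensor2" where
  "delta scl brk r x = ad2 scl brk x r"

definition phi ::
    "('k::field \<Rightarrow> 'g::ab_group_add \<Rightarrow> 'g) \<Rightarrow> ('g \<Rightarrow> 'g \<Rightarrow> 'g) \<Rightarrow> ('g, 'k) tensor2 \<Rightarrow> ('g, 'k) tensor3" where
  "phi scl brk s = (\<lambda>\<xi> \<eta> \<zeta>. - 2 * CYB scl brk s \<xi> \<eta> \<zeta>)"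

text \<open>
  \<open>\<gg>\<^sup>n\<close> is the type \<open>'n \<Rightarrow> 'g\<close> for a finite linearly ordered index type \<open>'n\<close> with \<open>n\<close> elements.
\<close>

definition pow_scale :: "('k \<Rightarrow> 'g \<Rightarrow> 'g) \<Rightarrow> 'k \<Rightarrow> ('n \<Rightarrow> 'g) \<Rightarrow> ('n \<Rightarrow> 'g)" where
  "pow_scale scl c x = (\<lambda>j. scl c (x j))"

definition summand :: "'n \<Rightarrow> 'g::zero \<Rightarrow> ('n \<Rightarrow> 'g)" where
  "summand j x = (\<lambda>i. if i = j then x else 0)"

text \<open>For the form of \<open>Mix\<close> in terms of \<open>a = \<Sum>\<^sub>i u\<^sub>i \<otimes> v\<^sub>i\<close> see lemma \<open>Mix_sum\<close> below.\<close>

definition Mix ::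
    "('k::field \<Rightarrow> 'g::ab_group_add \<Rightarrow> 'g) \<Rightarrow> ('g, 'k) tensor2 \<Rightarrow> ('n::{finite,linorder} \<Rightarrow> 'g, 'k) tensor2" where
  "Mix scl a = (\<Sum>(j, k) | j < k.
     tens_map (pow_scale scl) (summand j) (summand k) (flip a)
     - tens_map (pow_scale scl) (summand k) (summand j) a)"


section \<open>Manifolds\<close>

text \<open>
  The coordinate space \<open>k\<^sup>I\<close> for a finite set \<open>I\<close> of coordinate labels. Labels from an arbitrary
  type make the coordinates of a product manifold the disjoint union of those of the factors.
\<close>

definition coord_space :: "'i set \<Rightarrow> ('i \<Rightarrow> 'k::real_normed_field) topology" where
  "coord_space I = product_topology (\<lambda>_. euclidean) I"

text \<open>Functions with continuous partial derivatives up to order \<open>n\<close> on the open set \<open>V\<close>.\<close>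

fun cont_diff_on ::
    "nat \<Rightarrow> 'i set \<Rightarrow> ('i \<Rightarrow> 'k::real_normed_field) set \<Rightarrow> (('i \<Rightarrow> 'k) \<Rightarrow> 'k) \<Rightarrow> bool" where
  "cont_diff_on 0 I V f \<longleftrightarrow> continuous_map (subtopology (coord_space I) V) euclidean f"
| "cont_diff_on (Suc n) I V f \<longleftrightarrow> continuous_map (subtopology (coord_space I) V) euclidean f \<and>
     (\<forall>i\<in>I. \<exists>g. cont_diff_on n I V g \<and>
        (\<forall>x\<in>V. ((\<lambda>t. f (x(i := t))) has_field_derivative g x) (at (x i))))"

definition coord_smooth_on ::
    "'i set \<Rightarrow> ('i \<Rightarrow> 'k::real_normed_field) set \<Rightarrow> (('i \<Rightarrow> 'k) \<Rightarrow> 'k) \<Rightarrow> bool" where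
  "coord_smooth_on I V f \<longleftrightarrow> (\<forall>n. cont_diff_on n I V f)"

type_synonym ('a, 'i, 'k) chart = "'a set \<times> ('a \<Rightarrow> 'i \<Rightarrow> 'k)"

record ('a, 'i, 'k) mfd =
  top_of :: "'a topology"
  idx :: "'i set"
  atlas :: "('a, 'i, 'k) chart set"

abbreviation pts :: "('a, 'i, 'k) mfd \<Rightarrow> 'a set" where
  "pts M \<equiv> topspace (top_of M)"

definition is_chart :: "('a, 'i, 'k::real_normed_field) mfd \<Rightarrow> ('a, 'i, 'k) chart \<Rightarrow> bool" where
  "is_chart M = (\<lambda>(W, \<phi>). openin (top_of M) W \<and> openin (coord_space (idx M)) (\<phi> ` W) \<and>
     homeomorphic_map (subtopology (top_of M) W) (subtopology (coord_space (idx M)) (\<phi> ` W)) \<phi>)"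

definition manifold :: "('a, 'i, 'k::real_normed_field) mfd \<Rightarrow> bool" where
  "manifold M \<longleftrightarrow> Hausdorff_space (top_of M) \<and> second_countable (top_of M) \<and> finite (idx M) \<and>
     (\<forall>c\<in>atlas M. is_chart M c) \<and> (\<Union>(W, \<phi>)\<in>atlas M. W) = pts M \<and>
     (\<forall>(W, \<phi>)\<in>atlas M. \<forall>(W', \<phi>')\<in>atlas M. \<forall>i\<in>idx M.
        coord_smooth_on (idx M) (\<phi> ` (W \<inter> W')) (\<lambda>x. \<phi>' (the_inv_into W \<phi> x) i))"

definition smooth_on :: "('a, 'i, 'k::real_normed_field) mfd \<Rightarrow> 'a set \<Rightarrow> ('a \<Rightarrow> 'k) \<Rightarrow> bool" where
  "smooth_on M U f \<longleftrightarrow> openin (top_of M) U \<and>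
     (\<forall>(W, \<phi>)\<in>atlas M. coord_smooth_on (idx M) (\<phi> ` (U \<inter> W)) (f \<circ> the_inv_into W \<phi>))"

definition smooth_near :: "('a, 'i, 'k::real_normed_field) mfd \<Rightarrow> 'a \<Rightarrow> ('a \<Rightarrow> 'k) \<Rightarrow> bool" where
  "smooth_near M p f \<longleftrightarrow> (\<exists>U. p \<in> U \<and> smooth_on M U f)"

definition smooth_map ::
    "('a, 'i, 'k::real_normed_field) mfd \<Rightarrow> ('b, 'j, 'k) mfd \<Rightarrow> ('a \<Rightarrow> 'b) \<Rightarrow> bool" where
  "smooth_map M N F \<longleftrightarrow> continuous_map (top_of M) (top_of N) F \<and>
     (\<forall>(W, \<phi>)\<in>atlas N. \<forall>i\<in>idx N. smooth_on M {p \<in> pts M. F p \<in> W} (\<lambda>p. \<phi> (F p) i))"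


section \<open>Vector fields and bivector fields\<close>

text \<open>
  A tangent vector at \<open>p\<close> is a directional derivative \<open>\<Sum>\<^sub>i c\<^sub>i \<partial>/\<partial>x\<^sub>i\<close> at \<open>p\<close> in some chart, acting on
  the functions defined and smooth near \<open>p\<close>. As with tensors, the value on all other functions
  is fixed to be 0. A bivector at \<open>p\<close> is a skew-symmetric element of \<open>T\<^sub>p \<otimes> T\<^sub>p\<close>, where \<open>v \<otimes> w\<close> acts
  on pairs of functions by \<open>(f, g) \<mapsto> v(f) w(g)\<close>. All functions smooth near some point are
  represented by functions on the whole type \<open>'a\<close>; only their germ at the point matters.
\<close>

type_synonym ('a, 'k) vfield = "'a \<Rightarrow> ('a \<Rightarrow> 'k) \<Rightarrow> 'k"
type_synonym ('a, 'k) field2 = "'a \<Rightarrow> ('a \<Rightarrow> 'k) \<Rightarrow> ('a \<Rightarrow> 'k) \<Rightarrow> 'k"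
type_synonym ('a, 'k) field3 = "'a \<Rightarrow> ('a \<Rightarrow> 'k) \<Rightarrow> ('a \<Rightarrow> 'k) \<Rightarrow> ('a \<Rightarrow> 'k) \<Rightarrow> 'k"

definition tangent_space :: "('a, 'i, 'k::real_normed_field) mfd \<Rightarrow> 'a \<Rightarrow> (('a \<Rightarrow> 'k) \<Rightarrow> 'k) set" where
  "tangent_space M p =
     {v. \<exists>(W, \<phi>)\<in>atlas M. p \<in> W \<and> (\<exists>c. v = (\<lambda>f. if smooth_near M p f
        then \<Sum>i\<in>idx M. c i * deriv (\<lambda>t. f (the_inv_into W \<phi> ((\<phi> p)(i := t)))) (\<phi> p i) else 0))}"

definition vector_field :: "('a, 'i, 'k::real_normed_field) mfd \<Rightarrow> ('a, 'k) vfield \<Rightarrow> bool" where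
  "vector_field M X \<longleftrightarrow>
     (\<forall>p\<in>pts M. X p \<in> tangent_space M p) \<and> (\<forall>p. p \<notin> pts M \<longrightarrow> X p = 0) \<and>
     (\<forall>p f. smooth_near M p f \<longrightarrow> smooth_near M p (\<lambda>q. X q f))"

definition bivector_field :: "('a, 'i, 'k::real_normed_field) mfd \<Rightarrow> ('a, 'k) field2 \<Rightarrow> bool" where
  "bivector_field M A \<longleftrightarrow>
     (\<forall>p\<in>pts M. \<exists>(m::nat) v w. (\<forall>i<m. v i \<in> tangent_space M p \<and> w i \<in> tangent_space M p) \<and>
        A p = (\<lambda>f g. \<Sum>i<m. v i f * w i g)) \<and>
     (\<forall>p f g. A p f g = - A p g f) \<and> (\<forall>p. p \<notin> pts M \<longrightarrow> A p = 0) \<and>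
     (\<forall>p f g. smooth_near M p f \<and> smooth_near M p g \<longrightarrow> smooth_near M p (\<lambda>q. A q f g))"

definition vf_bracket ::
    "('a, 'i, 'k::real_normed_field) mfd \<Rightarrow> ('a, 'k) vfield \<Rightarrow> ('a, 'k) vfield \<Rightarrow> ('a, 'k) vfield" where
  "vf_bracket M X Y = (\<lambda>p f. if smooth_near M p f
     then X p (\<lambda>q. Y q f) - Y p (\<lambda>q. X q f) else 0)"

text \<open>
  Schouten brackets, with \<open>[X, Y \<and> Z] = [X, Y] \<and> Z + Y \<and> [X, Z]\<close> and
  \<open>[X\<^sub>1 \<and> X\<^sub>2, Y\<^sub>1 \<and> Y\<^sub>2] = \<Sum>\<^sub>i\<^sub>,\<^sub>j (-1)\<^sup>i\<^sup>+\<^sup>j [X\<^sub>i, Y\<^sub>j] \<and> X\<^sub>3\<^sub>-\<^sub>i \<and> Y\<^sub>3\<^sub>-\<^sub>j\<close>.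
  Since \<open>u \<and> v = u \<otimes> v - v \<otimes> u\<close> and correspondingly \<open>u \<and> v \<and> w\<close> is the full signed sum of six terms,
  \<open>[A, A]\<close> evaluated on \<open>(f, g, h)\<close> is twice the Jacobiator of \<open>{f, g} = A(f, g)\<close>. In the
  Lie algebra the same formula gives \<open>[\<Lambda>, \<Lambda>] = 2 CYB(\<Lambda>)\<close>, which is \<open>\<phi>\<^sub>s\<close> when \<open>\<Lambda> + s\<close> is
  quasitriangular.
\<close>

definition schouten12 ::
    "('a, 'i, 'k::real_normed_field) mfd \<Rightarrow> ('a, 'k) vfield \<Rightarrow> ('a, 'k) field2 \<Rightarrow> ('a, 'k) field2" where
  "schouten12 M X A = (\<lambda>p f g. if smooth_near M p f \<and> smooth_near M p g
     then X p (\<lambda>q. A q f g) - A p (\<lambda>q. X q f) g - A p f (\<lambda>q. X q g) else 0)"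

definition schouten22 ::
    "('a, 'i, 'k::real_normed_field) mfd \<Rightarrow> ('a, 'k) field2 \<Rightarrow> ('a, 'k) field2 \<Rightarrow> ('a, 'k) field3" where
  "schouten22 M A B = (\<lambda>p f g h. if smooth_near M p f \<and> smooth_near M p g \<and> smooth_near M p h
     then A p f (\<lambda>q. B q g h) + A p g (\<lambda>q. B q h f) + A p h (\<lambda>q. B q f g)
        + B p f (\<lambda>q. A q g h) + B p g (\<lambda>q. A q h f) + B p h (\<lambda>q. A q f g)
     else 0)"


section \<open>Actions and the two categories\<close>

definition left_action ::
    "('k::real_normed_field \<Rightarrow> 'g::ab_group_add \<Rightarrow> 'g) \<Rightarrow> ('g \<Rightarrow> 'g \<Rightarrow> 'g) \<Rightarrow> ('a, 'i, 'k) mfd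
     \<Rightarrow> ('g \<Rightarrow> ('a, 'k) vfield) \<Rightarrow> bool" where
  "left_action scl brk M \<rho> \<longleftrightarrow> (\<forall>x. vector_field M (\<rho> x)) \<and>
     (\<forall>x y. \<rho> (x + y) = \<rho> x + \<rho> y) \<and> (\<forall>c x. \<rho> (scl c x) = (\<lambda>p f. c * \<rho> x p f)) \<and>
     (\<forall>x y. \<rho> (brk x y) = - vf_bracket M (\<rho> x) (\<rho> y))"

text \<open>
  The multiplicative extension of \<open>\<rho>\<close> to tensors: \<open>\<rho>(u \<otimes> v) = \<rho>(u) \<otimes> \<rho>(v)\<close>. At \<open>p\<close> and for
  given functions, \<open>x \<mapsto> \<rho>(x)(f)(p)\<close> is a linear form, at which the tensor can be evaluated; see
  lemma \<open>act2_sum\<close> below.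
\<close>

definition act2 :: "('v \<Rightarrow> ('a, 'k) vfield) \<Rightarrow> ('v, 'k) tensor2 \<Rightarrow> ('a, 'k) field2" where
  "act2 \<rho> a = (\<lambda>p f g. a (\<lambda>x. \<rho> x p f) (\<lambda>x. \<rho> x p g))"

definition act3 :: "('v \<Rightarrow> ('a, 'k) vfield) \<Rightarrow> ('v, 'k) tensor3 \<Rightarrow> ('a, 'k) field3" where
  "act3 \<rho> a = (\<lambda>p f g h. a (\<lambda>x. \<rho> x p f) (\<lambda>x. \<rho> x p g) (\<lambda>x. \<rho> x p h))"

text \<open>Triples \<open>(Y, A, \<rho>)\<close> of a manifold, a bivector field and an action.\<close>

type_synonym ('a, 'i, 'k, 'g) gspace =
  "('a, 'i, 'k) mfd \<times> ('a, 'k) field2 \<times> ('g \<Rightarrow> ('a, 'k) vfield)"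

definition poisson_spaces ::
    "('k::{real_normed_field,euclidean_space} \<Rightarrow> 'g::ab_group_add \<Rightarrow> 'g) \<Rightarrow> ('g \<Rightarrow> 'g \<Rightarrow> 'g)
     \<Rightarrow> ('g \<Rightarrow> ('g, 'k) tensor2) \<Rightarrow> ('a, 'i, 'k, 'g) gspace set" where
  "poisson_spaces scl brk \<delta> = {(M, \<pi>, \<rho>). manifold M \<and> left_action scl brk M \<rho> \<and>
     bivector_field M \<pi> \<and> schouten22 M \<pi> \<pi> = 0 \<and>
     (\<forall>x. schouten12 M (\<rho> x) \<pi> = act2 \<rho> (\<delta> x))}"

definition quasi_poisson_spaces ::
    "('k::{real_normed_field,euclidean_space} \<Rightarrow> 'g::ab_group_add \<Rightarrow> 'g) \<Rightarrow> ('g \<Rightarrow> 'g \<Rightarrow> 'g)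
     \<Rightarrow> ('g, 'k) tensor3 \<Rightarrow> ('a, 'i, 'k, 'g) gspace set" where
  "quasi_poisson_spaces scl brk \<phi> = {(M, Q, \<rho>). manifold M \<and> left_action scl brk M \<rho> \<and>
     bivector_field M Q \<and> (\<forall>x. schouten12 M (\<rho> x) Q = 0) \<and>
     schouten22 M Q Q = act3 \<rho> \<phi>}"

text \<open>
  Morphisms are smooth maps (extensional, so that equality is equality on the points of the source)
  under which the actions and the bivector fields are related.
\<close>

definition gspace_hom ::
    "('a, 'i, 'k::real_normed_field, 'g) gspace \<Rightarrow> ('b, 'j, 'k, 'g) gspace \<Rightarrow> ('a \<Rightarrow> 'b) set" where
  "gspace_hom = (\<lambda>(M, A, \<rho>) (M', A', \<rho>'). {F \<in> extensional (pts M). smooth_map M M' F \<and>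
     (\<forall>p\<in>pts M. \<forall>f g. smooth_near M' (F p) f \<and> smooth_near M' (F p) g \<longrightarrow>
        (\<forall>x. \<rho> x p (f \<circ> F) = \<rho>' x (F p) f) \<and> A p (f \<circ> F) (g \<circ> F) = A' (F p) f g)})"

definition to_quasi ::
    "('g, 'k::real_normed_field) tensor2 \<Rightarrow> ('a, 'i, 'k, 'g) gspace \<Rightarrow> ('a, 'i, 'k, 'g) gspace" where
  "to_quasi \<Lambda> = (\<lambda>(M, \<pi>, \<rho>). (M, \<pi> + act2 \<rho> \<Lambda>, \<rho>))"


section \<open>Products and fusion\<close>

definition prod_mfd :: "('n \<Rightarrow> ('a, 'i, 'k) mfd) \<Rightarrow> ('n \<Rightarrow> 'a, 'n \<times> 'i, 'k) mfd" where
  "prod_mfd M = \<lparr>top_of = product_topology (\<lambda>j. top_of (M j)) UNIV,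
     idx = Sigma UNIV (\<lambda>j. idx (M j)),
     atlas = {(Pi UNIV (\<lambda>j. fst (c j)),
                \<lambda>y. restrict (\<lambda>(j, i). snd (c j) (y j) i) (Sigma UNIV (\<lambda>j. idx (M j)))) | c.
              \<forall>j. c j \<in> atlas (M j)}\<rparr>"

text \<open>
  \<open>(A\<^sub>1, \<dots>, A\<^sub>n)\<close>: the factor \<open>A\<^sub>j\<close> differentiates a function in the \<open>j\<close>-th variable, the other
  variables being held fixed.
\<close>

definition prod_field2 ::
    "('n::finite \<Rightarrow> ('a, 'i, 'k::real_normed_field) mfd) \<Rightarrow> ('n \<Rightarrow> ('a, 'k) field2) \<Rightarrow> ('n \<Rightarrow> 'a, 'k) field2" where
  "prod_field2 M A = (\<lambda>p f g.
     if p \<in> pts (prod_mfd M) \<and> smooth_near (prod_mfd M) p f \<and> smooth_near (prod_mfd M) p g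
     then \<Sum>j\<in>UNIV. A j (p j) (\<lambda>q. f (p(j := q))) (\<lambda>q. g (p(j := q))) else 0)"

definition prod_action ::
    "('n::finite \<Rightarrow> ('a, 'i, 'k::real_normed_field) mfd) \<Rightarrow> ('n \<Rightarrow> 'g \<Rightarrow> ('a, 'k) vfield)
     \<Rightarrow> ('n \<Rightarrow> 'g) \<Rightarrow> ('n \<Rightarrow> 'a, 'k) vfield" where
  "prod_action M \<rho> x = (\<lambda>p f. if p \<in> pts (prod_mfd M) \<and> smooth_near (prod_mfd M) p f
     then \<Sum>j\<in>UNIV. \<rho> j (x j) (p j) (\<lambda>q. f (p(j := q))) else 0)"

definition diag_action ::
    "('n::finite \<Rightarrow> ('a, 'i, 'k::real_normed_field) mfd) \<Rightarrow> ('n \<Rightarrow> 'g \<Rightarrow> ('a, 'k) vfield)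
     \<Rightarrow> 'g \<Rightarrow> ('n \<Rightarrow> 'a, 'k) vfield" where
  "diag_action M \<rho> x = prod_action M \<rho> (\<lambda>_. x)"

text \<open>
  The fusion product in either category, \<open>a\<close> being \<open>r\<close> for \<open>(\<gg>, \<delta>\<^sub>r)\<close>-Poisson spaces and \<open>s\<close> for
  \<open>(\<gg>, \<phi>\<^sub>s)\<close>-quasi-Poisson spaces.
\<close>

definition fusion ::
    "('k::real_normed_field \<Rightarrow> 'g::ab_group_add \<Rightarrow> 'g) \<Rightarrow> ('g, 'k) tensor2
     \<Rightarrow> ('n::{finite,linorder} \<Rightarrow> ('a, 'i, 'k, 'g) gspace) \<Rightarrow> ('n \<Rightarrow> 'a, 'n \<times> 'i, 'k, 'g) gspace" where
  "fusion scl a Y =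
     (let M = (\<lambda>j. fst (Y j)); A = (\<lambda>j. fst (snd (Y j))); \<rho> = (\<lambda>j. snd (snd (Y j)))
      in (prod_mfd M, prod_field2 M A + act2 (prod_action M \<rho>) (Mix scl a), diag_action M \<rho>))"


section \<open>Expressions in terms of a presentation of a tensor\<close>

lemma sum_fun_apply: "(\<Sum>i\<in>I. F i) x = (\<Sum>i\<in>I. F i x)"
  by (induction I rule: infinite_finite_induct) auto

lemma flip_sum: "flip (\<Sum>i<m. tens2 scl (u i) (v i)) = (\<Sum>i<(m::nat). tens2 scl (v i) (u i))"
  by (auto simp: flip_def fun_eq_iff sum_fun_apply tens2_def intro!: sum.cong)

lemma act2_sum:
  assumes "vector_space scl"
    and "\<And>x y. \<rho> (x + y) = \<rho> x + \<rho> y" "\<And>c x. \<rho> (scl c x) = (\<lambda>p f. c * \<rho> x p f)"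
  shows "act2 \<rho> (\<Sum>i<(m::nat). tens2 scl (u i) (v i)) = (\<lambda>p f g. \<Sum>i<m. \<rho> (u i) p f * \<rho> (v i) p g)"
proof -
  interpret vector_space scl by fact
  have "linear_form scl (\<lambda>x. \<rho> x p f)" for p f
    by unfold_locales (auto simp: assms algebra_simps)
  then show ?thesis
    by (simp add: act2_def fun_eq_iff sum_fun_apply tens2_def)
qed

lemma (in lie_algebra) linear_form_brk:
  assumes "linear_form scl \<xi>"
  shows "linear_form scl (\<lambda>x. \<xi> (brk y x))" "linear_form scl (\<lambda>x. \<xi> (brk x y))"
proof -
  interpret \<xi>: Vector_Spaces.linear scl "(*)" \<xi> by fact
  show "linear_form scl (\<lambda>x. \<xi> (brk y x))" "linear_form scl (\<lambda>x. \<xi> (brk x y))"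
    by (unfold_locales; simp add: brk_add_left brk_add_right brk_scale_left brk_scale_right \<xi>.add \<xi>.scale)+
qed

lemma (in vector_space) linear_form_sum:
  assumes "\<And>i. i < (m::nat) \<Longrightarrow> linear_form scale (\<xi> i)"
  shows "linear_form scale (\<lambda>x. \<Sum>i<m. \<xi> i x * c i)"
proof unfold_locales
  have *: "\<xi> i (x + y) = \<xi> i x + \<xi> i y" "\<xi> i (scale a x) = a * \<xi> i x" if "i < m" for i x y a
    using assms[OF that] unfolding module_hom_iff_linear[symmetric]
    by (simp_all add: module_hom.add module_hom.scale)
  show "(\<Sum>i<m. \<xi> i (x + y) * c i) = (\<Sum>i<m. \<xi> i x * c i) + (\<Sum>i<m. \<xi> i y * c i)" for x y
    by (simp add: * algebra_simps sum.distrib)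
  show "(\<Sum>i<m. \<xi> i (scale a x) * c i) = a * (\<Sum>i<m. \<xi> i x * c i)" for a x
    by (simp add: * sum_distrib_left mult.assoc)
qed

lemma CYB_sum:
  assumes "lie_algebra scl brk"
  shows "CYB scl brk (\<Sum>i<(m::nat). tens2 scl (x i) (y i)) =
    (\<Sum>i<m. \<Sum>j<m. tens3 scl (brk (x i) (x j)) (y i) (y j)
                     + tens3 scl (x i) (brk (y i) (x j)) (y j)
                     + tens3 scl (x i) (x j) (brk (y i) (y j)))"
    (is "CYB scl brk ?r = ?R")
proof -
  interpret lie_algebra scl brk by fact
  define r where "r = ?r"
  have r: "r \<xi> \<eta> = (\<Sum>i<m. \<xi> (x i) * \<eta> (y i))" if "linear_form scl \<xi>" "linear_form scl \<eta>" for \<xi> \<eta>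
    using that by (simp add: r_def sum_fun_apply tens2_def)
  have "CYB scl brk r \<xi> \<eta> \<zeta> = ?R \<xi> \<eta> \<zeta>" for \<xi> \<eta> \<zeta>
  proof (cases "linear_form scl \<xi> \<and> linear_form scl \<eta> \<and> linear_form scl \<zeta>")
    case True
    then have [simp]: "linear_form scl \<xi>" "linear_form scl \<eta>" "linear_form scl \<zeta>" by auto
    have s: "linear_form scl (\<lambda>u. \<Sum>j<m. c j * F j u)" if "\<And>j. linear_form scl (F j)" for c F
      using linear_form_sum[of m F c] that by (simp add: mult.commute)
    show ?thesis using True
      by (simp add: CYB_def r linear_form_brk linear_form_sum s sum_fun_apply tens3_def
          sum.distrib sum_distrib_left sum_distrib_right mult_ac)
  next
    case False
    then have "CYB scl brk r \<xi> \<eta> \<zeta> = 0" "tens3 scl u v w \<xi> \<eta> \<zeta> = 0" for u v w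
      by (simp_all only: CYB_def tens3_def if_False)
    then show ?thesis by (simp add: sum_fun_apply)
  qed
  then show ?thesis unfolding r_def by blast
qed

lemma Mix_sum:
  fixes scl :: "'k::field \<Rightarrow> 'v::ab_group_add \<Rightarrow> 'v"
  assumes "vector_space scl"
  shows "Mix scl (\<Sum>i<(m::nat). tens2 scl (u i) (v i)) =
    (\<Sum>(j, k) | j < k. \<Sum>i<m. wedge (pow_scale scl) (summand j (v i)) (summand k (u i)))"
proof -
  interpret vector_space scl by fact
  have l: "linear_form scl (\<xi> \<circ> summand j)" if "linear_form (pow_scale scl) \<xi>" for \<xi> and j :: 'n
  proof -
    interpret \<xi>: Vector_Spaces.linear "pow_scale scl" "(*)" \<xi> by fact
    have "summand j (a + b) = summand j a + summand j b" for a b :: 'v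
      by (auto simp: summand_def fun_eq_iff)
    moreover have "summand j (scl c a) = pow_scale scl c (summand j a)" for c a
      by (auto simp: summand_def pow_scale_def fun_eq_iff)
    ultimately show ?thesis
      by unfold_locales (simp_all add: \<xi>.add \<xi>.scale)
  qed
  have *: "tens_map (pow_scale scl) (summand j) (summand k) (\<Sum>i<m. tens2 scl (u i) (v i)) =
      (\<Sum>i<m. tens2 (pow_scale scl) (summand j (u i)) (summand k (v i)))" for j k :: 'n and u v
    by (auto simp: fun_eq_iff tens_map_def tens2_def sum_fun_apply l)
  show ?thesis
    by (simp add: Mix_def flip_sum * wedge_def sum_subtractf)
qed

end

theory Submission
  imports Defs
begin

text \<open>
  Extend an action \<open>\<lambda>\<close> to tensors. As \<open>\<lambda>\<close> is an anti-homomorphism, \<open>[\<lambda>(x), \<lambda>(a)] = - \<lambda>(ad\<^sub>x a)\<close>, and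
  \<open>[\<lambda>(a), \<lambda>(a)] = - 2 \<lambda>(CYB(a))\<close> for skew \<open>a\<close> (lemmas \<open>schouten12_act2\<close> and \<open>schouten22_act2\<close>). Moreover an
  invariant bivector field has bracket 0 with every \<open>\<lambda>(a)\<close> (lemma \<open>schouten22_invariant_act2\<close>).

  The equivalence follows. Since \<open>s\<close> is invariant, adding \<open>\<lambda>(\<Lambda>)\<close> to \<open>\<pi>\<close> changes \<open>[\<lambda>(x), \<pi>]\<close> by \<open>- \<lambda>(\<delta>\<^sub>r(x))\<close>,
  so \<open>Q = \<pi> + \<lambda>(\<Lambda>)\<close> is invariant exactly if \<open>\<pi>\<close> satisfies the condition of a Poisson space. Then
  \<open>[Q, \<lambda>(\<Lambda>)] = 0\<close> and hence \<open>[Q, Q] = [\<pi>, \<pi>] - [\<lambda>(\<Lambda>), \<lambda>(\<Lambda>)]\<close>. For invariant \<open>s\<close> the mixed terms of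
  \<open>CYB(\<Lambda> + s)\<close> cancel (lemma \<open>CYB_split\<close>), so \<open>CYB(\<Lambda>) = - CYB(s)\<close>, and \<open>[Q, Q] = [\<pi>, \<pi>] + \<lambda>(\<phi>\<^sub>s)\<close>.

  As to fusion, \<open>\<lambda>\<^sub>d\<^sub>i\<^sub>a\<^sub>g(\<Lambda>)\<close> is the sum of all components \<open>\<Lambda>\<^sub>j\<^sub>k\<close>, whose part with \<open>j \<noteq> k\<close> is the negative of
  \<open>Mix(\<Lambda>)\<close>. So the two fusion products correspond to each other as triples (lemma \<open>fusion_to_quasi\<close>), and
  it suffices that the one of the quasi-Poisson spaces is a quasi-Poisson space again. There
  \<open>(Q\<^sub>1, \<dots>, Q\<^sub>n)\<close> is invariant under \<open>\<gg>\<^sup>n\<close>, and its bracket with itself is the sum of the \<open>\<lambda>\<^sub>j(\<phi>\<^sub>s)\<close>. What is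
  left is an identity in \<open>\<gg>\<^sup>n\<close>: the Yang-Baxter expression of \<open>Mix(s)\<close> is the sum of the components of \<open>CYB(s)\<close>
  in three summands that are not all equal (lemma \<open>CYB_Mix\<close>).

  The analytic input is that tangent vectors have an expression in every chart, by the chain rule, that
  products of manifolds and fields lifted from the factors are smooth, and that derivations along
  different factors commute, by the symmetry of second derivatives (lemma \<open>tangent_commute\<close>).
\<close>

section \<open>Calculus in coordinates\<close>

definition pd :: "'i \<Rightarrow> (('i \<Rightarrow> 'k::real_normed_field) \<Rightarrow> 'k) \<Rightarrow> ('i \<Rightarrow> 'k) \<Rightarrow> 'k" where
  "pd i f x = deriv (\<lambda>t. f (x(i := t))) (x i)"

lemma topspace_coord_space: "topspace (coord_space I) = extensional I"
  by (simp add: coord_space_def PiE_def)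

lemma coord_open_subset: "openin (coord_space I) V \<Longrightarrow> V \<subseteq> extensional I"
  using openin_subset topspace_coord_space by metis

text \<open>
  With finitely many coordinates the product topology is that of uniform boxes, so the estimates below
  can be made in terms of \<open>\<epsilon>\<close> and \<open>\<delta>\<close>.
\<close>

lemma coord_open_box:
  fixes V :: "('i \<Rightarrow> 'k::real_normed_field) set"
  assumes I: "finite I" and V: "openin (coord_space I) V" and x: "x \<in> V"
  shows "\<exists>d>0. \<forall>y\<in>extensional I. (\<forall>i\<in>I. dist (y i) (x i) < d) \<longrightarrow> y \<in> V"
proof -
  obtain U where U: "\<forall>i\<in>I. open (U i)" "x \<in> PiE I U" "PiE I U \<subseteq> V"
    using V x unfolding coord_space_def openin_product_topology_alt by auto
  have "\<exists>d>0. \<forall>t. dist t (x i) < d \<longrightarrow> t \<in> U i" if "i \<in> I" for i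
    using U that by (auto simp: open_dist PiE_def Pi_def)
  then obtain D where D: "\<And>i. i \<in> I \<Longrightarrow> D i > 0" "\<And>i t. i \<in> I \<Longrightarrow> dist t (x i) < D i \<Longrightarrow> t \<in> U i"
    by metis
  define d where "d = Min (insert 1 (D ` I))"
  have "d > 0" "\<And>i. i \<in> I \<Longrightarrow> d \<le> D i"
    using I D(1) by (auto simp: d_def)
  then show ?thesis
    using D(2) U(3) by (intro exI[of _ d]) (fastforce simp: PiE_def Pi_def)
qed

lemma coord_open_preimage:
  assumes V: "openin (coord_space I) V"
    and f: "continuous_map (subtopology (coord_space I) V) euclidean f" and U: "open U"
  shows "openin (coord_space I) {x \<in> V. f x \<in> U}"
proof -
  have t: "topspace (subtopology (coord_space I) V) = V"
    using coord_open_subset[OF V] by (auto simp: topspace_coord_space)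
  have "openin (subtopology (coord_space I) V) {x \<in> topspace (subtopology (coord_space I) V). f x \<in> U}"
    using f U by (intro openin_continuous_map_preimage) auto
  then show ?thesis
    unfolding t using openin_open_subtopology[OF V] by blast
qed

lemma cont_coord_box:
  fixes f :: "('i \<Rightarrow> 'k::real_normed_field) \<Rightarrow> 'k"
  assumes I: "finite I" and V: "openin (coord_space I) V"
    and f: "continuous_map (subtopology (coord_space I) V) euclidean f" and x: "x \<in> V" and e: "e > 0"
  shows "\<exists>d>0. \<forall>y\<in>extensional I. (\<forall>i\<in>I. dist (y i) (x i) < d) \<longrightarrow> y \<in> V \<and> dist (f y) (f x) < e"
proof -
  have "openin (coord_space I) {y \<in> V. f y \<in> ball (f x) e}"
    using V f by (rule coord_open_preimage) simp
  from coord_open_box[OF I this, of x] x e show ?thesis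
    by (auto simp: dist_commute)
qed

lemma coord_line_eventually:
  assumes "finite I" "openin (coord_space I) V" "x \<in> V" "i \<in> I"
  shows "\<forall>\<^sub>F t in nhds (x i). x(i := t) \<in> V"
proof -
  obtain d where d: "d > 0" "\<And>y. y \<in> extensional I \<Longrightarrow> \<forall>i\<in>I. dist (y i) (x i) < d \<Longrightarrow> y \<in> V"
    using coord_open_box[OF assms(1-3)] by auto
  have "x \<in> extensional I"
    using assms coord_open_subset by blast
  then have "x(i := t) \<in> V" if "dist t (x i) < d" for t
    using d(1) that assms(4) by (intro d(2)) (auto simp: extensional_def)
  then show ?thesis
    using d(1) eventually_nhds_metric by blast
qed

lemma cont_diff_on_cong:
  assumes "finite I" "openin (coord_space I) V" "\<And>x. x \<in> V \<Longrightarrow> f x = g x"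
  shows "cont_diff_on n I V f \<longleftrightarrow> cont_diff_on n I V g"
proof -
  have c: "continuous_map (subtopology (coord_space I) V) euclidean f \<longleftrightarrow>
     continuous_map (subtopology (coord_space I) V) euclidean g"
    using assms(3) by (intro iffI; elim continuous_map_eq) auto
  have d: "((\<lambda>t. f (x(i := t))) has_field_derivative h) (at (x i)) \<longleftrightarrow>
     ((\<lambda>t. g (x(i := t))) has_field_derivative h) (at (x i))" if "x \<in> V" "i \<in> I" for x i h
    by (rule DERIV_cong_ev)
      (auto intro: eventually_mono[OF coord_line_eventually[OF assms(1,2) that]] assms(3))
  show ?thesis
    by (cases n) (simp_all add: c d cong: ball_cong)
qed

lemma cont_diff_on_SucD: "cont_diff_on (Suc n) I V f \<Longrightarrow> cont_diff_on n I V f"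
  by (induction n arbitrary: f) (auto, blast)

lemma cont_diff_on_SucE:
  assumes "cont_diff_on (Suc n) I V f" "i \<in> I"
  obtains g where "cont_diff_on n I V g"
    "\<And>x. x \<in> V \<Longrightarrow> ((\<lambda>t. f (x(i := t))) has_field_derivative g x) (at (x i))"
  using assms by auto

lemma cont_diff_on_subset: "cont_diff_on n I V f \<Longrightarrow> V' \<subseteq> V \<Longrightarrow> cont_diff_on n I V' f"
  by (induction n arbitrary: f)
    (auto intro: continuous_map_from_subtopology_mono, meson subset_iff)

text \<open>
  The definition provides a derivative for each order separately, as an existential witness. On an open
  set every witness agrees with \<^const>\<open>pd\<close>, so that one function serves for all orders.
\<close>

lemma cont_diff_on_Suc_iff:
  assumes "finite I" "openin (coord_space I) V"
  shows "cont_diff_on (Suc n) I V f \<longleftrightarrow>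
    continuous_map (subtopology (coord_space I) V) euclidean f \<and>
    (\<forall>i\<in>I. (\<forall>x\<in>V. ((\<lambda>t. f (x(i := t))) has_field_derivative pd i f x) (at (x i))) \<and>
       cont_diff_on n I V (pd i f))"
proof -
  have "(\<exists>g. cont_diff_on n I V g \<and> (\<forall>x\<in>V. ((\<lambda>t. f (x(i := t))) has_field_derivative g x) (at (x i))))
    \<longleftrightarrow> (\<forall>x\<in>V. ((\<lambda>t. f (x(i := t))) has_field_derivative pd i f x) (at (x i))) \<and> cont_diff_on n I V (pd i f)"
    for i
  proof
    assume "\<exists>g. cont_diff_on n I V g \<and> (\<forall>x\<in>V. ((\<lambda>t. f (x(i := t))) has_field_derivative g x) (at (x i)))"
    then obtain g where g: "cont_diff_on n I V g"
      "\<forall>x\<in>V. ((\<lambda>t. f (x(i := t))) has_field_derivative g x) (at (x i))" by blast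
    then have "\<forall>x\<in>V. g x = pd i f x"
      by (auto simp: pd_def dest!: DERIV_imp_deriv bspec)
    with g show "(\<forall>x\<in>V. ((\<lambda>t. f (x(i := t))) has_field_derivative pd i f x) (at (x i))) \<and> cont_diff_on n I V (pd i f)"
      using cont_diff_on_cong[OF assms, of g "pd i f"] by simp
  qed blast
  then show ?thesis by simp
qed

lemma coord_smooth_iff:
  assumes "finite I" "openin (coord_space I) V"
  shows "coord_smooth_on I V f \<longleftrightarrow>
    continuous_map (subtopology (coord_space I) V) euclidean f \<and>
    (\<forall>i\<in>I. (\<forall>x\<in>V. ((\<lambda>t. f (x(i := t))) has_field_derivative pd i f x) (at (x i))) \<and>
       coord_smooth_on I V (pd i f))"
proof -
  have "coord_smooth_on I V f \<longleftrightarrow> (\<forall>n. cont_diff_on (Suc n) I V f)"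
    unfolding coord_smooth_on_def using cont_diff_on_SucD by blast
  also have "\<dots> \<longleftrightarrow> continuous_map (subtopology (coord_space I) V) euclidean f \<and>
    (\<forall>i\<in>I. (\<forall>x\<in>V. ((\<lambda>t. f (x(i := t))) has_field_derivative pd i f x) (at (x i))) \<and>
       (\<forall>n. cont_diff_on n I V (pd i f)))"
    unfolding cont_diff_on_Suc_iff[OF assms] by blast
  finally show ?thesis by (simp only: coord_smooth_on_def)
qed

lemma coord_smooth_pd:
  assumes "finite I" "openin (coord_space I) V" "coord_smooth_on I V f" "i \<in> I"
  shows "coord_smooth_on I V (pd i f)"
    and "x \<in> V \<Longrightarrow> ((\<lambda>t. f (x(i := t))) has_field_derivative pd i f x) (at (x i))"
  using assms coord_smooth_iff by blast+

lemma coord_smooth_cong: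
  assumes "finite I" "openin (coord_space I) V" "\<And>x. x \<in> V \<Longrightarrow> f x = g x"
  shows "coord_smooth_on I V f \<longleftrightarrow> coord_smooth_on I V g"
  unfolding coord_smooth_on_def using assms cont_diff_on_cong[of I V f g] by blast

lemma coord_smooth_subset: "coord_smooth_on I V f \<Longrightarrow> V' \<subseteq> V \<Longrightarrow> coord_smooth_on I V' f"
  unfolding coord_smooth_on_def using cont_diff_on_subset by blast

lemma pd_cong:
  assumes "finite I" "openin (coord_space I) V" "\<And>y. y \<in> V \<Longrightarrow> f y = g y" "x \<in> V" "i \<in> I"
  shows "pd i f x = pd i g x"
  unfolding pd_def
  by (intro deriv_cong_ev refl eventually_mono[OF coord_line_eventually[OF assms(1,2,4,5)]] assms(3))

lemma continuous_map_mult':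
  fixes f g :: "'a \<Rightarrow> 'b::real_normed_algebra"
  shows "continuous_map X euclidean f \<Longrightarrow> continuous_map X euclidean g \<Longrightarrow>
    continuous_map X euclidean (\<lambda>x. f x * g x)"
  by (simp add: continuous_map_atin tendsto_mult)

lemma cont_diff_on_const: "cont_diff_on n I V (\<lambda>_. c)"
proof (induction n arbitrary: c)
  case (Suc n)
  have "cont_diff_on n I V (\<lambda>_. 0)" by (rule Suc)
  moreover have "((\<lambda>t. c) has_field_derivative 0) (at (x i))" for x :: "'a \<Rightarrow> 'b" and i
    by simp
  ultimately show ?case
    unfolding cont_diff_on.simps by (intro conjI ballI exI[of _ "\<lambda>_. 0"]) simp_all
qed simp

lemma cont_diff_on_add:
  "cont_diff_on n I V f \<Longrightarrow> cont_diff_on n I V g \<Longrightarrow> cont_diff_on n I V (\<lambda>x. f x + g x)"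
proof (induction n arbitrary: f g)
  case (Suc n)
  have "\<exists>h. cont_diff_on n I V h \<and>
      (\<forall>x\<in>V. ((\<lambda>t. f (x(i := t)) + g (x(i := t))) has_field_derivative h x) (at (x i)))" if i: "i \<in> I" for i
  proof -
    obtain f' where "cont_diff_on n I V f'"
      "\<And>x. x \<in> V \<Longrightarrow> ((\<lambda>t. f (x(i := t))) has_field_derivative f' x) (at (x i))"
      using cont_diff_on_SucE[OF Suc.prems(1) i] by blast
    moreover obtain g' where "cont_diff_on n I V g'"
      "\<And>x. x \<in> V \<Longrightarrow> ((\<lambda>t. g (x(i := t))) has_field_derivative g' x) (at (x i))"
      using cont_diff_on_SucE[OF Suc.prems(2) i] by blast
    ultimately show ?thesis
      by (intro exI[of _ "\<lambda>x. f' x + g' x"] conjI Suc.IH ballI DERIV_add) blast+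
  qed
  then show ?case
    using Suc.prems unfolding cont_diff_on.simps by (blast intro: continuous_map_add)
qed (auto intro: continuous_map_add)

lemma cont_diff_on_mult:
  "cont_diff_on n I V f \<Longrightarrow> cont_diff_on n I V g \<Longrightarrow> cont_diff_on n I V (\<lambda>x. f x * g x)"
proof (induction n arbitrary: f g)
  case (Suc n)
  have "\<exists>h. cont_diff_on n I V h \<and>
      (\<forall>x\<in>V. ((\<lambda>t. f (x(i := t)) * g (x(i := t))) has_field_derivative h x) (at (x i)))" if i: "i \<in> I" for i
  proof -
    obtain f' where f: "cont_diff_on n I V f'"
      "\<And>x. x \<in> V \<Longrightarrow> ((\<lambda>t. f (x(i := t))) has_field_derivative f' x) (at (x i))"
      using cont_diff_on_SucE[OF Suc.prems(1) i] by blast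
    obtain g' where g: "cont_diff_on n I V g'"
      "\<And>x. x \<in> V \<Longrightarrow> ((\<lambda>t. g (x(i := t))) has_field_derivative g' x) (at (x i))"
      using cont_diff_on_SucE[OF Suc.prems(2) i] by blast
    have "((\<lambda>t. f (x(i := t)) * g (x(i := t))) has_field_derivative f' x * g x + g' x * f x) (at (x i))"
      if "x \<in> V" for x
      using DERIV_mult[of "\<lambda>t. f (x(i := t))" "f' x" "x i" UNIV "\<lambda>t. g (x(i := t))" "g' x"] f g that by simp
    moreover have "cont_diff_on n I V (\<lambda>x. f' x * g x + g' x * f x)"
      using f g Suc.prems[THEN cont_diff_on_SucD] by (intro cont_diff_on_add Suc.IH)
    ultimately show ?thesis by blast
  qed
  then show ?case
    using Suc.prems unfolding cont_diff_on.simps by (blast intro: continuous_map_mult')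
qed (auto intro: continuous_map_mult')

lemma coord_smooth_const: "coord_smooth_on I V (\<lambda>_. c)"
  and coord_smooth_add: "coord_smooth_on I V f \<Longrightarrow> coord_smooth_on I V g \<Longrightarrow> coord_smooth_on I V (\<lambda>x. f x + g x)"
  and coord_smooth_mult: "coord_smooth_on I V f \<Longrightarrow> coord_smooth_on I V g \<Longrightarrow> coord_smooth_on I V (\<lambda>x. f x * g x)"
  by (auto simp: coord_smooth_on_def cont_diff_on_const cont_diff_on_add cont_diff_on_mult)

lemma coord_smooth_sum:
  "(\<And>a. a \<in> A \<Longrightarrow> coord_smooth_on I V (f a)) \<Longrightarrow> coord_smooth_on I V (\<lambda>x. \<Sum>a\<in>A. f a x)"
  by (induction A rule: infinite_finite_induct) (auto intro: coord_smooth_const coord_smooth_add)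

text \<open>
  The derivatives of all orders are iterates of \<^const>\<open>pd\<close>, which do not depend on the
  neighbourhood; hence smoothness is a local property.
\<close>

lemma coord_smooth_glue:
  assumes "finite I" "openin (coord_space I) V"
    and "\<And>x. x \<in> V \<Longrightarrow> \<exists>V'. openin (coord_space I) V' \<and> x \<in> V' \<and> V' \<subseteq> V \<and> coord_smooth_on I V' f"
  shows "coord_smooth_on I V f"
proof -
  have "cont_diff_on n I V f"
    if "\<forall>x\<in>V. \<exists>V'. openin (coord_space I) V' \<and> x \<in> V' \<and> V' \<subseteq> V \<and> coord_smooth_on I V' f" for n
    using that
  proof (induction n arbitrary: f)
    have cont: "continuous_map (subtopology (coord_space I) V) euclidean f"
      if *: "\<forall>x\<in>V. \<exists>V'. openin (coord_space I) V' \<and> x \<in> V' \<and> V' \<subseteq> V \<and> coord_smooth_on I V' f" for f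
      unfolding continuous_map_def
    proof (intro conjI allI impI)
      fix U :: "'b set" assume U: "openin euclidean U"
      have "\<exists>T. openin (coord_space I) T \<and> x \<in> T \<and> T \<subseteq> {x \<in> V. f x \<in> U}" if x: "x \<in> V" "f x \<in> U" for x
      proof -
        obtain V' where V': "openin (coord_space I) V'" "x \<in> V'" "V' \<subseteq> V" "coord_smooth_on I V' f"
          using * x by blast
        then have "continuous_map (subtopology (coord_space I) V') euclidean f"
          using coord_smooth_iff[OF assms(1)] by blast
        from coord_open_preimage[OF V'(1) this] U
        have "openin (coord_space I) ({x \<in> V'. f x \<in> U})" by simp
        then show ?thesis using V' x by blast
      qed
      then have "openin (coord_space I) {x \<in> V. f x \<in> U}"
        by (subst openin_subopen) blast
      then show "openin (subtopology (coord_space I) V) {x \<in> topspace (subtopology (coord_space I) V). f x \<in> U}"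
        using assms(2) coord_open_subset[of I V] by (simp add: openin_open_subtopology topspace_coord_space Int_absorb1)
    qed auto
    {
      case 0
      then show ?case using cont by simp
    next
      case (Suc n)
      have "cont_diff_on n I V (pd i f)" if "i \<in> I" for i
      proof (rule Suc.IH, intro ballI)
        fix x assume "x \<in> V"
        then show "\<exists>V'. openin (coord_space I) V' \<and> x \<in> V' \<and> V' \<subseteq> V \<and> coord_smooth_on I V' (pd i f)"
          using Suc.prems coord_smooth_pd(1)[OF assms(1) _ _ \<open>i \<in> I\<close>] by blast
      qed
      moreover have "((\<lambda>t. f (x(i := t))) has_field_derivative pd i f x) (at (x i))" if "i \<in> I" "x \<in> V" for i x
        using Suc.prems \<open>x \<in> V\<close> coord_smooth_pd(2)[OF assms(1) _ _ \<open>i \<in> I\<close>] by blast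
      ultimately show ?case
        using cont[OF Suc.prems] unfolding cont_diff_on_Suc_iff[OF assms(1,2)] by blast
    }
  qed
  then show ?thesis
    using assms(3) coord_smooth_on_def by blast
qed

text \<open>
  The maps \<open>\<theta>\<close> to which this applies are projections to some of the coordinates, and inclusions that give
  constant values to the others. They map coordinate lines to coordinate lines or to points, so that
  partial derivatives of the pullback are again pullbacks.
\<close>

lemma coord_smooth_pullback:
  fixes \<theta> :: "('i \<Rightarrow> 'k::real_normed_field) \<Rightarrow> ('j \<Rightarrow> 'k)"
  assumes \<theta>: "continuous_map (coord_space I) (coord_space J) \<theta>"
    and c: "\<And>i. i \<in> I \<Longrightarrow> (\<exists>l\<in>J. \<forall>x t. \<theta> (x(i := t)) = (\<theta> x)(l := t) \<and> \<theta> x l = x i)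
              \<or> (\<forall>x t. \<theta> (x(i := t)) = \<theta> x)"
    and f: "coord_smooth_on J V f" and V': "\<And>x. x \<in> V' \<Longrightarrow> \<theta> x \<in> V"
  shows "coord_smooth_on I V' (\<lambda>x. f (\<theta> x))"
proof -
  have "continuous_map (subtopology (coord_space I) V') (subtopology (coord_space J) V) \<theta>"
    using \<theta> V' by (auto simp: continuous_map_in_subtopology continuous_map_from_subtopology)
  then have cont: "continuous_map (subtopology (coord_space I) V') euclidean (\<lambda>x. f (\<theta> x))"
    if "continuous_map (subtopology (coord_space J) V) euclidean f" for f :: "('j \<Rightarrow> 'k) \<Rightarrow> 'k"
    using continuous_map_compose[OF _ that] by (auto simp: comp_def)
  have "cont_diff_on n I V' (\<lambda>x. f (\<theta> x))" if "cont_diff_on n J V f" for n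
    using that
  proof (induction n arbitrary: f)
    case (Suc n)
    have "\<exists>g. cont_diff_on n I V' g \<and> (\<forall>x\<in>V'. ((\<lambda>t. f (\<theta> (x(i := t)))) has_field_derivative g x) (at (x i)))"
      if "i \<in> I" for i
      using c[OF that]
    proof
      assume "\<exists>l\<in>J. \<forall>x t. \<theta> (x(i := t)) = (\<theta> x)(l := t) \<and> \<theta> x l = x i"
      then obtain l where l: "l \<in> J" "\<And>x t. \<theta> (x(i := t)) = (\<theta> x)(l := t)" "\<And>x. \<theta> x l = x i" by blast
      obtain g where g: "cont_diff_on n J V g" "\<forall>x\<in>V. ((\<lambda>t. f (x(l := t))) has_field_derivative g x) (at (x l))"
        using Suc.prems l(1) by auto
      then show ?thesis
        using V' by (intro exI[of _ "\<lambda>x. g (\<theta> x)"]) (force intro: Suc.IH simp: l simp flip: l(3))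
    next
      assume "\<forall>x t. \<theta> (x(i := t)) = \<theta> x"
      then show ?thesis
        by (intro exI[of _ "\<lambda>x. 0"]) (auto intro: cont_diff_on_const)
    qed
    then show ?case
      using cont Suc.prems by auto
  qed (use cont in auto)
  with f show ?thesis by (auto simp: coord_smooth_on_def)
qed

text \<open>The remainder estimate behind both the chain rule and the symmetry of second derivatives.\<close>

lemma mean_value_ball:
  fixes f :: "'k::real_normed_field \<Rightarrow> 'k"
  assumes "\<And>z. z \<in> ball x0 d \<Longrightarrow> (f has_field_derivative f' z) (at z)"
    and "\<And>z. z \<in> ball x0 d \<Longrightarrow> norm (f' z - c) \<le> B" and "a \<in> ball x0 d" "b \<in> ball x0 d"
  shows "norm (f b - f a - c * (b - a)) \<le> B * norm (b - a)"
proof -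
  have "norm ((f b - c * b) - (f a - c * a)) \<le> B * norm (b - a)"
  proof (rule field_differentiable_bound[of "ball x0 d" "\<lambda>z. f z - c * z" "\<lambda>z. f' z - c"])
    show "((\<lambda>z. f z - c * z) has_field_derivative f' z - c) (at z within ball x0 d)" if "z \<in> ball x0 d" for z
      using assms(1)[OF that] by (auto intro!: derivative_eq_intros intro: has_field_derivative_at_within)
  qed (use assms in auto)
  then show ?thesis by (simp add: algebra_simps)
qed

text \<open>
  The coordinates are set in motion one after the other. Each step changes a single coordinate, where
  the mean value inequality applies, and the continuity of the partial derivatives makes its relative
  error small.
\<close>

lemma pd_chain:
  fixes F :: "('i \<Rightarrow> 'k::real_normed_field) \<Rightarrow> 'k"
  assumes I: "finite I" and V: "openin (coord_space I) V" and F: "coord_smooth_on I V F" and x: "\<gamma> t0 \<in> V"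
    and ext: "\<forall>\<^sub>F t in nhds t0. \<gamma> t \<in> extensional I"
    and \<gamma>: "\<And>i. i \<in> I \<Longrightarrow> ((\<lambda>t. \<gamma> t i) has_field_derivative d i) (at t0)"
  shows "((\<lambda>t. F (\<gamma> t)) has_field_derivative (\<Sum>i\<in>I. pd i F (\<gamma> t0) * d i)) (at t0)"
proof -
  define x where "x = \<gamma> t0"
  have xV: "x \<in> V" and xe: "x \<in> extensional I"
    using assms(4) coord_open_subset[OF V] by (auto simp: x_def)
  \<comment> \<open>Only the coordinates in \<open>S\<close> move, the others are kept at \<open>x\<close>.\<close>
  define G where "G S t = (\<lambda>i. if i \<in> S then \<gamma> t i else x i)" for S t
  have G0: "G S t0 = x" for S by (auto simp: G_def x_def)
  have "((\<lambda>t. F (G S t)) has_field_derivative (\<Sum>i\<in>S. pd i F x * d i)) (at t0)" if "finite S" "S \<subseteq> I" for S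
    using that
  proof (induction S rule: finite_induct)
    case empty
    then show ?case by (simp add: G_def)
  next
    case (insert l S)
    then have l: "l \<in> I" "l \<notin> S" "S \<subseteq> I" by auto
    define c where "c = pd l F x"
    define \<Delta> where "\<Delta> t = \<gamma> t l - x l" for t
    define h where "h t = F (G (insert l S) t) - F (G S t)" for t
    \<comment> \<open>The relative error. Where \<open>\<Delta> t = 0\<close> it is 0, and the numerator vanishes as well.\<close>
    define \<rho> where "\<rho> t = (h t - c * \<Delta> t) / \<Delta> t" for t
    have h0: "h t = 0" if "\<Delta> t = 0" for t
    proof -
      have "G (insert l S) t = G S t"
        using that l by (auto simp: G_def \<Delta>_def)
      then show ?thesis by (simp add: h_def)
    qed
    have cont: "((\<lambda>t. \<gamma> t i) \<longlongrightarrow> x i) (at t0)" if "i \<in> I" for i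
      using DERIV_isCont[OF \<gamma>[OF that]] by (simp add: isCont_def x_def)
    have "(\<rho> \<longlongrightarrow> 0) (at t0)"
    proof (rule tendstoI)
      fix e :: real assume e: "e > 0"
      have "continuous_map (subtopology (coord_space I) V) euclidean (pd l F)"
        using coord_smooth_pd(1)[OF I V F l(1)] coord_smooth_iff[OF I V] by blast
      from cont_coord_box[OF I V this xV, of "e / 2"] e obtain b where b: "b > 0"
        "\<And>y. y \<in> extensional I \<Longrightarrow> \<forall>i\<in>I. dist (y i) (x i) < b \<Longrightarrow> y \<in> V \<and> dist (pd l F y) c < e / 2"
        by (auto simp: c_def)
      have "\<forall>\<^sub>F t in at t0. \<forall>i\<in>I. dist (\<gamma> t i) (x i) < b"
        using I cont b(1) by (intro eventually_ball_finite ballI) (auto dest: tendstoD)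
      then show "\<forall>\<^sub>F t in at t0. dist (\<rho> t) 0 < e"
      proof eventually_elim
        case (elim t)
        have y: "(G S t)(l := z) \<in> V \<and> dist (pd l F ((G S t)(l := z))) c < e / 2" if "z \<in> ball (x l) b" for z
          using elim l that xe b(1) by (intro b(2)) (auto simp: G_def extensional_def dist_commute)
        have "norm (F ((G S t)(l := \<gamma> t l)) - F ((G S t)(l := x l)) - c * (\<gamma> t l - x l)) \<le> e / 2 * norm (\<gamma> t l - x l)"
        proof (rule mean_value_ball[where f = "\<lambda>z. F ((G S t)(l := z))" and f' = "\<lambda>z. pd l F ((G S t)(l := z))"])
          show "((\<lambda>z. F ((G S t)(l := z))) has_field_derivative pd l F ((G S t)(l := z))) (at z)"
            if "z \<in> ball (x l) b" for z
            using coord_smooth_pd(2)[OF I V F l(1), of "(G S t)(l := z)"] y[OF that] by simp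
          show "norm (pd l F ((G S t)(l := z)) - c) \<le> e / 2" if "z \<in> ball (x l) b" for z
            using y[OF that] by (simp add: dist_norm)
        qed (use elim l b(1) in \<open>auto simp: dist_commute\<close>)
        moreover have "(G S t)(l := \<gamma> t l) = G (insert l S) t" "(G S t)(l := x l) = G S t"
          using l by (auto simp: G_def)
        ultimately have "norm (h t - c * \<Delta> t) \<le> e / 2 * norm (\<Delta> t)"
          by (simp add: h_def \<Delta>_def)
        then have "norm (\<rho> t) \<le> e / 2"
          using e by (cases "\<Delta> t = 0") (auto simp: \<rho>_def norm_divide field_simps)
        with e show ?case by simp
      qed
    qed
    moreover have \<Delta>: "((\<lambda>t. \<Delta> t / (t - t0)) \<longlongrightarrow> d l) (at t0)"
      using \<gamma>[OF l(1)] by (simp add: has_field_derivative_iff \<Delta>_def x_def)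
    ultimately have lim: "((\<lambda>t. (c + \<rho> t) * (\<Delta> t / (t - t0))) \<longlongrightarrow> (c + 0) * d l) (at t0)"
      by (intro tendsto_intros)
    have eq: "(c + \<rho> t) * (\<Delta> t / (t - t0)) = (h t - h t0) / (t - t0)" for t
    proof -
      have "(c + \<rho> t) * \<Delta> t = h t"
        using h0[of t] by (cases "\<Delta> t = 0") (auto simp: \<rho>_def field_simps)
      moreover have "h t0 = 0" by (simp add: h_def G0)
      ultimately show ?thesis by simp
    qed
    have "(h has_field_derivative c * d l) (at t0)"
      using lim by (simp only: has_field_derivative_iff eq add_0_right)
    then have "((\<lambda>t. h t + F (G S t)) has_field_derivative c * d l + (\<Sum>i\<in>S. pd i F x * d i)) (at t0)"
      using insert by (intro DERIV_add) auto
    then show ?case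
      using insert by (simp add: h_def c_def)
  qed
  from this[OF I order.refl] have "((\<lambda>t. F (G I t)) has_field_derivative (\<Sum>i\<in>I. pd i F x * d i)) (at t0)" .
  moreover have "\<forall>\<^sub>F t in nhds t0. F (G I t) = F (\<gamma> t)"
    using ext
  proof eventually_elim
    case (elim t)
    then have "G I t = \<gamma> t"
      using xe by (auto simp: G_def extensional_def fun_eq_iff)
    then show ?case by simp
  qed
  ultimately show ?thesis
    by (simp add: x_def DERIV_cong_ev)
qed

text \<open>
  The mean value inequality is used twice: in the coordinate \<open>i\<close> for the increment of \<open>f\<close> in the
  coordinate \<open>l\<close>, whose derivative is in turn an increment of \<open>pd i f\<close>.
\<close>

lemma pd_increment:
  fixes f :: "('i \<Rightarrow> 'k::real_normed_field) \<Rightarrow> 'k"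
  assumes I: "finite I" and V: "openin (coord_space I) V" and f: "coord_smooth_on I V f" and i: "i \<in> I" "l \<in> I" "i \<noteq> l"
    and b: "\<And>s t. s \<in> ball (x i) b \<Longrightarrow> t \<in> ball (x l) b \<Longrightarrow>
       x(i := s, l := t) \<in> V \<and> norm (pd l (pd i f) (x(i := s, l := t)) - c) \<le> e"
    and st: "s \<in> ball (x i) b" "t \<in> ball (x l) b"
  shows "norm (f (x(i := s, l := t)) - f (x(i := s)) - f (x(l := t)) + f x - c * (t - x l) * (s - x i))
    \<le> e * norm (t - x l) * norm (s - x i)"
proof -
  have b0: "b > 0"
    using st(1) zero_le_dist[of "x i" s] by (simp only: mem_ball)
  note D = coord_smooth_pd(2)[OF I V]
  have li: "x(i := s, l := x l) = x(i := s)" for s using i by auto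
  have 1: "norm (pd i f (x(i := s, l := t)) - pd i f (x(i := s)) - c * (t - x l)) \<le> e * norm (t - x l)"
    if s: "s \<in> ball (x i) b" for s
  proof -
    have "norm (pd i f (x(i := s, l := t)) - pd i f (x(i := s, l := x l)) - c * (t - x l)) \<le> e * norm (t - x l)"
    proof (rule mean_value_ball[where f = "\<lambda>t. pd i f (x(i := s, l := t))"
          and f' = "\<lambda>t. pd l (pd i f) (x(i := s, l := t))"])
      show "((\<lambda>t. pd i f (x(i := s, l := t))) has_field_derivative pd l (pd i f) (x(i := s, l := z))) (at z)"
        if "z \<in> ball (x l) b" for z
        using D[OF coord_smooth_pd(1)[OF I V f i(1)] i(2), of "x(i := s, l := z)"] b[OF s that] by simp
    qed (use b s st b0 in auto)
    then show ?thesis by (simp add: li)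
  qed
  have "norm ((f (x(i := s, l := t)) - f (x(i := s))) - (f (x(i := x i, l := t)) - f (x(i := x i)))
      - c * (t - x l) * (s - x i)) \<le> (e * norm (t - x l)) * norm (s - x i)"
  proof (rule mean_value_ball[where f = "\<lambda>s. f (x(i := s, l := t)) - f (x(i := s))"
        and f' = "\<lambda>s. pd i f (x(i := s, l := t)) - pd i f (x(i := s))"])
    fix z assume z: "z \<in> ball (x i) b"
    have *: "x(i := s, l := t) = x(l := t, i := s)" for s t using i by auto
    have "((\<lambda>s. f (x(i := s, l := t))) has_field_derivative pd i f (x(i := z, l := t))) (at z)"
      using D[OF f i(1), of "x(i := z, l := t)"] b[OF z st(2)] by (simp add: *)
    moreover have "((\<lambda>s. f (x(i := s))) has_field_derivative pd i f (x(i := z))) (at z)"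
      using D[OF f i(1), of "x(i := z)"] b[OF z, of "x l"] b0 by (simp add: li)
    ultimately show "((\<lambda>s. f (x(i := s, l := t)) - f (x(i := s))) has_field_derivative
        pd i f (x(i := z, l := t)) - pd i f (x(i := z))) (at z)"
      by (rule DERIV_diff)
  qed (use 1 st b0 in auto)
  then show ?thesis by (simp add: algebra_simps)
qed

text \<open>The second difference over a small square is close to its area times either mixed derivative.\<close>

lemma pd_commute:
  fixes f :: "('i \<Rightarrow> 'k::real_normed_field) \<Rightarrow> 'k"
  assumes I: "finite I" and V: "openin (coord_space I) V" and f: "coord_smooth_on I V f" and x: "x \<in> V"
    and i: "i \<in> I" "l \<in> I"
  shows "pd i (pd l f) x = pd l (pd i f) x"
proof (cases "i = l")
  case False
  define c1 where "c1 = pd l (pd i f) x"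
  define c2 where "c2 = pd i (pd l f) x"
  have "norm (c1 - c2) \<le> 2 * e" if e: "e > 0" for e
  proof -
    have box: "\<exists>b>0. \<forall>y\<in>extensional I. (\<forall>i\<in>I. dist (y i) (x i) < b) \<longrightarrow>
        y \<in> V \<and> dist (pd l (pd i f) y) (pd l (pd i f) x) < e" if "i \<in> I" "l \<in> I" for i l
      by (rule cont_coord_box[OF I V _ x e])
        (use coord_smooth_pd(1)[OF I V] coord_smooth_iff[OF I V] f that in blast)
    obtain b1 where b1: "b1 > 0" "\<And>y. y \<in> extensional I \<Longrightarrow> \<forall>i\<in>I. dist (y i) (x i) < b1 \<Longrightarrow>
        y \<in> V \<and> dist (pd l (pd i f) y) c1 < e"
      using box[OF i] by (auto simp: c1_def)
    obtain b2 where b2: "b2 > 0" "\<And>y. y \<in> extensional I \<Longrightarrow> \<forall>i\<in>I. dist (y i) (x i) < b2 \<Longrightarrow>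
        y \<in> V \<and> dist (pd i (pd l f) y) c2 < e"
      using box[OF i(2,1)] by (auto simp: c2_def)
    define b where "b = min b1 b2"
    have b: "b > 0" "b \<le> b1" "b \<le> b2" using b1 b2 by (auto simp: b_def)
    have xe: "x \<in> extensional I"
      using x coord_open_subset[OF V] by blast
    define s where "s = x i + of_real (b / 2)"
    define t where "t = x l + of_real (b / 2)"
    have n: "norm (of_real (b / 2) :: 'k) = b / 2"
      unfolding norm_of_real using b(1) by simp
    then have st: "s \<in> ball (x i) b" "t \<in> ball (x l) b"
      using b(1) by (simp_all add: s_def t_def dist_norm)
    define D where "D = f (x(i := s, l := t)) - f (x(i := s)) - f (x(l := t)) + f x"
    have "norm (D - c1 * (t - x l) * (s - x i)) \<le> e * norm (t - x l) * norm (s - x i)"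
      unfolding D_def
    proof (rule pd_increment[OF I V f i False _ st])
      fix s t assume "s \<in> ball (x i) b" "t \<in> ball (x l) b"
      then have "x(i := s, l := t) \<in> V \<and> dist (pd l (pd i f) (x(i := s, l := t))) c1 < e"
        using xe i b by (intro b1(2)) (auto simp: extensional_def dist_commute)
      then show "x(i := s, l := t) \<in> V \<and> norm (pd l (pd i f) (x(i := s, l := t)) - c1) \<le> e"
        by (simp add: dist_norm)
    qed
    moreover have "norm (f (x(l := t, i := s)) - f (x(l := t)) - f (x(i := s)) + f x - c2 * (s - x i) * (t - x l))
        \<le> e * norm (s - x i) * norm (t - x l)"
    proof (rule pd_increment[OF I V f i(2,1) False[symmetric] _ st(2,1)])
      fix t s assume "t \<in> ball (x l) b" "s \<in> ball (x i) b"
      then have "x(l := t, i := s) \<in> V \<and> dist (pd i (pd l f) (x(l := t, i := s))) c2 < e"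
        using xe i b by (intro b2(2)) (auto simp: extensional_def dist_commute)
      then show "x(l := t, i := s) \<in> V \<and> norm (pd i (pd l f) (x(l := t, i := s)) - c2) \<le> e"
        by (simp add: dist_norm)
    qed
    then have "norm (D - c2 * (t - x l) * (s - x i)) \<le> e * norm (t - x l) * norm (s - x i)"
      using False by (simp add: D_def fun_upd_twist algebra_simps)
    ultimately have "norm ((D - c2 * (t - x l) * (s - x i)) - (D - c1 * (t - x l) * (s - x i)))
        \<le> e * norm (t - x l) * norm (s - x i) + e * norm (t - x l) * norm (s - x i)"
      by (intro norm_triangle_le_diff) linarith
    also have "(D - c2 * (t - x l) * (s - x i)) - (D - c1 * (t - x l) * (s - x i)) = (c1 - c2) * ((t - x l) * (s - x i))"
      by (simp add: algebra_simps)
    finally have "norm (c1 - c2) * (b / 2 * (b / 2)) \<le> 2 * e * (b / 2 * (b / 2))"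
      unfolding norm_mult by (simp add: s_def t_def n mult_ac del: of_real_divide)
    moreover have "b / 2 * (b / 2) > 0" using b(1) by simp
    ultimately show ?thesis
      using mult_le_cancel_right_pos by blast
  qed
  from this[of "norm (c1 - c2) / 4"] have "norm (c1 - c2) = 0"
    by (cases "norm (c1 - c2) = 0") (auto simp: field_simps)
  then show ?thesis by (simp add: c1_def c2_def)
qed simp

lemma pd_const [simp]: "pd i (\<lambda>_. c) x = 0"
  by (simp add: pd_def)

lemma pd_add:
  assumes "finite I" "openin (coord_space I) V" "coord_smooth_on I V f" "coord_smooth_on I V g" "i \<in> I" "x \<in> V"
  shows "pd i (\<lambda>y. f y + g y) x = pd i f x + pd i g x"
  unfolding pd_def[of i "\<lambda>y. f y + g y"]
  by (intro DERIV_imp_deriv DERIV_add coord_smooth_pd(2)[OF assms(1,2)] assms)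

lemma pd_mult:
  assumes "finite I" "openin (coord_space I) V" "coord_smooth_on I V f" "coord_smooth_on I V g" "i \<in> I" "x \<in> V"
  shows "pd i (\<lambda>y. f y * g y) x = pd i f x * g x + f x * pd i g x"
  unfolding pd_def[of i "\<lambda>y. f y * g y"]
  using DERIV_mult[OF coord_smooth_pd(2)[OF assms(1-3,5,6)] coord_smooth_pd(2)[OF assms(1,2,4-6)]]
  by (intro DERIV_imp_deriv) (simp add: mult.commute)

lemma pd_sum:
  assumes "finite I" "openin (coord_space I) V" "\<And>a. a \<in> A \<Longrightarrow> coord_smooth_on I V (f a)" "i \<in> I" "x \<in> V"
  shows "pd i (\<lambda>y. \<Sum>a\<in>A. f a y) x = (\<Sum>a\<in>A. pd i (f a) x)"
  unfolding pd_def[of i "\<lambda>y. \<Sum>a\<in>A. f a y"]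
  by (intro DERIV_imp_deriv DERIV_sum coord_smooth_pd(2)[OF assms(1,2)] assms)

section \<open>Smooth functions on a manifold\<close>

text \<open>The expression of a function in the coordinates of a chart.\<close>

abbreviation in_chart :: "('a, 'i, 'k) chart \<Rightarrow> ('a \<Rightarrow> 'b) \<Rightarrow> ('i \<Rightarrow> 'k) \<Rightarrow> 'b" where
  "in_chart c f \<equiv> f \<circ> the_inv_into (fst c) (snd c)"

lemma manifold_finite: "manifold M \<Longrightarrow> finite (idx M)"
  by (simp add: manifold_def)

lemma chart_exists:
  assumes "manifold M" "p \<in> pts M"
  shows "\<exists>c\<in>atlas M. p \<in> fst c"
proof -
  have "(\<Union>(W, \<phi>)\<in>atlas M. W) = pts M"
    using assms(1) by (simp add: manifold_def)
  with assms(2) obtain c where "c \<in> atlas M" "p \<in> (case c of (W, \<phi>) \<Rightarrow> W)"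
    by blast
  then show ?thesis by (auto simp: case_prod_unfold)
qed

lemma chart_open:
  assumes "manifold M" "c \<in> atlas M"
  shows "openin (top_of M) (fst c)" "inj_on (snd c) (fst c)"
    and "openin (coord_space (idx M)) (snd c ` fst c)"
    and "openin (top_of M) U \<Longrightarrow> openin (coord_space (idx M)) (snd c ` (U \<inter> fst c))"
proof -
  obtain W \<phi> where c: "c = (W, \<phi>)" by fastforce
  have *: "openin (top_of M) W" "openin (coord_space (idx M)) (\<phi> ` W)"
    "homeomorphic_map (subtopology (top_of M) W) (subtopology (coord_space (idx M)) (\<phi> ` W)) \<phi>"
    using assms by (auto simp: manifold_def is_chart_def c)
  have t: "topspace (subtopology (top_of M) W) = W"
    using openin_subset[OF *(1)] by auto
  show "openin (top_of M) (fst c)" "openin (coord_space (idx M)) (snd c ` fst c)"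
    using * by (simp_all add: c)
  show "inj_on (snd c) (fst c)"
    using homeomorphic_imp_injective_map[OF *(3)] t by (simp add: c)
  show "openin (coord_space (idx M)) (snd c ` (U \<inter> fst c))" if "openin (top_of M) U"
  proof -
    have "openin (subtopology (top_of M) W) (U \<inter> W)"
      using that by (simp add: openin_subtopology_Int)
    then have "openin (subtopology (coord_space (idx M)) (\<phi> ` W)) (\<phi> ` (U \<inter> W))"
      using homeomorphic_imp_open_map[OF *(3)] by (simp add: open_map_def)
    then show ?thesis
      using openin_open_subtopology[OF *(2)] by (simp add: c)
  qed
qed

lemma chart_inv [simp]:
  assumes "manifold M" "c \<in> atlas M"
  shows "p \<in> fst c \<Longrightarrow> the_inv_into (fst c) (snd c) (snd c p) = p"
    and "x \<in> snd c ` fst c \<Longrightarrow> snd c (the_inv_into (fst c) (snd c) x) = x"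
    and "x \<in> snd c ` fst c \<Longrightarrow> the_inv_into (fst c) (snd c) x \<in> fst c"
  using chart_open(2)[OF assms]
  by (auto simp: the_inv_into_f_f f_the_inv_into_f the_inv_into_into)

lemma chart_extensional:
  assumes "manifold M" "c \<in> atlas M" "p \<in> fst c"
  shows "snd c p \<in> extensional (idx M)"
  using coord_open_subset[OF chart_open(3)[OF assms(1,2)]] assms(3) by blast

lemma smooth_onD:
  "smooth_on M U f \<Longrightarrow> c \<in> atlas M \<Longrightarrow>
    coord_smooth_on (idx M) (snd c ` (U \<inter> fst c)) (in_chart c f)"
  unfolding smooth_on_def by (cases c) auto

lemma smooth_onI:
  assumes "openin (top_of M) U"
    and "\<And>c. c \<in> atlas M \<Longrightarrow>
      coord_smooth_on (idx M) (snd c ` (U \<inter> fst c)) (in_chart c f)"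
  shows "smooth_on M U f"
  unfolding smooth_on_def using assms by force

lemma smooth_on_open: "smooth_on M U f \<Longrightarrow> openin (top_of M) U"
  by (simp add: smooth_on_def)

lemma smooth_on_subset: "smooth_on M U f \<Longrightarrow> openin (top_of M) U' \<Longrightarrow> U' \<subseteq> U \<Longrightarrow> smooth_on M U' f"
  by (rule smooth_onI) (auto intro: coord_smooth_subset[OF smooth_onD])

lemma smooth_on_cong:
  assumes M: "manifold M" and f: "smooth_on M U f" and eq: "\<And>p. p \<in> U \<Longrightarrow> f p = g p"
  shows "smooth_on M U g"
proof (rule smooth_onI)
  show U: "openin (top_of M) U" using f by (rule smooth_on_open)
  fix c assume c: "c \<in> atlas M"
  have "coord_smooth_on (idx M) (snd c ` (U \<inter> fst c)) (in_chart c f) \<longleftrightarrow>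
      coord_smooth_on (idx M) (snd c ` (U \<inter> fst c)) (in_chart c g)"
    by (rule coord_smooth_cong[OF manifold_finite[OF M] chart_open(4)[OF M c U]]) (use M c eq in auto)
  with smooth_onD[OF f c]
  show "coord_smooth_on (idx M) (snd c ` (U \<inter> fst c)) (in_chart c g)"
    by simp
qed

lemma smooth_on_const: "openin (top_of M) U \<Longrightarrow> smooth_on M U (\<lambda>_. a)"
  by (rule smooth_onI) (auto simp: comp_def intro: coord_smooth_const)

lemma smooth_on_add: "smooth_on M U f \<Longrightarrow> smooth_on M U g \<Longrightarrow> smooth_on M U (\<lambda>p. f p + g p)"
  using smooth_onD[of M U f] smooth_onD[of M U g]
  by (intro smooth_onI) (auto simp: comp_def intro: coord_smooth_add smooth_on_open)

lemma smooth_on_mult: "smooth_on M U f \<Longrightarrow> smooth_on M U g \<Longrightarrow> smooth_on M U (\<lambda>p. f p * g p)"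
  using smooth_onD[of M U f] smooth_onD[of M U g]
  by (intro smooth_onI) (auto simp: comp_def intro: coord_smooth_mult smooth_on_open)

lemma smooth_near_pts: "smooth_near M p f \<Longrightarrow> p \<in> pts M"
  unfolding smooth_near_def using smooth_on_open openin_subset by blast

lemma smooth_on_near: "smooth_on M U f \<Longrightarrow> p \<in> U \<Longrightarrow> smooth_near M p f"
  unfolding smooth_near_def by blast

lemma smooth_near2:
  assumes "smooth_near M p f" "smooth_near M p g"
  obtains U where "p \<in> U" "smooth_on M U f" "smooth_on M U g"
proof -
  obtain U1 U2 where U: "p \<in> U1" "smooth_on M U1 f" "p \<in> U2" "smooth_on M U2 g"
    using assms unfolding smooth_near_def by blast
  from openin_Int[OF smooth_on_open[OF U(2)] smooth_on_open[OF U(4)]] show ?thesis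
    using U(1,3) by (intro that[of "U1 \<inter> U2"] smooth_on_subset[OF U(2)] smooth_on_subset[OF U(4)]) auto
qed

lemma smooth_near_const: "p \<in> pts M \<Longrightarrow> smooth_near M p (\<lambda>_. a)"
  by (rule smooth_on_near[OF smooth_on_const[OF openin_topspace]])

lemma smooth_near_add: "smooth_near M p f \<Longrightarrow> smooth_near M p g \<Longrightarrow> smooth_near M p (\<lambda>q. f q + g q)"
  by (erule (1) smooth_near2) (rule smooth_on_near[OF smooth_on_add])

lemma smooth_near_mult: "smooth_near M p f \<Longrightarrow> smooth_near M p g \<Longrightarrow> smooth_near M p (\<lambda>q. f q * g q)"
  by (erule (1) smooth_near2) (rule smooth_on_near[OF smooth_on_mult])

lemma smooth_near_sum:
  "p \<in> pts M \<Longrightarrow> (\<And>a. a \<in> A \<Longrightarrow> smooth_near M p (f a)) \<Longrightarrow> smooth_near M p (\<lambda>q. \<Sum>a\<in>A. f a q)"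
  by (induction A rule: infinite_finite_induct) (auto intro: smooth_near_const smooth_near_add)

lemma smooth_near_cong:
  assumes "manifold M" "smooth_near M p f" "openin (top_of M) U" "p \<in> U" "\<And>q. q \<in> U \<Longrightarrow> f q = g q"
  shows "smooth_near M p g"
proof -
  obtain U' where U': "p \<in> U'" "smooth_on M U' f"
    using assms(2) by (auto simp: smooth_near_def)
  then have "smooth_on M (U \<inter> U') f"
    using assms(3) smooth_on_open[OF U'(2)] by (intro smooth_on_subset[OF U'(2)]) auto
  then have "smooth_on M (U \<inter> U') g"
    by (rule smooth_on_cong[OF assms(1)]) (use assms(5) in blast)
  then show ?thesis
    by (rule smooth_on_near) (use U' assms(4) in blast)
qed

lemma smooth_on_if_near:
  assumes M: "manifold M" and U: "openin (top_of M) U" and f: "\<And>p. p \<in> U \<Longrightarrow> smooth_near M p f"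
  shows "smooth_on M U f"
proof (rule smooth_onI[OF U])
  fix c assume c: "c \<in> atlas M"
  show "coord_smooth_on (idx M) (snd c ` (U \<inter> fst c)) (in_chart c f)"
  proof (rule coord_smooth_glue[OF manifold_finite[OF M] chart_open(4)[OF M c U]])
    fix x assume "x \<in> snd c ` (U \<inter> fst c)"
    then obtain p where p: "p \<in> U" "p \<in> fst c" "x = snd c p" by auto
    obtain U' where U': "p \<in> U'" "smooth_on M U' f"
      using f[OF p(1)] by (auto simp: smooth_near_def)
    define V where "V = snd c ` ((U \<inter> U') \<inter> fst c)"
    have "openin (top_of M) (U \<inter> U')"
      using U smooth_on_open[OF U'(2)] by blast
    then have "openin (coord_space (idx M)) V"
      unfolding V_def by (rule chart_open(4)[OF M c])
    moreover have "coord_smooth_on (idx M) V (in_chart c f)"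
      using smooth_onD[OF U'(2) c] by (rule coord_smooth_subset) (auto simp: V_def)
    ultimately show "\<exists>V. openin (coord_space (idx M)) V \<and> x \<in> V \<and> V \<subseteq> snd c ` (U \<inter> fst c) \<and>
        coord_smooth_on (idx M) V (in_chart c f)"
      using p U' by (intro exI[of _ V]) (auto simp: V_def)
  qed
qed

text \<open>In the coordinates of another chart, a coordinate function is a component of a transition map.\<close>

lemma smooth_on_coord:
  assumes M: "manifold M" and c: "c \<in> atlas M" and i: "i \<in> idx M"
  shows "smooth_on M (fst c) (\<lambda>p. snd c p i)"
proof (rule smooth_onI[OF chart_open(1)[OF M c]])
  have all: "\<forall>a\<in>atlas M. \<forall>b\<in>atlas M. \<forall>i\<in>idx M.
      coord_smooth_on (idx M) (snd a ` (fst a \<inter> fst b)) (\<lambda>x. snd b (the_inv_into (fst a) (snd a) x) i)"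
    using M unfolding manifold_def case_prod_unfold by (elim conjE)
  fix c' assume "c' \<in> atlas M"
  then have "coord_smooth_on (idx M) (snd c' ` (fst c' \<inter> fst c)) (\<lambda>x. snd c (the_inv_into (fst c') (snd c') x) i)"
    using c i all by blast
  then show "coord_smooth_on (idx M) (snd c' ` (fst c \<inter> fst c')) (in_chart c' (\<lambda>p. snd c p i))"
    by (simp add: comp_def Int_commute)
qed

section \<open>Tangent vectors\<close>

definition chart_pd :: "('a, 'i, 'k::real_normed_field) chart \<Rightarrow> 'i \<Rightarrow> ('a \<Rightarrow> 'k) \<Rightarrow> 'a \<Rightarrow> 'k" where
  "chart_pd c i f p = pd i (in_chart c f) (snd c p)"

definition chart_vector ::
    "('a, 'i, 'k::real_normed_field) mfd \<Rightarrow> ('a, 'i, 'k) chart \<Rightarrow> ('i \<Rightarrow> 'k) \<Rightarrow> 'a \<Rightarrow> ('a \<Rightarrow> 'k) \<Rightarrow> 'k" where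
  "chart_vector M c a p f = (if smooth_near M p f then \<Sum>i\<in>idx M. a i * chart_pd c i f p else 0)"

lemma tangent_space_iff:
  "v \<in> tangent_space M p \<longleftrightarrow> (\<exists>c\<in>atlas M. p \<in> fst c \<and> (\<exists>a. v = chart_vector M c a p))"
  by (simp add: tangent_space_def chart_vector_def chart_pd_def pd_def fun_eq_iff comp_def Bex_def split_beta)

text \<open>
  Tangent vectors at \<open>p\<close> and, for a bivector field \<open>A\<close>, the maps \<open>A p f\<close> are derivations in this sense.
  The calculations with brackets use nothing else about them.
\<close>

definition derivation_at :: "('a, 'i, 'k::real_normed_field) mfd \<Rightarrow> 'a \<Rightarrow> (('a \<Rightarrow> 'k) \<Rightarrow> 'k) \<Rightarrow> bool" where
  "derivation_at M p v \<longleftrightarrow>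
     (\<forall>f g. smooth_near M p f \<and> smooth_near M p g \<longrightarrow>
        v (\<lambda>q. f q + g q) = v f + v g \<and> v (\<lambda>q. f q * g q) = v f * g p + f p * v g) \<and>
     (\<forall>c. v (\<lambda>_. c) = 0) \<and> (\<forall>f. \<not> smooth_near M p f \<longrightarrow> v f = 0) \<and>
     (\<forall>f g U. openin (top_of M) U \<and> p \<in> U \<and> (\<forall>q\<in>U. f q = g q) \<longrightarrow> v f = v g)"

context
  fixes M :: "('a, 'i, 'k::real_normed_field) mfd" and p v
  assumes d: "derivation_at M p v"
begin

lemma derivation_add:
  "smooth_near M p f \<Longrightarrow> smooth_near M p g \<Longrightarrow> v (\<lambda>q. f q + g q) = v f + v g"
  using d by (simp add: derivation_at_def)

lemma derivation_mult:
  "smooth_near M p f \<Longrightarrow> smooth_near M p g \<Longrightarrow> v (\<lambda>q. f q * g q) = v f * g p + f p * v g"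
  using d by (simp add: derivation_at_def)

lemma derivation_const: "v (\<lambda>_. c) = 0"
  using d by (simp add: derivation_at_def)

lemma derivation_not_smooth: "\<not> smooth_near M p f \<Longrightarrow> v f = 0"
  using d by (simp add: derivation_at_def)

lemma derivation_cong:
  "openin (top_of M) U \<Longrightarrow> p \<in> U \<Longrightarrow> (\<And>q. q \<in> U \<Longrightarrow> f q = g q) \<Longrightarrow> v f = v g"
  using d unfolding derivation_at_def by blast

lemma derivation_cmult:
  assumes f: "smooth_near M p f"
  shows "v (\<lambda>q. c * f q) = c * v f"
  using derivation_mult[OF smooth_near_const[OF smooth_near_pts[OF f]] f, of c] by (simp add: derivation_const)

lemma derivation_sum:
  "p \<in> pts M \<Longrightarrow> (\<And>a. a \<in> A \<Longrightarrow> smooth_near M p (f a)) \<Longrightarrow> v (\<lambda>q. \<Sum>a\<in>A. f a q) = (\<Sum>a\<in>A. v (f a))"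
proof (induction A rule: infinite_finite_induct)
  case (insert a A)
  then show ?case
    using derivation_add[of "f a" "\<lambda>q. \<Sum>a\<in>A. f a q"] by (simp add: smooth_near_sum)
qed (auto simp: derivation_const)

end

lemma derivation_atI:
  assumes "\<And>f g. smooth_near M p f \<Longrightarrow> smooth_near M p g \<Longrightarrow> v (\<lambda>q. f q + g q) = v f + v g"
    and "\<And>f g. smooth_near M p f \<Longrightarrow> smooth_near M p g \<Longrightarrow> v (\<lambda>q. f q * g q) = v f * g p + f p * v g"
    and "\<And>c. v (\<lambda>_. c) = 0" and "\<And>f. \<not> smooth_near M p f \<Longrightarrow> v f = 0"
    and "\<And>f g U. openin (top_of M) U \<Longrightarrow> p \<in> U \<Longrightarrow> (\<And>q. q \<in> U \<Longrightarrow> f q = g q) \<Longrightarrow> v f = v g"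
  shows "derivation_at M p v"
  unfolding derivation_at_def
proof (intro conjI)
  show "\<forall>f g U. openin (top_of M) U \<and> p \<in> U \<and> (\<forall>q\<in>U. f q = g q) \<longrightarrow> v f = v g"
    using assms(5) by blast
qed (use assms(1-4) in simp_all)

lemma derivation_at_zero: "derivation_at M p (\<lambda>_. 0)"
  by (rule derivation_atI) simp_all

lemma derivation_at_add:
  assumes v: "derivation_at M p v" and w: "derivation_at M p w"
  shows "derivation_at M p (\<lambda>f. v f + w f)"
proof (rule derivation_atI)
  show "v f + w f = v g + w g"
    if "openin (top_of M) U" "p \<in> U" "\<And>q. q \<in> U \<Longrightarrow> f q = g q" for f g U
    using derivation_cong[OF v that(1,2), of f g] derivation_cong[OF w that(1,2), of f g] that(3) by simp
qed (simp_all add: derivation_add[OF v] derivation_add[OF w] derivation_mult[OF v] derivation_mult[OF w]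
    derivation_const[OF v] derivation_const[OF w] derivation_not_smooth[OF v] derivation_not_smooth[OF w] algebra_simps)

lemma derivation_at_cmult:
  assumes v: "derivation_at M p v"
  shows "derivation_at M p (\<lambda>f. a * v f)"
proof (rule derivation_atI)
  show "a * v f = a * v g"
    if "openin (top_of M) U" "p \<in> U" "\<And>q. q \<in> U \<Longrightarrow> f q = g q" for f g U
    using derivation_cong[OF v that(1,2), of f g] that(3) by simp
qed (simp_all add: derivation_add[OF v] derivation_mult[OF v] derivation_const[OF v]
    derivation_not_smooth[OF v] algebra_simps)

lemma derivation_at_sum:
  "(\<And>a. a \<in> A \<Longrightarrow> derivation_at M p (v a)) \<Longrightarrow> derivation_at M p (\<lambda>f. \<Sum>a\<in>A. v a f)"
  by (induction A rule: infinite_finite_induct) (auto intro: derivation_at_zero derivation_at_add)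

lemma derivation_at_chart_pd:
  assumes M: "manifold M" and c: "c \<in> atlas M" and p: "p \<in> fst c" and i: "i \<in> idx M"
  shows "derivation_at M p (\<lambda>f. if smooth_near M p f then chart_pd c i f p else 0)"
proof -
  note fin = manifold_finite[OF M]
  have x: "snd c p \<in> snd c ` (U \<inter> fst c)" if "p \<in> U" for U
    using that p by blast
  have cong: "chart_pd c i f p = chart_pd c i g p"
    if "openin (top_of M) U" "p \<in> U" "\<forall>q\<in>U. f q = g q" for f g U
    unfolding chart_pd_def
    by (rule pd_cong[OF fin chart_open(4)[OF M c that(1)] _ x i]) (use that M c in auto)
  have 1: "chart_pd c i (\<lambda>q. f q + g q) p = chart_pd c i f p + chart_pd c i g p"
    "chart_pd c i (\<lambda>q. f q * g q) p = chart_pd c i f p * g p + f p * chart_pd c i g p"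
    if fg: "smooth_near M p f" "smooth_near M p g" for f g
  proof -
    obtain U where U: "p \<in> U" "smooth_on M U f" "smooth_on M U g"
      using smooth_near2[OF fg] .
    have o: "openin (coord_space (idx M)) (snd c ` (U \<inter> fst c))"
      using chart_open(4)[OF M c smooth_on_open[OF U(2)]] .
    show "chart_pd c i (\<lambda>q. f q + g q) p = chart_pd c i f p + chart_pd c i g p"
      using pd_add[OF fin o smooth_onD[OF U(2) c] smooth_onD[OF U(3) c] i x[OF U(1)]]
      by (simp add: chart_pd_def comp_def)
    show "chart_pd c i (\<lambda>q. f q * g q) p = chart_pd c i f p * g p + f p * chart_pd c i g p"
      using pd_mult[OF fin o smooth_onD[OF U(2) c] smooth_onD[OF U(3) c] i x[OF U(1)]] M c p
      by (simp add: chart_pd_def comp_def)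
  qed
  have 2: "smooth_near M p f \<longleftrightarrow> smooth_near M p g"
    if U: "openin (top_of M) U" "p \<in> U" and eq: "\<And>q. q \<in> U \<Longrightarrow> f q = g q" for f g U
    using smooth_near_cong[OF M _ U, of f g] smooth_near_cong[OF M _ U, of g f] eq by auto
  show ?thesis
  proof (rule derivation_atI)
    show "(if smooth_near M p (\<lambda>_. a) then chart_pd c i (\<lambda>_. a) p else 0) = 0" for a
      by (simp add: chart_pd_def comp_def)
    show "(if smooth_near M p f then chart_pd c i f p else 0) = (if smooth_near M p g then chart_pd c i g p else 0)"
      if "openin (top_of M) U" "p \<in> U" "\<And>q. q \<in> U \<Longrightarrow> f q = g q" for f g U
      using 2[of U f g] cong[of U f g] that by simp
  qed (simp_all add: 1 smooth_near_add smooth_near_mult)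
qed

lemma tangent_derivation:
  assumes "manifold M" "v \<in> tangent_space M p"
  shows "derivation_at M p v"
proof -
  obtain c a where c: "c \<in> atlas M" "p \<in> fst c" "v = chart_vector M c a p"
    using assms(2) unfolding tangent_space_iff by blast
  have "derivation_at M p (\<lambda>f. \<Sum>i\<in>idx M. a i * (if smooth_near M p f then chart_pd c i f p else 0))"
    by (intro derivation_at_sum derivation_at_cmult derivation_at_chart_pd assms c)
  also have "(\<lambda>f. \<Sum>i\<in>idx M. a i * (if smooth_near M p f then chart_pd c i f p else 0)) = v"
    by (auto simp: c chart_vector_def fun_eq_iff)
  finally show ?thesis .
qed

text \<open>This is the chain rule for the transition map from \<open>c'\<close> to \<open>c\<close>.\<close>

lemma chart_pd_change:
  assumes M: "manifold M" and c: "c \<in> atlas M" "p \<in> fst c" and c': "c' \<in> atlas M" "p \<in> fst c'"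
    and f: "smooth_near M p f" and i: "i \<in> idx M"
  shows "chart_pd c' i f p = (\<Sum>l\<in>idx M. chart_pd c l f p * chart_pd c' i (\<lambda>q. snd c q l) p)"
proof -
  note fin = manifold_finite[OF M]
  define t0 where "t0 = snd c' p i"
  define \<beta> where "\<beta> t = the_inv_into (fst c') (snd c') ((snd c' p)(i := t))" for t
  define \<gamma> where "\<gamma> t = snd c (\<beta> t)" for t
  obtain U where U: "p \<in> U" "smooth_on M U f"
    using f by (auto simp: smooth_near_def)
  have \<beta>0: "\<beta> t0 = p" using M c' by (simp add: \<beta>_def t0_def)
  have o: "openin (top_of M) (fst c)" using chart_open(1)[OF M c(1)] .
  have "\<forall>\<^sub>F t in nhds t0. (snd c' p)(i := t) \<in> snd c' ` (fst c \<inter> fst c')"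
    unfolding t0_def
    by (rule coord_line_eventually[OF fin chart_open(4)[OF M c'(1) o] _ i]) (use c c' in blast)
  then have ev: "\<forall>\<^sub>F t in nhds t0. \<beta> t \<in> fst c"
    by (rule eventually_mono) (use M c' in \<open>auto simp: \<beta>_def\<close>)
  have "((\<lambda>t. (in_chart c f) (\<gamma> t)) has_field_derivative
      (\<Sum>l\<in>idx M. pd l (in_chart c f) (\<gamma> t0) * chart_pd c' i (\<lambda>q. snd c q l) p)) (at t0)"
  proof (rule pd_chain[OF fin chart_open(4)[OF M c(1) smooth_on_open[OF U(2)]] smooth_onD[OF U(2) c(1)]])
    show "\<gamma> t0 \<in> snd c ` (U \<inter> fst c)"
      using U c by (auto simp: \<gamma>_def \<beta>0)
    show "\<forall>\<^sub>F t in nhds t0. \<gamma> t \<in> extensional (idx M)"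
      using ev by (rule eventually_mono) (use chart_extensional[OF M c(1)] in \<open>auto simp: \<gamma>_def\<close>)
    fix l assume l: "l \<in> idx M"
    show "((\<lambda>t. \<gamma> t l) has_field_derivative chart_pd c' i (\<lambda>q. snd c q l) p) (at t0)"
      using coord_smooth_pd(2)[OF fin chart_open(4)[OF M c'(1) o] smooth_onD[OF smooth_on_coord[OF M c(1) l] c'(1)] i,
          of "snd c' p"] c c'
      by (auto simp: \<gamma>_def \<beta>_def chart_pd_def t0_def)
  qed
  moreover have "\<forall>\<^sub>F t in nhds t0. (in_chart c f) (\<gamma> t) = f (\<beta> t)"
    using ev by (rule eventually_mono) (use M c in \<open>auto simp: \<gamma>_def\<close>)
  ultimately have "((\<lambda>t. f (\<beta> t)) has_field_derivative
      (\<Sum>l\<in>idx M. pd l (in_chart c f) (\<gamma> t0) * chart_pd c' i (\<lambda>q. snd c q l) p)) (at t0)"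
    by (simp add: DERIV_cong_ev)
  then have "deriv (\<lambda>t. f (\<beta> t)) t0 =
      (\<Sum>l\<in>idx M. pd l (in_chart c f) (\<gamma> t0) * chart_pd c' i (\<lambda>q. snd c q l) p)"
    by (rule DERIV_imp_deriv)
  moreover have "chart_pd c' i f p = deriv (\<lambda>t. f (\<beta> t)) t0"
    by (simp add: chart_pd_def pd_def \<beta>_def t0_def)
  moreover have "chart_pd c l f p = pd l (in_chart c f) (\<gamma> t0)" for l
    unfolding chart_pd_def \<gamma>_def \<beta>0 ..
  ultimately show ?thesis by simp
qed

text \<open>
  A tangent vector comes with some chart at its base point, which may vary from point to point along a
  vector field. In a fixed chart its coefficients are its values on the coordinate functions; for a
  smooth vector field these depend smoothly on the point.
\<close>

lemma tangent_in_chart: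
  assumes M: "manifold M" and v: "v \<in> tangent_space M p" and c: "c \<in> atlas M" "p \<in> fst c"
  shows "v = chart_vector M c (\<lambda>i. v (\<lambda>q. snd c q i)) p"
proof (rule ext)
  fix f
  obtain c' a where c': "c' \<in> atlas M" "p \<in> fst c'" "v = chart_vector M c' a p"
    using v unfolding tangent_space_iff by blast
  have s: "smooth_near M p (\<lambda>q. snd c q i)" if "i \<in> idx M" for i
    using smooth_on_near[OF smooth_on_coord[OF M c(1) that] c(2)] .
  show "v f = chart_vector M c (\<lambda>i. v (\<lambda>q. snd c q i)) p f"
  proof (cases "smooth_near M p f")
    case True
    have "v f = (\<Sum>i\<in>idx M. a i * (\<Sum>l\<in>idx M. chart_pd c l f p * chart_pd c' i (\<lambda>q. snd c q l) p))"
      using True by (simp add: c'(3) chart_vector_def chart_pd_change[OF M c c'(1,2)])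
    also have "\<dots> = (\<Sum>l\<in>idx M. (\<Sum>i\<in>idx M. a i * chart_pd c' i (\<lambda>q. snd c q l) p) * chart_pd c l f p)"
      by (simp add: sum_distrib_left sum_distrib_right mult_ac) (rule sum.swap)
    also have "\<dots> = chart_vector M c (\<lambda>i. v (\<lambda>q. snd c q i)) p f"
      using True s by (simp add: c'(3) chart_vector_def)
    finally show ?thesis .
  qed (simp add: c'(3) chart_vector_def)
qed

lemma tangent_formula:
  assumes "manifold M" "v \<in> tangent_space M p" "c \<in> atlas M" "p \<in> fst c" "smooth_near M p f"
  shows "v f = (\<Sum>i\<in>idx M. v (\<lambda>q. snd c q i) * chart_pd c i f p)"
  using tangent_in_chart[OF assms(1-4), THEN fun_cong, of f] assms(5) by (simp add: chart_vector_def)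

lemma tangent_zero:
  assumes "manifold M" "p \<in> pts M"
  shows "0 \<in> tangent_space M p"
proof -
  obtain c where "c \<in> atlas M" "p \<in> fst c"
    using chart_exists[OF assms] by blast
  moreover have "0 = chart_vector M c (\<lambda>_. 0) p"
    by (auto simp: chart_vector_def fun_eq_iff)
  ultimately show ?thesis
    unfolding tangent_space_iff by blast
qed

lemma tangent_add:
  assumes "manifold M" "v \<in> tangent_space M p" "w \<in> tangent_space M p"
  shows "v + w \<in> tangent_space M p"
proof -
  obtain c where c: "c \<in> atlas M" "p \<in> fst c"
    using assms(2) unfolding tangent_space_iff by blast
  define a where "a u i = u (\<lambda>q. snd c q i)" for u :: "('a \<Rightarrow> 'c) \<Rightarrow> 'c" and i
  have "v f + w f = chart_vector M c (\<lambda>i. a v i + a w i) p f" for f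
    using tangent_in_chart[OF assms(1,2) c, THEN fun_cong, of f] tangent_in_chart[OF assms(1,3) c, THEN fun_cong, of f]
    by (simp add: chart_vector_def a_def ring_distribs sum.distrib)
  then have "v + w = chart_vector M c (\<lambda>i. a v i + a w i) p"
    by (simp add: fun_eq_iff)
  then show ?thesis
    using c unfolding tangent_space_iff by blast
qed

lemma vector_field_zero: "manifold M \<Longrightarrow> vector_field M 0"
  unfolding vector_field_def using tangent_zero
  by (auto simp: zero_fun_def intro: smooth_near_const smooth_near_pts)

lemma vector_field_add: "manifold M \<Longrightarrow> vector_field M X \<Longrightarrow> vector_field M Y \<Longrightarrow> vector_field M (X + Y)"
  unfolding vector_field_def by (simp add: tangent_add smooth_near_add)

lemma vector_field_sum:
  "manifold M \<Longrightarrow> (\<And>a. a \<in> A \<Longrightarrow> vector_field M (X a)) \<Longrightarrow> vector_field M (\<Sum>a\<in>A. X a)"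
  by (induction A rule: infinite_finite_induct) (auto intro: vector_field_zero vector_field_add)

lemma vector_field_tangent: "vector_field M X \<Longrightarrow> p \<in> pts M \<Longrightarrow> X p \<in> tangent_space M p"
  by (simp add: vector_field_def)

lemma vector_field_smooth: "vector_field M X \<Longrightarrow> smooth_near M p f \<Longrightarrow> smooth_near M p (\<lambda>q. X q f)"
  by (simp add: vector_field_def)

lemma vector_field_not_smooth: "manifold M \<Longrightarrow> vector_field M X \<Longrightarrow> \<not> smooth_near M p f \<Longrightarrow> X p f = 0"
  using tangent_derivation[of M "X p" p] derivation_not_smooth[of M p "X p" f]
  by (cases "p \<in> pts M") (auto simp: vector_field_def)

lemma vector_field_derivation: "manifold M \<Longrightarrow> vector_field M X \<Longrightarrow> p \<in> pts M \<Longrightarrow> derivation_at M p (X p)"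
  by (simp add: tangent_derivation vector_field_tangent)

section \<open>Bivector fields\<close>

lemma bivector_decomp:
  assumes "bivector_field M A" "p \<in> pts M"
  obtains m :: nat and v w where "\<forall>i<m. v i \<in> tangent_space M p" "\<forall>i<m. w i \<in> tangent_space M p"
    "A p = (\<lambda>f g. \<Sum>i<m. v i f * w i g)"
proof -
  have "\<exists>(m::nat) v w. (\<forall>i<m. v i \<in> tangent_space M p \<and> w i \<in> tangent_space M p) \<and>
      A p = (\<lambda>f g. \<Sum>i<m. v i f * w i g)"
    using assms unfolding bivector_field_def by blast
  then show ?thesis using that by blast
qed

lemma bivector_skew: "bivector_field M A \<Longrightarrow> A p f g = - A p g f"
  unfolding bivector_field_def by blast

lemma bivector_smooth:
  "bivector_field M A \<Longrightarrow> smooth_near M p f \<Longrightarrow> smooth_near M p g \<Longrightarrow> smooth_near M p (\<lambda>q. A q f g)"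
  unfolding bivector_field_def by blast

lemma bivector_derivation:
  assumes "manifold M" "bivector_field M A" "p \<in> pts M"
  shows "derivation_at M p (A p f)" "derivation_at M p (\<lambda>g. A p g f)"
proof -
  obtain m :: nat and v w where A: "\<forall>i<m. v i \<in> tangent_space M p" "\<forall>i<m. w i \<in> tangent_space M p"
    "A p = (\<lambda>f g. \<Sum>i<m. v i f * w i g)"
    using bivector_decomp[OF assms(2,3)] .
  have "derivation_at M p (\<lambda>g. \<Sum>i<m. v i f * w i g)" for f
    using A(2) by (intro derivation_at_sum derivation_at_cmult tangent_derivation assms) auto
  then show 1: "derivation_at M p (A p f)" for f by (simp add: A(3))
  show "derivation_at M p (\<lambda>g. A p g f)"
    using derivation_at_cmult[OF 1, of "-1"] bivector_skew[OF assms(2), of p _ f] by simp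
qed

lemma bivector_formula:
  assumes M: "manifold M" and A: "bivector_field M A" and c: "c \<in> atlas M" "p \<in> fst c"
    and f: "smooth_near M p f" and g: "smooth_near M p g"
  shows "A p f g = (\<Sum>i\<in>idx M. \<Sum>l\<in>idx M.
    A p (\<lambda>q. snd c q i) (\<lambda>q. snd c q l) * chart_pd c i f p * chart_pd c l g p)"
proof -
  have p: "p \<in> pts M" using f by (rule smooth_near_pts)
  obtain m :: nat and v w where v: "\<forall>a<m. v a \<in> tangent_space M p" "\<forall>a<m. w a \<in> tangent_space M p"
    "A p = (\<lambda>f g. \<Sum>a<m. v a f * w a g)"
    using bivector_decomp[OF A p] .
  have "A p f g = (\<Sum>a<m. (\<Sum>i\<in>idx M. v a (\<lambda>q. snd c q i) * chart_pd c i f p) *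
      (\<Sum>l\<in>idx M. w a (\<lambda>q. snd c q l) * chart_pd c l g p))"
    unfolding v(3) using v(1,2)
    by (intro sum.cong refl arg_cong2[where f = "(*)"] tangent_formula[OF M _ c] f g) auto
  also have "\<dots> = (\<Sum>a<m. \<Sum>i\<in>idx M. \<Sum>l\<in>idx M. v a (\<lambda>q. snd c q i) * w a (\<lambda>q. snd c q l) * chart_pd c i f p * chart_pd c l g p)"
    by (simp add: sum_product mult_ac)
  also have "\<dots> = (\<Sum>i\<in>idx M. \<Sum>a<m. \<Sum>l\<in>idx M. v a (\<lambda>q. snd c q i) * w a (\<lambda>q. snd c q l) * chart_pd c i f p * chart_pd c l g p)"
    by (rule sum.swap)
  also have "\<dots> = (\<Sum>i\<in>idx M. \<Sum>l\<in>idx M. \<Sum>a<m. v a (\<lambda>q. snd c q i) * w a (\<lambda>q. snd c q l) * chart_pd c i f p * chart_pd c l g p)"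
    by (intro sum.cong refl sum.swap)
  finally show ?thesis
    by (simp add: v(3) sum_distrib_right)
qed

lemma bivector_field_zero: "manifold M \<Longrightarrow> bivector_field M 0"
  unfolding bivector_field_def
  by (auto simp: zero_fun_def intro: smooth_near_const smooth_near_pts intro!: exI[of _ "0::nat"])

lemma bivector_field_add:
  assumes "manifold M" "bivector_field M A" "bivector_field M B"
  shows "bivector_field M (A + B)"
  unfolding bivector_field_def
proof (intro conjI ballI allI impI)
  fix p assume p: "p \<in> pts M"
  obtain m :: nat and v w where A: "\<forall>i<m. v i \<in> tangent_space M p" "\<forall>i<m. w i \<in> tangent_space M p"
    "A p = (\<lambda>f g. \<Sum>i<m. v i f * w i g)"
    using bivector_decomp[OF assms(2) p] .
  obtain m' :: nat and v' w' where B: "\<forall>i<m'. v' i \<in> tangent_space M p" "\<forall>i<m'. w' i \<in> tangent_space M p"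
    "B p = (\<lambda>f g. \<Sum>i<m'. v' i f * w' i g)"
    using bivector_decomp[OF assms(3) p] .
  define V where "V i = (if i < m then v i else v' (i - m))" for i
  define W where "W i = (if i < m then w i else w' (i - m))" for i
  have split: "(\<Sum>i<m+m'. F i) = (\<Sum>i<m. F i) + (\<Sum>i<m'. F (i + m))" for F :: "nat \<Rightarrow> 'c"
    by (induction m') (auto simp: add.commute add.left_commute)
  have "(A + B) p = (\<lambda>f g. \<Sum>i<m+m'. V i f * W i g)"
    by (auto simp: split V_def W_def A(3) B(3) fun_eq_iff)
  moreover have "\<forall>i<m+m'. V i \<in> tangent_space M p \<and> W i \<in> tangent_space M p"
    using A B by (auto simp: V_def W_def)
  ultimately show "\<exists>(m::nat) v w. (\<forall>i<m. v i \<in> tangent_space M p \<and> w i \<in> tangent_space M p) \<and>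
      (A + B) p = (\<lambda>f g. \<Sum>i<m. v i f * w i g)"
    by blast
next
  show "(A + B) p f g = - (A + B) p g f" for p f g
    using bivector_skew[OF assms(2), of p f g] bivector_skew[OF assms(3), of p f g] by simp
  show "(A + B) p = 0" if "p \<notin> pts M" for p
    using assms that by (simp add: bivector_field_def)
  show "smooth_near M p (\<lambda>q. (A + B) q f g)" if "smooth_near M p f \<and> smooth_near M p g" for p f g
    using assms(2,3)[THEN bivector_smooth, of p f g] that by (simp add: smooth_near_add)
qed

lemma bivector_field_sum:
  "manifold M \<Longrightarrow> (\<And>a. a \<in> S \<Longrightarrow> bivector_field M (A a)) \<Longrightarrow> bivector_field M (\<Sum>a\<in>S. A a)"
  by (induction S rule: infinite_finite_induct) (auto intro: bivector_field_zero bivector_field_add)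

section \<open>Product manifolds\<close>

text \<open>Boxes whose sides belong to countable bases of the factors form a countable base.\<close>

lemma second_countable_product_topology:
  assumes I: "finite I" and X: "\<And>i. i \<in> I \<Longrightarrow> second_countable (X i)"
  shows "second_countable (product_topology X I)"
proof -
  have "\<exists>B. countable B \<and> (\<forall>V\<in>B. openin (X i) V) \<and> (\<forall>U x. openin (X i) U \<and> x \<in> U \<longrightarrow> (\<exists>V\<in>B. x \<in> V \<and> V \<subseteq> U))"
    if "i \<in> I" for i
    using X[OF that] by (simp add: second_countable_def)
  then obtain B where B: "\<And>i. i \<in> I \<Longrightarrow> countable (B i)" "\<And>i V. i \<in> I \<Longrightarrow> V \<in> B i \<Longrightarrow> openin (X i) V"
    "\<And>i U x. i \<in> I \<Longrightarrow> openin (X i) U \<Longrightarrow> x \<in> U \<Longrightarrow> \<exists>V\<in>B i. x \<in> V \<and> V \<subseteq> U"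
    by metis
  show ?thesis
    unfolding second_countable_def
  proof (intro exI[of _ "PiE I ` PiE I B"] conjI ballI allI impI)
    show "countable (PiE I ` PiE I B)"
      using I B(1) by (intro countable_image countable_PiE)
    show "openin (product_topology X I) V" if "V \<in> PiE I ` PiE I B" for V
      using that I B(2) by (auto simp: openin_PiE_gen PiE_mem)
    fix U x assume U: "openin (product_topology X I) U \<and> x \<in> U"
    then obtain T where T: "\<forall>i\<in>I. openin (X i) (T i)" "x \<in> PiE I T" "PiE I T \<subseteq> U"
      unfolding openin_product_topology_alt by blast
    have "\<exists>V\<in>B i. x i \<in> V \<and> V \<subseteq> T i" if "i \<in> I" for i
      using T that by (intro B(3)) (auto simp: PiE_mem)
    then obtain b where b: "\<And>i. i \<in> I \<Longrightarrow> b i \<in> B i \<and> x i \<in> b i \<and> b i \<subseteq> T i"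
      by metis
    have "PiE I (restrict b I) = PiE I b"
      by (auto simp: PiE_def Pi_def)
    moreover have "x \<in> PiE I b"
      using b T(2) by (auto simp: PiE_def Pi_def)
    moreover have "PiE I b \<subseteq> U"
      using PiE_mono[of I b T] b T(3) by blast
    moreover have "restrict b I \<in> PiE I B"
      using b by auto
    ultimately show "\<exists>V\<in>PiE I ` PiE I B. x \<in> V \<and> V \<subseteq> U"
      by blast
  qed
qed

lemma pts_prod_mfd: "p \<in> pts (prod_mfd M) \<longleftrightarrow> (\<forall>j. p j \<in> pts (M j))"
  by (auto simp: prod_mfd_def)

abbreviation prod_idx :: "('n \<Rightarrow> ('a, 'i, 'k) mfd) \<Rightarrow> ('n \<times> 'i) set" where
  "prod_idx M \<equiv> Sigma UNIV (\<lambda>j. idx (M j))"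

lemma idx_prod_mfd: "idx (prod_mfd M) = prod_idx M"
  by (simp add: prod_mfd_def)

definition prod_chart ::
    "('n \<Rightarrow> ('a, 'i, 'k) mfd) \<Rightarrow> ('n \<Rightarrow> ('a, 'i, 'k) chart) \<Rightarrow> ('n \<Rightarrow> 'a, 'n \<times> 'i, 'k) chart" where
  "prod_chart M c = (Pi UNIV (\<lambda>j. fst (c j)),
     \<lambda>y. restrict (\<lambda>(j, i). snd (c j) (y j) i) (prod_idx M))"

lemma atlas_prod_mfd: "atlas (prod_mfd M) = {prod_chart M c | c. \<forall>j. c j \<in> atlas (M j)}"
  by (simp add: prod_mfd_def prod_chart_def)

lemma fst_prod_chart: "p \<in> fst (prod_chart M c) \<longleftrightarrow> (\<forall>j. p j \<in> fst (c j))"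
  by (auto simp: prod_chart_def)

lemma snd_prod_chart: "i \<in> idx (M j) \<Longrightarrow> snd (prod_chart M c) p (j, i) = snd (c j) (p j) i"
  by (simp add: prod_chart_def)

text \<open>The \<open>j\<close>-th block of coordinates, and its replacement by other values.\<close>

definition coord_proj :: "('n \<Rightarrow> ('a, 'i, 'k) mfd) \<Rightarrow> 'n \<Rightarrow> ('n \<times> 'i \<Rightarrow> 'k) \<Rightarrow> 'i \<Rightarrow> 'k" where
  "coord_proj M j x = restrict (\<lambda>i. x (j, i)) (idx (M j))"

definition coord_slice ::
    "('n \<Rightarrow> ('a, 'i, 'k) mfd) \<Rightarrow> 'n \<Rightarrow> ('n \<times> 'i \<Rightarrow> 'k) \<Rightarrow> ('i \<Rightarrow> 'k) \<Rightarrow> 'n \<times> 'i \<Rightarrow> 'k" where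
  "coord_slice M j y x = restrict (\<lambda>(k, i). if k = j then x i else y (k, i)) (prod_idx M)"

lemma continuous_coord_proj:
  fixes M :: "'n \<Rightarrow> ('a, 'i, 'k::real_normed_field) mfd"
  shows "continuous_map (coord_space (prod_idx M)) (coord_space (idx (M j))) (coord_proj M j)"
  unfolding coord_space_def continuous_map_componentwise
  using continuous_map_product_coordinates[of _ "prod_idx M" "\<lambda>_. euclidean :: 'k topology"]
  by (fastforce simp: coord_proj_def)

lemma continuous_coord_slice:
  fixes M :: "'n \<Rightarrow> ('a, 'i, 'k::real_normed_field) mfd"
  shows "continuous_map (coord_space (idx (M j))) (coord_space (prod_idx M)) (coord_slice M j y)"
  unfolding coord_space_def continuous_map_componentwise
  using continuous_map_product_coordinates[of _ "idx (M j)" "\<lambda>_. euclidean :: 'k topology"]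
  by (fastforce simp: coord_slice_def)

lemma coord_proj_upd:
  "i \<in> idx (M k) \<Longrightarrow> coord_proj M j (x((k, i) := t)) = (if k = j then (coord_proj M j x)(i := t) else coord_proj M j x)"
  by (auto simp: coord_proj_def fun_eq_iff)

lemma coord_slice_upd: "i \<in> idx (M j) \<Longrightarrow> coord_slice M j y (x(i := t)) = (coord_slice M j y x)((j, i) := t)"
  by (auto simp: coord_slice_def fun_eq_iff)

lemma coord_smooth_proj:
  fixes M :: "'n \<Rightarrow> ('a, 'i, 'k::real_normed_field) mfd"
  assumes "coord_smooth_on (idx (M j)) V f" "\<And>x. x \<in> V' \<Longrightarrow> coord_proj M j x \<in> V"
  shows "coord_smooth_on (prod_idx M) V' (\<lambda>x. f (coord_proj M j x))"
proof (rule coord_smooth_pullback[OF continuous_coord_proj _ assms])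
  fix l assume "l \<in> prod_idx M"
  then obtain k i where l: "l = (k, i)" "i \<in> idx (M k)" by auto
  show "(\<exists>m\<in>idx (M j). \<forall>x t. coord_proj M j (x(l := t)) = (coord_proj M j x)(m := t) \<and> coord_proj M j x m = x l)
      \<or> (\<forall>x t. coord_proj M j (x(l := t)) = coord_proj M j x)"
    using l by (cases "k = j") (auto simp: coord_proj_upd, auto simp: coord_proj_def)
qed

lemma coord_smooth_slice:
  fixes M :: "'n \<Rightarrow> ('a, 'i, 'k::real_normed_field) mfd"
  assumes "coord_smooth_on (prod_idx M) V f" "\<And>x. x \<in> V' \<Longrightarrow> coord_slice M j y x \<in> V"
  shows "coord_smooth_on (idx (M j)) V' (\<lambda>x. f (coord_slice M j y x))"
proof (rule coord_smooth_pullback[OF continuous_coord_slice _ assms])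
  fix i assume "i \<in> idx (M j)"
  then show "(\<exists>l\<in>prod_idx M. \<forall>x t. coord_slice M j y (x(i := t)) = (coord_slice M j y x)(l := t)
        \<and> coord_slice M j y x l = x i) \<or> (\<forall>x t. coord_slice M j y (x(i := t)) = coord_slice M j y x)"
    by (intro disjI1 bexI[of _ "(j, i)"]) (auto simp: coord_slice_upd, auto simp: coord_slice_def)
qed

lemma pd_slice:
  "i \<in> idx (M j) \<Longrightarrow> pd i (\<lambda>x. h (coord_slice M j y x)) x = pd (j, i) h (coord_slice M j y x)"
  unfolding pd_def by (simp add: coord_slice_upd) (simp add: coord_slice_def)

lemma coord_proj_prod_chart:
  assumes "snd (c j) (p j) \<in> extensional (idx (M j))"
  shows "coord_proj M j (snd (prod_chart M c) p) = snd (c j) (p j)"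
  using assms by (auto simp: coord_proj_def prod_chart_def extensional_def fun_eq_iff)

lemma prod_chart_upd: "snd (prod_chart M c) (p(j := q)) = coord_slice M j (snd (prod_chart M c) p) (snd (c j) q)"
  by (auto simp: prod_chart_def coord_slice_def fun_eq_iff)

text \<open>A vector, a vector field or a bivector field on the factor \<open>j\<close>, acting on functions on the product.\<close>

definition lift_vector ::
    "('n \<Rightarrow> ('a, 'i, 'k::real_normed_field) mfd) \<Rightarrow> 'n \<Rightarrow> ('n \<Rightarrow> 'a) \<Rightarrow> (('a \<Rightarrow> 'k) \<Rightarrow> 'k) \<Rightarrow> (('n \<Rightarrow> 'a) \<Rightarrow> 'k) \<Rightarrow> 'k" where
  "lift_vector M j p v f = (if smooth_near (prod_mfd M) p f then v (\<lambda>q. f (p(j := q))) else 0)"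

definition lift_field ::
    "('n \<Rightarrow> ('a, 'i, 'k::real_normed_field) mfd) \<Rightarrow> 'n \<Rightarrow> ('a, 'k) vfield \<Rightarrow> ('n \<Rightarrow> 'a, 'k) vfield" where
  "lift_field M j X p = lift_vector M j p (X (p j))"

definition lift_bivector ::
    "('n \<Rightarrow> ('a, 'i, 'k::real_normed_field) mfd) \<Rightarrow> 'n \<Rightarrow> ('a, 'k) field2 \<Rightarrow> ('n \<Rightarrow> 'a, 'k) field2" where
  "lift_bivector M j A p f g = (if smooth_near (prod_mfd M) p f \<and> smooth_near (prod_mfd M) p g
     then A (p j) (\<lambda>q. f (p(j := q))) (\<lambda>q. g (p(j := q))) else 0)"

context
  fixes M :: "'n::finite \<Rightarrow> ('a, 'i, 'k::real_normed_field) mfd"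
  assumes M: "\<And>j. manifold (M j)"
begin

lemma finite_Sigma_idx: "finite (prod_idx M)"
  using manifold_finite[OF M] by auto

lemma open_prod_box:
  assumes "\<And>j. openin (top_of (M j)) (U j)"
  shows "openin (top_of (prod_mfd M)) (Pi UNIV U)"
proof -
  have "openin (product_topology (\<lambda>j. top_of (M j)) UNIV) (PiE UNIV U)"
    using assms by (subst openin_PiE) auto
  then show ?thesis by (simp add: prod_mfd_def PiE_UNIV_domain)
qed

lemma prod_chart_proj:
  assumes c: "\<And>j. c j \<in> atlas (M j)" and p: "p \<in> fst (prod_chart M c)"
  shows "coord_proj M j (snd (prod_chart M c) p) = snd (c j) (p j)"
  by (rule coord_proj_prod_chart) (use chart_extensional[OF M c] p in \<open>auto simp: fst_prod_chart\<close>)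

lemma inj_prod_chart:
  assumes c: "\<And>j. c j \<in> atlas (M j)"
  shows "inj_on (snd (prod_chart M c)) (fst (prod_chart M c))"
proof (rule inj_onI, rule ext)
  fix p q j assume *: "p \<in> fst (prod_chart M c)" "q \<in> fst (prod_chart M c)"
    "snd (prod_chart M c) p = snd (prod_chart M c) q"
  then have "snd (c j) (p j) = snd (c j) (q j)"
    using prod_chart_proj[OF c] by metis
  then show "p j = q j"
    using inj_onD[OF chart_open(2)[OF M c[of j]]] * by (auto simp: fst_prod_chart)
qed

lemma prod_chart_inv:
  assumes c: "\<And>j. c j \<in> atlas (M j)" and x: "x \<in> snd (prod_chart M c) ` fst (prod_chart M c)"
  shows "the_inv_into (fst (prod_chart M c)) (snd (prod_chart M c)) x =
    (\<lambda>j. the_inv_into (fst (c j)) (snd (c j)) (coord_proj M j x))"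
proof -
  obtain p where p: "p \<in> fst (prod_chart M c)" "x = snd (prod_chart M c) p"
    using x by blast
  have "the_inv_into (fst (c j)) (snd (c j)) (coord_proj M j x) = p j" for j
    using prod_chart_proj[OF c p(1)] p(1) chart_inv(1)[OF M c[of j]] by (simp add: p(2) fst_prod_chart)
  then show ?thesis
    by (simp add: p(2) the_inv_into_f_f[OF inj_prod_chart[OF c] p(1)])
qed

lemma prod_chart_image:
  assumes c: "\<And>j. c j \<in> atlas (M j)" and U: "\<And>j. U j \<subseteq> fst (c j)"
  shows "snd (prod_chart M c) ` Pi UNIV U =
    {x \<in> extensional (prod_idx M). \<forall>j. coord_proj M j x \<in> snd (c j) ` U j}"
proof (intro equalityI subsetI)
  fix x assume "x \<in> snd (prod_chart M c) ` Pi UNIV U"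
  then obtain p where p: "p \<in> Pi UNIV U" "x = snd (prod_chart M c) p" by blast
  then have "p \<in> fst (prod_chart M c)"
    using U by (auto simp: fst_prod_chart)
  from prod_chart_proj[OF c this] p
  show "x \<in> {x \<in> extensional (prod_idx M). \<forall>j. coord_proj M j x \<in> snd (c j) ` U j}"
    by (auto simp: prod_chart_def)
next
  fix x assume x: "x \<in> {x \<in> extensional (prod_idx M). \<forall>j. coord_proj M j x \<in> snd (c j) ` U j}"
  then have "\<forall>j. \<exists>q. q \<in> U j \<and> coord_proj M j x = snd (c j) q" by blast
  then obtain p where p: "\<And>j. p j \<in> U j" "\<And>j. coord_proj M j x = snd (c j) (p j)" by metis
  have "x l = snd (prod_chart M c) p l" for l
  proof (cases "l \<in> prod_idx M")
    case True
    then obtain j i where l: "l = (j, i)" "i \<in> idx (M j)" by auto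
    have "x (j, i) = coord_proj M j x i" using l by (simp add: coord_proj_def)
    then show ?thesis using l p(2) by (simp add: snd_prod_chart)
  next
    case False
    then have "x l = undefined"
      using x by (auto dest: extensional_arb)
    with False show ?thesis by (auto simp: prod_chart_def)
  qed
  then have "x = snd (prod_chart M c) p" by blast
  then show "x \<in> snd (prod_chart M c) ` Pi UNIV U"
    using p(1) by blast
qed

lemma prod_chart_image_open:
  assumes c: "\<And>j. c j \<in> atlas (M j)" and U: "\<And>j. openin (top_of (M j)) (U j)" "\<And>j. U j \<subseteq> fst (c j)"
  shows "openin (coord_space (prod_idx M)) (snd (prod_chart M c) ` Pi UNIV U)"
proof -
  let ?S = "prod_idx M"
  have "openin (coord_space (idx (M j))) (snd (c j) ` U j)" for j
    using chart_open(4)[OF M[of j] c[of j] U(1)[of j]] U(2)[of j] by (simp add: Int_absorb2)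
  then have "openin (coord_space ?S) {x \<in> topspace (coord_space ?S). coord_proj M j x \<in> snd (c j) ` U j}" for j
    by (rule openin_continuous_map_preimage[OF continuous_coord_proj])
  then have "openin (coord_space ?S) (\<Inter>j. {x \<in> extensional ?S. coord_proj M j x \<in> snd (c j) ` U j})"
    by (intro openin_INT2) (auto simp: topspace_coord_space)
  also have "(\<Inter>j. {x \<in> extensional ?S. coord_proj M j x \<in> snd (c j) ` U j}) = snd (prod_chart M c) ` Pi UNIV U"
    unfolding prod_chart_image[OF c U(2)] by blast
  finally show ?thesis .
qed

lemma is_chart_prod:
  assumes c: "\<And>j. c j \<in> atlas (M j)"
  shows "is_chart (prod_mfd M) (prod_chart M c)"
proof -
  let ?S = "prod_idx M"
  define W where "W = fst (prod_chart M c)"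
  define \<phi> where "\<phi> = snd (prod_chart M c)"
  define \<psi> where "\<psi> x j = the_inv_into (fst (c j)) (snd (c j)) (coord_proj M j x)" for x j
  have W: "W = Pi UNIV (\<lambda>j. fst (c j))" by (simp add: W_def prod_chart_def)
  have Wo: "openin (top_of (prod_mfd M)) W"
    unfolding W by (rule open_prod_box) (rule chart_open(1)[OF M c])
  have \<phi>o: "openin (coord_space ?S) (\<phi> ` W)"
    unfolding W \<phi>_def by (rule prod_chart_image_open[OF c chart_open(1)[OF M c] order.refl])
  have tW: "topspace (subtopology (top_of (prod_mfd M)) W) = W"
    using openin_subset[OF Wo] by auto
  have t\<phi>: "topspace (subtopology (coord_space ?S) (\<phi> ` W)) = \<phi> ` W"
    using openin_subset[OF \<phi>o] by auto
  have hom: "homeomorphic_map (subtopology (top_of (M j)) (fst (c j)))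
      (subtopology (coord_space (idx (M j))) (snd (c j) ` fst (c j))) (snd (c j))" for j
    using M[of j] c[of j] by (auto simp: manifold_def is_chart_def case_prod_unfold)
  have inv: "continuous_map (subtopology (coord_space (idx (M j))) (snd (c j) ` fst (c j)))
      (top_of (M j)) (the_inv_into (fst (c j)) (snd (c j)))" for j
  proof -
    obtain g where g: "homeomorphic_maps (subtopology (top_of (M j)) (fst (c j)))
      (subtopology (coord_space (idx (M j))) (snd (c j) ` fst (c j))) (snd (c j)) g"
      using hom[of j] homeomorphic_map_maps by blast
    then have "continuous_map (subtopology (coord_space (idx (M j))) (snd (c j) ` fst (c j))) (top_of (M j)) g"
      by (simp add: homeomorphic_maps_def continuous_map_in_subtopology)
    moreover have "g x = the_inv_into (fst (c j)) (snd (c j)) x"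
      if x: "x \<in> topspace (subtopology (coord_space (idx (M j))) (snd (c j) ` fst (c j)))" for x
    proof -
      obtain q where q: "q \<in> fst (c j)" "x = snd (c j) q" using x by auto
      have "q \<in> topspace (subtopology (top_of (M j)) (fst (c j)))"
        using q openin_subset[OF chart_open(1)[OF M c]] by auto
      with g have "g x = q" by (simp add: q homeomorphic_maps_def)
      then show ?thesis using q chart_inv(1)[OF M c[of j]] by simp
    qed
    ultimately show ?thesis by (rule continuous_map_eq)
  qed
  have "homeomorphic_maps (subtopology (top_of (prod_mfd M)) W) (subtopology (coord_space ?S) (\<phi> ` W)) \<phi> \<psi>"
    unfolding homeomorphic_maps_def
  proof (intro conjI ballI)
    have comp: "continuous_map (subtopology (top_of (prod_mfd M)) W) euclidean (\<lambda>p. snd (c j) (p j) i)"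
      if "i \<in> idx (M j)" for j i
    proof -
      have "continuous_map (top_of (prod_mfd M)) (top_of (M j)) (\<lambda>p. p j)"
        unfolding prod_mfd_def by (simp, rule continuous_map_product_projection, simp)
      then have "continuous_map (subtopology (top_of (prod_mfd M)) W) (subtopology (top_of (M j)) (fst (c j))) (\<lambda>p. p j)"
        by (auto simp: continuous_map_in_subtopology continuous_map_from_subtopology W)
      from continuous_map_compose[OF this homeomorphic_imp_continuous_map[OF hom[of j]]]
      have "continuous_map (subtopology (top_of (prod_mfd M)) W) (coord_space (idx (M j))) (\<lambda>p. snd (c j) (p j))"
        by (simp add: continuous_map_in_subtopology comp_def)
      moreover have "continuous_map (coord_space (idx (M j))) euclidean (\<lambda>x. x i :: 'k)"
        unfolding coord_space_def using that by (rule continuous_map_product_projection)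
      ultimately show ?thesis
        using continuous_map_compose by (fastforce simp: comp_def)
    qed
    have "continuous_map (subtopology (top_of (prod_mfd M)) W) (coord_space ?S) \<phi>"
      unfolding coord_space_def continuous_map_componentwise
      using comp by (auto simp: \<phi>_def prod_chart_def)
    then show "continuous_map (subtopology (top_of (prod_mfd M)) W) (subtopology (coord_space ?S) (\<phi> ` W)) \<phi>"
      by (auto simp: continuous_map_in_subtopology)
    have "continuous_map (subtopology (coord_space ?S) (\<phi> ` W)) (top_of (M j)) (\<lambda>x. \<psi> x j)" for j
    proof -
      have "coord_proj M j x \<in> snd (c j) ` fst (c j)" if "x \<in> \<phi> ` W" for x
        using that prod_chart_proj[OF c] by (auto simp: W_def \<phi>_def fst_prod_chart)
      then have "continuous_map (subtopology (coord_space ?S) (\<phi> ` W))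
          (subtopology (coord_space (idx (M j))) (snd (c j) ` fst (c j))) (coord_proj M j)"
        by (auto simp: continuous_map_in_subtopology intro: continuous_map_from_subtopology continuous_coord_proj)
      from continuous_map_compose[OF this inv[of j]] show ?thesis
        by (simp add: \<psi>_def comp_def)
    qed
    then have "continuous_map (subtopology (coord_space ?S) (\<phi> ` W)) (top_of (prod_mfd M)) \<psi>"
      by (simp add: prod_mfd_def continuous_map_componentwise)
    moreover have \<psi>\<phi>: "\<psi> (\<phi> p) = p" if "p \<in> W" for p
    proof -
      have "\<psi> (\<phi> p) = the_inv_into W \<phi> (\<phi> p)"
        unfolding \<psi>_def W_def \<phi>_def by (rule prod_chart_inv[OF c, symmetric]) (use that W_def in blast)
      then show ?thesis
        using the_inv_into_f_f[OF inj_prod_chart[OF c]] that by (simp add: W_def \<phi>_def)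
    qed
    ultimately show "continuous_map (subtopology (coord_space ?S) (\<phi> ` W)) (subtopology (top_of (prod_mfd M)) W) \<psi>"
      unfolding continuous_map_in_subtopology t\<phi> by auto
    show "\<psi> (\<phi> p) = p" if "p \<in> topspace (subtopology (top_of (prod_mfd M)) W)" for p
      using that \<psi>\<phi> tW by simp
    show "\<phi> (\<psi> x) = x" if "x \<in> topspace (subtopology (coord_space ?S) (\<phi> ` W))" for x
      using that \<psi>\<phi> t\<phi> by auto
  qed
  then have "homeomorphic_map (subtopology (top_of (prod_mfd M)) W) (subtopology (coord_space ?S) (\<phi> ` W)) \<phi>"
    using homeomorphic_map_maps by blast
  with Wo \<phi>o show ?thesis
    by (simp add: is_chart_def case_prod_unfold idx_prod_mfd W_def \<phi>_def)
qed

lemma prod_chart_smooth_change: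
  assumes c: "\<And>j. c j \<in> atlas (M j)" and c': "\<And>j. c' j \<in> atlas (M j)" and i: "i \<in> idx (M j)"
  shows "coord_smooth_on (prod_idx M)
    (snd (prod_chart M c) ` (fst (prod_chart M c) \<inter> fst (prod_chart M c')))
    (\<lambda>x. snd (prod_chart M c') (the_inv_into (fst (prod_chart M c)) (snd (prod_chart M c)) x) (j, i))"
proof -
  let ?S = "prod_idx M"
  have W: "fst (prod_chart M c) \<inter> fst (prod_chart M c') = Pi UNIV (\<lambda>j. fst (c j) \<inter> fst (c' j))"
    by (auto simp: prod_chart_def)
  have o: "openin (coord_space ?S) (snd (prod_chart M c) ` (fst (prod_chart M c) \<inter> fst (prod_chart M c')))"
    unfolding W by (rule prod_chart_image_open[OF c]) (auto intro: chart_open(1)[OF M c] chart_open(1)[OF M c'])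
  have "coord_smooth_on (idx (M j)) (snd (c j) ` (fst (c' j) \<inter> fst (c j))) (in_chart (c j) (\<lambda>p. snd (c' j) p i))"
    by (rule smooth_onD[OF smooth_on_coord[OF M c' i] c])
  then have "coord_smooth_on ?S (snd (prod_chart M c) ` (fst (prod_chart M c) \<inter> fst (prod_chart M c')))
      (\<lambda>x. (in_chart (c j) (\<lambda>p. snd (c' j) p i)) (coord_proj M j x))"
    by (rule coord_smooth_proj) (use prod_chart_proj[OF c] in \<open>auto simp: fst_prod_chart\<close>)
  then show ?thesis
    by (subst coord_smooth_cong[OF finite_Sigma_idx o]) (auto simp: snd_prod_chart i prod_chart_inv[OF c])
qed

lemma manifold_prod: "manifold (prod_mfd M)"
  unfolding manifold_def
proof (intro conjI)
  show "Hausdorff_space (top_of (prod_mfd M))"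
    using M by (simp add: prod_mfd_def Hausdorff_space_product_topology manifold_def)
  show "second_countable (top_of (prod_mfd M))"
    using M by (simp add: prod_mfd_def second_countable_product_topology manifold_def)
  show "finite (idx (prod_mfd M))"
    by (simp add: idx_prod_mfd finite_Sigma_idx)
  show "\<forall>c\<in>atlas (prod_mfd M). is_chart (prod_mfd M) c"
    using is_chart_prod by (auto simp: atlas_prod_mfd)
  show "(\<Union>(W, \<phi>)\<in>atlas (prod_mfd M). W) = pts (prod_mfd M)"
  proof (intro equalityI subsetI)
    fix p assume "p \<in> (\<Union>(W, \<phi>)\<in>atlas (prod_mfd M). W)"
    then obtain d where "d \<in> atlas (prod_mfd M)" "p \<in> fst d"
      by (auto simp: case_prod_unfold)
    then obtain c where c: "\<And>j. c j \<in> atlas (M j)" "p \<in> fst (prod_chart M c)"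
      unfolding atlas_prod_mfd by blast
    then show "p \<in> pts (prod_mfd M)"
      using openin_subset[OF chart_open(1)[OF M c(1)]] by (auto simp: pts_prod_mfd fst_prod_chart)
  next
    fix p assume "p \<in> pts (prod_mfd M)"
    then have "\<exists>d\<in>atlas (M j). p j \<in> fst d" for j
      by (intro chart_exists M) (simp add: pts_prod_mfd)
    then obtain c where "\<And>j. c j \<in> atlas (M j)" "\<And>j. p j \<in> fst (c j)" by metis
    then have "prod_chart M c \<in> atlas (prod_mfd M)" "p \<in> fst (prod_chart M c)"
      by (auto simp: atlas_prod_mfd fst_prod_chart)
    then show "p \<in> (\<Union>(W, \<phi>)\<in>atlas (prod_mfd M). W)"
      unfolding case_prod_unfold by blast
  qed
  show "\<forall>(W, \<phi>)\<in>atlas (prod_mfd M). \<forall>(W', \<phi>')\<in>atlas (prod_mfd M). \<forall>i\<in>idx (prod_mfd M).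
        coord_smooth_on (idx (prod_mfd M)) (\<phi> ` (W \<inter> W')) (\<lambda>x. \<phi>' (the_inv_into W \<phi> x) i)"
    unfolding case_prod_unfold idx_prod_mfd
  proof (intro ballI)
    fix d d' l assume "d \<in> atlas (prod_mfd M)" "d' \<in> atlas (prod_mfd M)" "l \<in> prod_idx M"
    then obtain c c' j i where *: "\<And>j. c j \<in> atlas (M j)" "\<And>j. c' j \<in> atlas (M j)" "i \<in> idx (M j)"
      "d = prod_chart M c" "d' = prod_chart M c'" "l = (j, i)"
      by (auto simp: atlas_prod_mfd)
    show "coord_smooth_on (prod_idx M) (snd d ` (fst d \<inter> fst d')) (\<lambda>x. snd d' (the_inv_into (fst d) (snd d) x) l)"
      unfolding *(4-6) by (rule prod_chart_smooth_change[OF *(1-3)])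
  qed
qed

section \<open>Functions of one factor\<close>

lemma prod_chart_in_atlas: "(\<And>j. c j \<in> atlas (M j)) \<Longrightarrow> prod_chart M c \<in> atlas (prod_mfd M)"
  by (auto simp: atlas_prod_mfd)

lemma charts_around:
  assumes "p \<in> pts (prod_mfd M)"
  obtains c where "\<And>j. c j \<in> atlas (M j)" "\<And>j. p j \<in> fst (c j)"
proof -
  have "\<exists>d\<in>atlas (M j). p j \<in> fst d" for j
    using assms by (intro chart_exists M) (simp add: pts_prod_mfd)
  then show ?thesis using that by metis
qed

lemma continuous_upd:
  assumes "p \<in> pts (prod_mfd M)"
  shows "continuous_map (top_of (M j)) (top_of (prod_mfd M)) (\<lambda>q. p(j := q))"
proof -
  have "continuous_map (top_of (M j)) (top_of (M k)) (\<lambda>q. (p(j := q)) k)" for k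
    using assms by (cases "k = j") (auto simp: pts_prod_mfd id_def[symmetric])
  then show ?thesis
    by (simp add: prod_mfd_def continuous_map_componentwise)
qed

lemma open_slice:
  assumes U: "openin (top_of (prod_mfd M)) U" and p: "p \<in> pts (prod_mfd M)"
  shows "openin (top_of (M j)) {q \<in> pts (M j). p(j := q) \<in> U}"
  using openin_continuous_map_preimage[OF continuous_upd[OF p] U] .

lemma prod_chart_inv_slice:
  assumes c: "\<And>j. c j \<in> atlas (M j)" and q: "p(j := q) \<in> fst (prod_chart M c)"
  shows "the_inv_into (fst (prod_chart M c)) (snd (prod_chart M c))
    (coord_slice M j (snd (prod_chart M c) p) (snd (c j) q)) = p(j := q)"
  using chart_inv(1)[OF manifold_prod prod_chart_in_atlas[OF c] q] by (simp add: prod_chart_upd)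

text \<open>
  In product charts the remaining variables are constants, and the inclusion of one block of coordinates
  maps coordinate lines to coordinate lines.
\<close>

lemma smooth_slice:
  assumes f: "smooth_on (prod_mfd M) U f" and p: "p \<in> pts (prod_mfd M)"
  shows "smooth_on (M j) {q \<in> pts (M j). p(j := q) \<in> U} (\<lambda>q. f (p(j := q)))"
proof (rule smooth_onI)
  show U': "openin (top_of (M j)) {q \<in> pts (M j). p(j := q) \<in> U}"
    using open_slice[OF smooth_on_open[OF f] p] .
  fix d assume d: "d \<in> atlas (M j)"
  obtain c0 where c0: "\<And>j. c0 j \<in> atlas (M j)" "\<And>j. p j \<in> fst (c0 j)"
    using charts_around[OF p] by blast
  define c where "c = c0(j := d)"
  have c: "c k \<in> atlas (M k)" for k using c0 d by (auto simp: c_def)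
  have cj: "c j = d" by (simp add: c_def)
  let ?C = "prod_chart M c"
  have pq: "p(j := q) \<in> fst ?C" if "q \<in> fst d" for q
    using that c0(2) by (auto simp: fst_prod_chart c_def)
  have upd: "coord_slice M j (snd ?C p) (snd d q) = snd ?C (p(j := q))" for q
    using prod_chart_upd[of M c p j q] by (simp add: cj)
  have "coord_smooth_on (prod_idx M) (snd ?C ` (U \<inter> fst ?C)) (in_chart ?C f)"
    using smooth_onD[OF f prod_chart_in_atlas[OF c]] by (simp add: idx_prod_mfd)
  then have F: "coord_smooth_on (idx (M j)) (snd d ` ({q \<in> pts (M j). p(j := q) \<in> U} \<inter> fst d))
      (\<lambda>x. (in_chart ?C f) (coord_slice M j (snd ?C p) x))"
    by (rule coord_smooth_slice) (use pq upd in auto)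
  have eq: "(in_chart ?C f) (coord_slice M j (snd ?C p) x) =
      (in_chart d (\<lambda>q. f (p(j := q)))) x"
    if x: "x \<in> snd d ` ({q \<in> pts (M j). p(j := q) \<in> U} \<inter> fst d)" for x
  proof -
    obtain q where q: "q \<in> fst d" "x = snd d q" using x by blast
    then show ?thesis
      using prod_chart_inv_slice[OF c pq[OF q(1)]] chart_inv(1)[OF M d q(1)] by (simp add: cj)
  qed
  show "coord_smooth_on (idx (M j)) (snd d ` ({q \<in> pts (M j). p(j := q) \<in> U} \<inter> fst d))
      (in_chart d (\<lambda>q. f (p(j := q))))"
    by (rule iffD1[OF coord_smooth_cong[OF manifold_finite[OF M] chart_open(4)[OF M d U'] eq] F])
qed

lemma smooth_near_slice:
  assumes "smooth_near (prod_mfd M) p f"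
  shows "smooth_near (M j) (p j) (\<lambda>q. f (p(j := q)))"
proof -
  obtain U where U: "p \<in> U" "smooth_on (prod_mfd M) U f"
    using assms by (auto simp: smooth_near_def)
  have p: "p \<in> pts (prod_mfd M)" using assms by (rule smooth_near_pts)
  show ?thesis
    by (rule smooth_on_near[OF smooth_slice[OF U(2) p]]) (use U p in \<open>auto simp: pts_prod_mfd\<close>)
qed

lemma chart_pd_slice:
  assumes c: "\<And>j. c j \<in> atlas (M j)" and p: "p \<in> fst (prod_chart M c)" and i: "i \<in> idx (M j)"
  shows "chart_pd (c j) i (\<lambda>q. f (p(j := q))) (p j) = chart_pd (prod_chart M c) (j, i) f p"
proof -
  let ?C = "prod_chart M c"
  have pj: "p j \<in> fst (c j)" using p by (simp add: fst_prod_chart)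
  have "chart_pd (c j) i (\<lambda>q. f (p(j := q))) (p j) =
      pd i (\<lambda>x. (in_chart ?C f) (coord_slice M j (snd ?C p) x)) (snd (c j) (p j))"
    unfolding chart_pd_def
  proof (rule pd_cong[OF manifold_finite[OF M] chart_open(3)[OF M c] _ _ i])
    fix x assume "x \<in> snd (c j) ` fst (c j)"
    then obtain q where q: "q \<in> fst (c j)" "x = snd (c j) q" by blast
    have "p(j := q) \<in> fst ?C" using p q by (auto simp: fst_prod_chart)
    then show "(in_chart (c j) (\<lambda>q. f (p(j := q)))) x =
        (in_chart ?C f) (coord_slice M j (snd ?C p) x)"
      using prod_chart_inv_slice[OF c] chart_inv(1)[OF M c q(1)] by (simp add: q)
  qed (use pj in blast)
  also have "\<dots> = pd (j, i) (in_chart ?C f) (coord_slice M j (snd ?C p) (snd (c j) (p j)))"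
    by (rule pd_slice[where M = M and j = j, OF i])
  also have "coord_slice M j (snd ?C p) (snd (c j) (p j)) = snd ?C p"
    using prod_chart_upd[of M c p j "p j"] by simp
  finally show ?thesis unfolding chart_pd_def[of ?C] .
qed

lemma tangent_slice_formula:
  assumes v: "v \<in> tangent_space (M j) (p j)" and c: "\<And>j. c j \<in> atlas (M j)" and p: "p \<in> fst (prod_chart M c)"
    and f: "smooth_near (prod_mfd M) p f"
  shows "v (\<lambda>q. f (p(j := q))) = (\<Sum>i\<in>idx (M j). v (\<lambda>q. snd (c j) q i) * chart_pd (prod_chart M c) (j, i) f p)"
proof -
  have "p j \<in> fst (c j)" using p by (simp add: fst_prod_chart)
  from tangent_formula[OF M v c this smooth_near_slice[OF f]] show ?thesis
    by (simp add: chart_pd_slice[OF c p])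
qed

lemma lift_vector_tangent:
  assumes p: "p \<in> pts (prod_mfd M)" and v: "v \<in> tangent_space (M j) (p j)"
  shows "lift_vector M j p v \<in> tangent_space (prod_mfd M) p"
proof -
  obtain c where c: "\<And>j. c j \<in> atlas (M j)" "\<And>j. p j \<in> fst (c j)"
    using charts_around[OF p] by blast
  let ?C = "prod_chart M c"
  have pC: "p \<in> fst ?C" using c(2) by (simp add: fst_prod_chart)
  define a where "a = (\<lambda>(k, i). if k = j then v (\<lambda>q. snd (c j) q i) else 0)"
  have "(\<Sum>l\<in>prod_idx M. a l * chart_pd ?C l f p) =
      (\<Sum>i\<in>idx (M j). v (\<lambda>q. snd (c j) q i) * chart_pd ?C (j, i) f p)" for f
  proof -
    have "(\<Sum>l\<in>prod_idx M. a l * chart_pd ?C l f p) =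
        (\<Sum>k\<in>UNIV. \<Sum>i\<in>idx (M k). a (k, i) * chart_pd ?C (k, i) f p)"
      by (subst sum.Sigma) (auto simp: manifold_finite[OF M] intro!: sum.cong)
    also have "\<dots> = (\<Sum>k\<in>UNIV. if k = j then \<Sum>i\<in>idx (M j). v (\<lambda>q. snd (c j) q i) * chart_pd ?C (j, i) f p else 0)"
      by (intro sum.cong) (auto simp: a_def)
    finally show ?thesis by simp
  qed
  then have "lift_vector M j p v = chart_vector (prod_mfd M) ?C a p"
    by (auto simp: fun_eq_iff lift_vector_def chart_vector_def idx_prod_mfd tangent_slice_formula[OF v c(1) pC])
  then show ?thesis
    using prod_chart_in_atlas[OF c(1)] pC unfolding tangent_space_iff by blast
qed

text \<open>
  This is applied to lifted fields. In a product chart they are given by their coefficients on the factor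
  and by partial derivatives on the product, and both are smooth functions of the coordinates.
\<close>

lemma smooth_on_prodI:
  assumes U: "openin (top_of (prod_mfd M)) U"
    and F': "\<And>c. (\<And>j. c j \<in> atlas (M j)) \<Longrightarrow>
      coord_smooth_on (prod_idx M) (snd (prod_chart M c) ` (U \<inter> fst (prod_chart M c))) (F' c)"
    and eq: "\<And>c p. (\<And>j. c j \<in> atlas (M j)) \<Longrightarrow> p \<in> U \<Longrightarrow> p \<in> fst (prod_chart M c) \<Longrightarrow>
      F p = F' c (snd (prod_chart M c) p)"
  shows "smooth_on (prod_mfd M) U F"
proof (rule smooth_onI[OF U])
  fix C assume C: "C \<in> atlas (prod_mfd M)"
  then obtain c where c: "C = prod_chart M c" "\<And>j. c j \<in> atlas (M j)"
    by (auto simp: atlas_prod_mfd)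
  have "F' c x = in_chart C F x" if "x \<in> snd C ` (U \<inter> fst C)" for x
    using that eq[OF c(2)] chart_inv(1)[OF manifold_prod C] by (auto simp: c(1))
  from coord_smooth_cong[OF manifold_finite[OF manifold_prod] chart_open(4)[OF manifold_prod C U] this]
  show "coord_smooth_on (idx (prod_mfd M)) (snd C ` (U \<inter> fst C)) (in_chart C F)"
    using F'[OF c(2)] by (simp only: c(1) idx_prod_mfd)
qed

lemma coord_smooth_component:
  assumes c: "\<And>j. c j \<in> atlas (M j)" and G: "smooth_on (M j) (fst (c j)) G"
  shows "coord_smooth_on (prod_idx M) (snd (prod_chart M c) ` (U \<inter> fst (prod_chart M c)))
      (\<lambda>x. (in_chart (c j) G) (coord_proj M j x))"
  by (rule coord_smooth_proj[where M = M and j = j, OF smooth_onD[OF G c]])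
    (use prod_chart_proj[OF c] in \<open>auto simp: fst_prod_chart\<close>)

lemma component_prod_chart:
  assumes c: "\<And>j. c j \<in> atlas (M j)" and p: "p \<in> fst (prod_chart M c)"
  shows "(in_chart (c j) G) (coord_proj M j (snd (prod_chart M c) p)) = G (p j)"
  using prod_chart_proj[OF c p] chart_inv(1)[OF M c] p by (simp add: fst_prod_chart)

lemma coord_smooth_chart_pd:
  assumes c: "\<And>j. c j \<in> atlas (M j)" and f: "smooth_on (prod_mfd M) U f" and i: "i \<in> idx (M j)"
  shows "coord_smooth_on (prod_idx M) (snd (prod_chart M c) ` (U \<inter> fst (prod_chart M c)))
      (pd (j, i) (in_chart (prod_chart M c) f))"
  using coord_smooth_pd(1)[OF manifold_finite[OF manifold_prod]
      chart_open(4)[OF manifold_prod prod_chart_in_atlas[OF c] smooth_on_open[OF f]]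
      smooth_onD[OF f prod_chart_in_atlas[OF c]], of "(j, i)"] i
  by (simp add: idx_prod_mfd)

lemma vector_field_lift:
  assumes X: "vector_field (M j) X"
  shows "vector_field (prod_mfd M) (lift_field M j X)"
  unfolding vector_field_def
proof (intro conjI ballI allI impI)
  show "lift_field M j X p \<in> tangent_space (prod_mfd M) p" if "p \<in> pts (prod_mfd M)" for p
    unfolding lift_field_def using that
    by (intro lift_vector_tangent vector_field_tangent[OF X]) (auto simp: pts_prod_mfd)
  show "lift_field M j X p = 0" if "p \<notin> pts (prod_mfd M)" for p
    using that by (auto simp: lift_field_def lift_vector_def fun_eq_iff dest: smooth_near_pts)
  fix p f assume "smooth_near (prod_mfd M) p f"
  then obtain U where U: "p \<in> U" "smooth_on (prod_mfd M) U f"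
    by (auto simp: smooth_near_def)
  have "smooth_on (prod_mfd M) U (\<lambda>q. lift_field M j X q f)"
  proof (rule smooth_on_prodI[OF smooth_on_open[OF U(2)]])
    fix c assume c: "\<And>j. c j \<in> atlas (M j)"
    let ?C = "prod_chart M c"
    have G: "smooth_on (M j) (fst (c j)) (\<lambda>q. X q (\<lambda>q. snd (c j) q i))" if "i \<in> idx (M j)" for i
      by (rule smooth_on_if_near[OF M chart_open(1)[OF M c]],
          rule vector_field_smooth[OF X smooth_on_near[OF smooth_on_coord[OF M c that]]])
    show "coord_smooth_on (prod_idx M) (snd ?C ` (U \<inter> fst ?C)) (\<lambda>x. \<Sum>i\<in>idx (M j).
        in_chart (c j) (\<lambda>q. X q (\<lambda>q. snd (c j) q i)) (coord_proj M j x) * pd (j, i) (in_chart ?C f) x)"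
      by (intro coord_smooth_sum coord_smooth_mult coord_smooth_component[OF c] coord_smooth_chart_pd[OF c U(2)] G)
    fix p assume p: "p \<in> U" "p \<in> fst ?C"
    have sm: "smooth_near (prod_mfd M) p f" by (rule smooth_on_near[OF U(2) p(1)])
    then have "p j \<in> pts (M j)"
      using smooth_near_pts[of "prod_mfd M" p f] by (simp add: pts_prod_mfd)
    then show "lift_field M j X p f = (\<Sum>i\<in>idx (M j).
        in_chart (c j) (\<lambda>q. X q (\<lambda>q. snd (c j) q i)) (coord_proj M j (snd ?C p)) * pd (j, i) (in_chart ?C f) (snd ?C p))"
      using tangent_slice_formula[of "X (p j)" j p c f, OF vector_field_tangent[OF X] c p(2) sm] sm
      by (simp add: lift_field_def lift_vector_def component_prod_chart[OF c p(2)] chart_pd_def[of ?C] del: comp_apply)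
  qed
  then show "smooth_near (prod_mfd M) p (\<lambda>q. lift_field M j X q f)"
    using U(1) by (rule smooth_on_near)
qed

lemma bivector_field_lift:
  assumes A: "bivector_field (M j) A"
  shows "bivector_field (prod_mfd M) (lift_bivector M j A)"
  unfolding bivector_field_def
proof (intro conjI ballI allI impI)
  fix p assume p: "p \<in> pts (prod_mfd M)"
  then have "p j \<in> pts (M j)" by (simp add: pts_prod_mfd)
  then obtain m :: nat and v w where vw: "\<forall>i<m. v i \<in> tangent_space (M j) (p j)" "\<forall>i<m. w i \<in> tangent_space (M j) (p j)"
    "A (p j) = (\<lambda>f g. \<Sum>i<m. v i f * w i g)"
    using bivector_decomp[OF A] by blast
  have "lift_bivector M j A p = (\<lambda>f g. \<Sum>i<m. lift_vector M j p (v i) f * lift_vector M j p (w i) g)"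
    by (auto simp: lift_bivector_def lift_vector_def vw(3) fun_eq_iff)
  then show "\<exists>(m::nat) v w. (\<forall>i<m. v i \<in> tangent_space (prod_mfd M) p \<and> w i \<in> tangent_space (prod_mfd M) p) \<and>
      lift_bivector M j A p = (\<lambda>f g. \<Sum>i<m. v i f * w i g)"
    using vw(1,2)
    by (intro exI[of _ m] exI[of _ "\<lambda>i. lift_vector M j p (v i)"] exI[of _ "\<lambda>i. lift_vector M j p (w i)"])
      (simp add: lift_vector_tangent[OF p])
next
  show "lift_bivector M j A p f g = - lift_bivector M j A p g f" for p f g
    using bivector_skew[OF A, of "p j" "\<lambda>q. f (p(j := q))"] by (simp add: lift_bivector_def)
  show "lift_bivector M j A p = 0" if "p \<notin> pts (prod_mfd M)" for p
    using that by (auto simp: lift_bivector_def fun_eq_iff dest: smooth_near_pts)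
  fix p f g assume "smooth_near (prod_mfd M) p f \<and> smooth_near (prod_mfd M) p g"
  then obtain U where U: "p \<in> U" "smooth_on (prod_mfd M) U f" "smooth_on (prod_mfd M) U g"
    using smooth_near2[of "prod_mfd M" p f g] by auto
  have "smooth_on (prod_mfd M) U (\<lambda>q. lift_bivector M j A q f g)"
  proof (rule smooth_on_prodI[OF smooth_on_open[OF U(2)]])
    fix c assume c: "\<And>j. c j \<in> atlas (M j)"
    let ?C = "prod_chart M c"
    let ?G = "\<lambda>i l q. A q (\<lambda>q. snd (c j) q i) (\<lambda>q. snd (c j) q l)"
    have G: "smooth_on (M j) (fst (c j)) (?G i l)" if "i \<in> idx (M j)" "l \<in> idx (M j)" for i l
      by (rule smooth_on_if_near[OF M chart_open(1)[OF M c]],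
          rule bivector_smooth[OF A smooth_on_near[OF smooth_on_coord[OF M c that(1)]]
            smooth_on_near[OF smooth_on_coord[OF M c that(2)]]])
    show "coord_smooth_on (prod_idx M) (snd ?C ` (U \<inter> fst ?C)) (\<lambda>x. \<Sum>i\<in>idx (M j). \<Sum>l\<in>idx (M j).
        in_chart (c j) (?G i l) (coord_proj M j x) * pd (j, i) (in_chart ?C f) x * pd (j, l) (in_chart ?C g) x)"
      by (intro coord_smooth_sum coord_smooth_mult coord_smooth_component[OF c]
          coord_smooth_chart_pd[OF c U(2)] coord_smooth_chart_pd[OF c U(3)] G)
    fix p assume p: "p \<in> U" "p \<in> fst ?C"
    have sm: "smooth_near (prod_mfd M) p f" "smooth_near (prod_mfd M) p g"
      by (rule smooth_on_near[OF U(2) p(1)], rule smooth_on_near[OF U(3) p(1)])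
    have "p j \<in> fst (c j)" using p by (auto simp: fst_prod_chart)
    from bivector_formula[OF M A c this smooth_near_slice[OF sm(1)] smooth_near_slice[OF sm(2)]]
    show "lift_bivector M j A p f g = (\<Sum>i\<in>idx (M j). \<Sum>l\<in>idx (M j). in_chart (c j) (?G i l) (coord_proj M j (snd ?C p)) *
        pd (j, i) (in_chart ?C f) (snd ?C p) * pd (j, l) (in_chart ?C g) (snd ?C p))"
      by (simp add: sm lift_bivector_def component_prod_chart[OF c p(2)] chart_pd_slice[OF c p(2)]
          chart_pd_def[of ?C] del: comp_apply)
  qed
  then show "smooth_near (prod_mfd M) p (\<lambda>q. lift_bivector M j A q f g)"
    using U(1) by (rule smooth_on_near)
qed

end

section \<open>Brackets of sums\<close>

lemma sum_additive:
  fixes F :: "'x::ab_group_add \<Rightarrow> 'y::ab_group_add"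
  assumes P: "P 0" "\<And>x y. P x \<Longrightarrow> P y \<Longrightarrow> P (x + y)"
    and F: "\<And>x y. P x \<Longrightarrow> P y \<Longrightarrow> F (x + y) = F x + F y" and X: "\<And>a. a \<in> S \<Longrightarrow> P (X a)"
  shows "F (\<Sum>a\<in>S. X a) = (\<Sum>a\<in>S. F (X a))"
proof -
  have "F 0 = 0" using F[OF P(1) P(1)] by simp
  moreover have "P (\<Sum>a\<in>S. X a) \<and> F (\<Sum>a\<in>S. X a) = (\<Sum>a\<in>S. F (X a))" if "finite S"
    using that X
  proof (induction S rule: finite_induct)
    case empty
    show ?case using P(1) \<open>F 0 = 0\<close> by simp
  next
    case (insert a S)
    then show ?case using P(2)[of "X a" "sum X S"] F[of "X a" "sum X S"] by simp
  qed
  ultimately show ?thesis by (cases "finite S") simp_all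
qed

context
  fixes M :: "('a, 'i, 'k::real_normed_field) mfd"
  assumes M: "manifold M"
begin

lemma vf_bracket_add_left:
  assumes "vector_field M X" "vector_field M X'" "vector_field M Y"
  shows "vf_bracket M (X + X') Y = vf_bracket M X Y + vf_bracket M X' Y"
proof (intro ext)
  fix p f
  show "vf_bracket M (X + X') Y p f = (vf_bracket M X Y + vf_bracket M X' Y) p f"
  proof (cases "smooth_near M p f")
    case True
    have p: "p \<in> pts M" using True by (rule smooth_near_pts)
    show ?thesis
      using True derivation_add[OF vector_field_derivation[OF M assms(3) p]
          vector_field_smooth[OF assms(1) True] vector_field_smooth[OF assms(2) True]]
      by (simp add: vf_bracket_def)
  qed (simp add: vf_bracket_def)
qed

lemma vf_bracket_skew: "vf_bracket M X Y = - vf_bracket M Y X"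
  by (auto simp: vf_bracket_def fun_eq_iff)

lemma vf_bracket_sum_left:
  assumes "\<And>a. a \<in> S \<Longrightarrow> vector_field M (X a)" "vector_field M Y"
  shows "vf_bracket M (\<Sum>a\<in>S. X a) Y = (\<Sum>a\<in>S. vf_bracket M (X a) Y)"
  by (rule sum_additive[where P = "vector_field M" and F = "\<lambda>X. vf_bracket M X Y"])
    (intro vector_field_zero vector_field_add vf_bracket_add_left M assms | assumption)+

lemma vf_bracket_sum_right:
  assumes "\<And>a. a \<in> S \<Longrightarrow> vector_field M (X a)" "vector_field M Y"
  shows "vf_bracket M Y (\<Sum>a\<in>S. X a) = (\<Sum>a\<in>S. vf_bracket M Y (X a))"
proof -
  have "vf_bracket M Y (\<Sum>a\<in>S. X a) = - (\<Sum>a\<in>S. vf_bracket M (X a) Y)"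
    by (subst vf_bracket_skew) (simp add: vf_bracket_sum_left[OF assms])
  also have "\<dots> = (\<Sum>a\<in>S. vf_bracket M Y (X a))"
    unfolding sum_negf[symmetric] by (intro sum.cong refl vf_bracket_skew[symmetric])
  finally show ?thesis .
qed

lemma schouten12_add_right:
  assumes X: "vector_field M X" and A: "bivector_field M A" "bivector_field M B"
  shows "schouten12 M X (A + B) = schouten12 M X A + schouten12 M X B"
proof (intro ext)
  fix p f g
  show "schouten12 M X (A + B) p f g = (schouten12 M X A + schouten12 M X B) p f g"
  proof (cases "smooth_near M p f \<and> smooth_near M p g")
    case True
    then have p: "p \<in> pts M" using smooth_near_pts[of M p f] by blast
    show ?thesis
      using True derivation_add[OF vector_field_derivation[OF M X p], of "\<lambda>q. A q f g" "\<lambda>q. B q f g"]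
        bivector_smooth[OF A(1)] bivector_smooth[OF A(2)]
      by (simp add: schouten12_def)
  qed (auto simp: schouten12_def)
qed

lemma schouten12_sum_right:
  assumes "vector_field M X" "\<And>a. a \<in> S \<Longrightarrow> bivector_field M (A a)"
  shows "schouten12 M X (\<Sum>a\<in>S. A a) = (\<Sum>a\<in>S. schouten12 M X (A a))"
  by (rule sum_additive[where P = "bivector_field M"])
    (intro bivector_field_zero bivector_field_add schouten12_add_right M assms | assumption)+

lemma schouten12_add_left:
  assumes X: "vector_field M X" "vector_field M Y" and A: "bivector_field M A"
  shows "schouten12 M (X + Y) A = schouten12 M X A + schouten12 M Y A"
proof (intro ext)
  fix p f g
  show "schouten12 M (X + Y) A p f g = (schouten12 M X A + schouten12 M Y A) p f g"
  proof (cases "smooth_near M p f \<and> smooth_near M p g")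
    case True
    then have p: "p \<in> pts M" using smooth_near_pts[of M p f] by blast
    show ?thesis
      using True derivation_add[OF bivector_derivation(1)[OF M A p, of f], of "\<lambda>q. X q g" "\<lambda>q. Y q g"]
        derivation_add[OF bivector_derivation(2)[OF M A p, of g], of "\<lambda>q. X q f" "\<lambda>q. Y q f"]
        vector_field_smooth[OF X(1)] vector_field_smooth[OF X(2)]
      by (simp add: schouten12_def)
  qed (auto simp: schouten12_def)
qed

lemma schouten12_sum_left:
  assumes "bivector_field M A" "\<And>a. a \<in> S \<Longrightarrow> vector_field M (X a)"
  shows "schouten12 M (\<Sum>a\<in>S. X a) A = (\<Sum>a\<in>S. schouten12 M (X a) A)"
  by (rule sum_additive[where P = "vector_field M" and F = "\<lambda>X. schouten12 M X A"])
    (intro vector_field_zero vector_field_add schouten12_add_left M assms | assumption)+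

lemma schouten22_commute: "schouten22 M A B = schouten22 M B A"
  by (auto simp: schouten22_def fun_eq_iff)

lemma schouten22_add_left:
  assumes A: "bivector_field M A" "bivector_field M A'" and B: "bivector_field M B"
  shows "schouten22 M (A + A') B = schouten22 M A B + schouten22 M A' B"
proof (intro ext)
  fix p f g h
  show "schouten22 M (A + A') B p f g h = (schouten22 M A B + schouten22 M A' B) p f g h"
  proof (cases "smooth_near M p f \<and> smooth_near M p g \<and> smooth_near M p h")
    case True
    then have p: "p \<in> pts M" using smooth_near_pts[of M p f] by blast
    have "B p u (\<lambda>q. A q v w + A' q v w) = B p u (\<lambda>q. A q v w) + B p u (\<lambda>q. A' q v w)"
      if "smooth_near M p v" "smooth_near M p w" for u v w
      using derivation_add[OF bivector_derivation(1)[OF M B p]]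
        bivector_smooth[OF A(1) that] bivector_smooth[OF A(2) that] by blast
    then show ?thesis
      using True by (simp add: schouten22_def)
  qed (auto simp: schouten22_def)
qed

lemma schouten22_sum_left:
  assumes "\<And>a. a \<in> S \<Longrightarrow> bivector_field M (A a)" "bivector_field M B"
  shows "schouten22 M (\<Sum>a\<in>S. A a) B = (\<Sum>a\<in>S. schouten22 M (A a) B)"
  by (rule sum_additive[where P = "bivector_field M" and F = "\<lambda>A. schouten22 M A B"])
    (intro bivector_field_zero bivector_field_add schouten22_add_left M assms | assumption)+

lemma schouten22_sum:
  assumes "\<And>a. a \<in> S \<Longrightarrow> bivector_field M (A a)"
  shows "schouten22 M (\<Sum>a\<in>S. A a) (\<Sum>a\<in>S. A a) = (\<Sum>a\<in>S. \<Sum>b\<in>S. schouten22 M (A a) (A b))"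
proof -
  have B: "bivector_field M (\<Sum>a\<in>S. A a)"
    by (intro bivector_field_sum M assms)
  have "schouten22 M (A a) (\<Sum>b\<in>S. A b) = (\<Sum>b\<in>S. schouten22 M (A a) (A b))" if a: "a \<in> S" for a
  proof -
    have "schouten22 M (A a) (\<Sum>b\<in>S. A b) = (\<Sum>b\<in>S. schouten22 M (A b) (A a))"
      by (subst schouten22_commute) (intro schouten22_sum_left assms a)
    also have "\<dots> = (\<Sum>b\<in>S. schouten22 M (A a) (A b))"
      by (intro sum.cong refl schouten22_commute)
    finally show ?thesis .
  qed
  moreover have "schouten22 M (\<Sum>a\<in>S. A a) (\<Sum>a\<in>S. A a) = (\<Sum>a\<in>S. schouten22 M (A a) (\<Sum>a\<in>S. A a))"
    by (intro schouten22_sum_left assms B)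
  ultimately show ?thesis by simp
qed

end

section \<open>Brackets on a product\<close>

lemma pd_cmult:
  assumes "finite I" "openin (coord_space I) V" "coord_smooth_on I V f" "i \<in> I" "x \<in> V"
  shows "pd i (\<lambda>y. a * f y) x = a * pd i f x"
  using pd_mult[OF assms(1,2) coord_smooth_const assms(3-5), of a] by simp

context
  fixes M :: "'n::finite \<Rightarrow> ('a, 'i, 'k::real_normed_field) mfd"
  assumes M: "\<And>j. manifold (M j)"
begin

lemma partial_formula:
  assumes jk: "j \<noteq> k" and w: "w \<in> tangent_space (M k) (p k)" and c: "\<And>j. c j \<in> atlas (M j)"
    and q: "p(j := q) \<in> fst (prod_chart M c)" and f: "smooth_near (prod_mfd M) (p(j := q)) f"
  shows "w (\<lambda>q'. f (p(j := q, k := q'))) = (\<Sum>l\<in>idx (M k). w (\<lambda>q. snd (c k) q l) *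
     pd (k, l) (in_chart (prod_chart M c) f)
       (coord_slice M j (snd (prod_chart M c) p) (snd (c j) q)))"
  using tangent_slice_formula[OF M, where v = w and j = k and p = "p(j := q)" and c = c and f = f] w c q f jk
  by (simp add: chart_pd_def prod_chart_upd del: comp_apply)

text \<open>
  To differentiate first along factor \<open>k\<close> and then along factor \<open>j\<close>, the result of the first derivation
  has to be smooth in the \<open>j\<close>-th variable.
\<close>

lemma smooth_partial:
  assumes jk: "j \<noteq> k" and w: "w \<in> tangent_space (M k) (p k)" and p: "p \<in> pts (prod_mfd M)"
    and f: "smooth_on (prod_mfd M) U f"
  shows "smooth_on (M j) {q \<in> pts (M j). p(j := q) \<in> U} (\<lambda>q. w (\<lambda>q'. f (p(j := q, k := q'))))"
proof (rule smooth_onI)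
  define U' where "U' = {q \<in> pts (M j). p(j := q) \<in> U}"
  have U': "openin (top_of (M j)) U'"
    unfolding U'_def by (rule open_slice[OF M smooth_on_open[OF f] p])
  then show "openin (top_of (M j)) {q \<in> pts (M j). p(j := q) \<in> U}" by (simp add: U'_def)
  fix d assume d: "d \<in> atlas (M j)"
  obtain c0 where c0: "\<And>j. c0 j \<in> atlas (M j)" "\<And>j. p j \<in> fst (c0 j)"
    using charts_around[OF M p] by blast
  define c where "c = c0(j := d)"
  have c: "c k \<in> atlas (M k)" for k using c0 d by (auto simp: c_def)
  have cj: "c j = d" by (simp add: c_def)
  let ?C = "prod_chart M c"
  have pq: "p(j := q) \<in> fst ?C" if "q \<in> fst d" for q
    using that c0(2) by (auto simp: fst_prod_chart c_def)
  have upd: "coord_slice M j (snd ?C p) (snd d q) = snd ?C (p(j := q))" for q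
    using prod_chart_upd[of M c p j q] by (simp add: cj)
  define H where "H x = (\<Sum>l\<in>idx (M k). w (\<lambda>q. snd (c k) q l) * pd (k, l) (in_chart ?C f) x)" for x
  have "coord_smooth_on (prod_idx M) (snd ?C ` (U \<inter> fst ?C)) H"
    unfolding H_def
    by (intro coord_smooth_sum coord_smooth_mult coord_smooth_const coord_smooth_chart_pd[OF M c f])
  then have F: "coord_smooth_on (idx (M j)) (snd d ` (U' \<inter> fst d)) (\<lambda>x. H (coord_slice M j (snd ?C p) x))"
    by (rule coord_smooth_slice) (use pq upd in \<open>auto simp: U'_def\<close>)
  have eq: "H (coord_slice M j (snd ?C p) x) = (in_chart d (\<lambda>q. w (\<lambda>q'. f (p(j := q, k := q'))))) x"
    if x: "x \<in> snd d ` (U' \<inter> fst d)" for x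
  proof -
    obtain q where q: "q \<in> fst d" "q \<in> U'" "x = snd d q" using x by blast
    then have "smooth_near (prod_mfd M) (p(j := q)) f"
      using smooth_on_near[OF f] by (auto simp: U'_def)
    from partial_formula[where c = c, OF jk w c pq[OF q(1)] this] show ?thesis
      using chart_inv(1)[OF M d q(1)] by (simp add: H_def cj q(3) del: comp_apply) simp
  qed
  have "coord_smooth_on (idx (M j)) (snd d ` (U' \<inter> fst d)) (in_chart d (\<lambda>q. w (\<lambda>q'. f (p(j := q, k := q')))))"
    by (rule iffD1[OF coord_smooth_cong[OF manifold_finite[OF M] chart_open(4)[OF M d U'] eq] F])
  then show "coord_smooth_on (idx (M j)) (snd d ` ({q \<in> pts (M j). p(j := q) \<in> U} \<inter> fst d))
      (in_chart d (\<lambda>q. w (\<lambda>q'. f (p(j := q, k := q')))))"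
    by (simp add: U'_def)
qed

lemma smooth_near_partial:
  assumes jk: "j \<noteq> k" and w: "w \<in> tangent_space (M k) (p k)" and f: "smooth_near (prod_mfd M) p f"
  shows "smooth_near (M j) (p j) (\<lambda>q. w (\<lambda>q'. f (p(j := q, k := q'))))"
proof -
  obtain U where U: "p \<in> U" "smooth_on (prod_mfd M) U f"
    using f by (auto simp: smooth_near_def)
  have p: "p \<in> pts (prod_mfd M)" using f by (rule smooth_near_pts)
  show ?thesis
    by (rule smooth_on_near[OF smooth_partial[OF jk w p U(2)]]) (use U(1) p in \<open>auto simp: pts_prod_mfd\<close>)
qed

lemma second_partial_formula:
  assumes jk: "j \<noteq> k" and v: "v \<in> tangent_space (M j) (p j)" and w: "w \<in> tangent_space (M k) (p k)"
    and c: "\<And>j. c j \<in> atlas (M j)" "\<And>j. p j \<in> fst (c j)" and f: "smooth_near (prod_mfd M) p f"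
  shows "v (\<lambda>q. w (\<lambda>q'. f (p(j := q, k := q')))) =
    (\<Sum>i\<in>idx (M j). \<Sum>l\<in>idx (M k). v (\<lambda>q. snd (c j) q i) * w (\<lambda>q. snd (c k) q l) *
      pd (j, i) (pd (k, l) (in_chart (prod_chart M c) f)) (snd (prod_chart M c) p))"
proof -
  let ?C = "prod_chart M c"
  define F where "F = in_chart ?C f"
  define H where "H x = (\<Sum>l\<in>idx (M k). w (\<lambda>q. snd (c k) q l) * pd (k, l) F x)" for x
  define g where "g q = w (\<lambda>q'. f (p(j := q, k := q')))" for q
  obtain U where U: "p \<in> U" "smooth_on (prod_mfd M) U f"
    using f by (auto simp: smooth_near_def)
  have p: "p \<in> pts (prod_mfd M)" using f by (rule smooth_near_pts)
  have pC: "p \<in> fst ?C" using c(2) by (simp add: fst_prod_chart)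
  define U' where "U' = {q \<in> pts (M j). p(j := q) \<in> U}"
  have U': "openin (top_of (M j)) U'"
    unfolding U'_def by (rule open_slice[OF M smooth_on_open[OF U(2)] p])
  note oC = chart_open(4)[OF manifold_prod[OF M] prod_chart_in_atlas[OF M c(1)] smooth_on_open[OF U(2)], unfolded idx_prod_mfd]
  note finC = finite_Sigma_idx[OF M]
  have xC: "snd ?C p \<in> snd ?C ` (U \<inter> fst ?C)" using U(1) pC by blast
  have sF: "coord_smooth_on (prod_idx M) (snd ?C ` (U \<inter> fst ?C)) (pd (k, l) F)"
    if "l \<in> idx (M k)" for l
    unfolding F_def by (rule coord_smooth_chart_pd[OF M c(1) U(2) that])
  have "chart_pd (c j) i g (p j) = (\<Sum>l\<in>idx (M k). w (\<lambda>q. snd (c k) q l) * pd (j, i) (pd (k, l) F) (snd ?C p))"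
    if i: "i \<in> idx (M j)" for i
  proof -
    have "chart_pd (c j) i g (p j) = pd i (\<lambda>x. H (coord_slice M j (snd ?C p) x)) (snd (c j) (p j))"
      unfolding chart_pd_def
    proof (rule pd_cong[OF manifold_finite[OF M] chart_open(4)[OF M c(1) U'] _ _ i])
      show "snd (c j) (p j) \<in> snd (c j) ` (U' \<inter> fst (c j))"
        using U(1) p c(2) by (auto simp: U'_def pts_prod_mfd)
      fix x assume "x \<in> snd (c j) ` (U' \<inter> fst (c j))"
      then obtain q where q: "q \<in> fst (c j)" "q \<in> U'" "x = snd (c j) q" by blast
      have pq: "p(j := q) \<in> fst ?C" using q(1) c(2) by (auto simp: fst_prod_chart)
      have "smooth_near (prod_mfd M) (p(j := q)) f"
        using smooth_on_near[OF U(2)] q(2) by (auto simp: U'_def)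
      from partial_formula[where c = c, OF jk w c(1) pq this]
      have "g q = H (coord_slice M j (snd ?C p) x)"
        by (simp only: g_def H_def F_def q(3))
      then show "(in_chart (c j) g) x = H (coord_slice M j (snd ?C p) x)"
        using chart_inv(1)[OF M c(1) q(1)] by (simp add: q(3))
    qed
    also have "\<dots> = pd (j, i) H (coord_slice M j (snd ?C p) (snd (c j) (p j)))"
      by (rule pd_slice[where M = M and j = j, OF i])
    also have "coord_slice M j (snd ?C p) (snd (c j) (p j)) = snd ?C p"
      using prod_chart_upd[of M c p j "p j"] by simp
    also have "pd (j, i) H (snd ?C p) = (\<Sum>l\<in>idx (M k). pd (j, i) (\<lambda>x. w (\<lambda>q. snd (c k) q l) * pd (k, l) F x) (snd ?C p))"
      unfolding H_def
      by (rule pd_sum[OF finC oC _ _ xC]) (use i sF in \<open>auto intro: coord_smooth_mult coord_smooth_const\<close>)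
    also have "\<dots> = (\<Sum>l\<in>idx (M k). w (\<lambda>q. snd (c k) q l) * pd (j, i) (pd (k, l) F) (snd ?C p))"
      by (intro sum.cong refl pd_cmult[OF finC oC sF _ xC]) (use i in auto)
    finally show ?thesis .
  qed
  moreover have "v g = (\<Sum>i\<in>idx (M j). v (\<lambda>q. snd (c j) q i) * chart_pd (c j) i g (p j))"
    by (rule tangent_formula[OF M v c]) (unfold g_def, rule smooth_near_partial[OF jk w f])
  ultimately have "v g = (\<Sum>i\<in>idx (M j). \<Sum>l\<in>idx (M k). v (\<lambda>q. snd (c j) q i) * w (\<lambda>q. snd (c k) q l) *
      pd (j, i) (pd (k, l) F) (snd ?C p))"
    by (simp add: sum_distrib_left mult.assoc)
  then show ?thesis by (simp only: g_def[abs_def] F_def)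
qed

text \<open>
  In a product chart, both sides are combinations of second partial derivatives mixing a coordinate of
  factor \<open>j\<close> with one of factor \<open>k\<close>, and partial derivatives commute.
\<close>

lemma tangent_commute:
  assumes jk: "j \<noteq> k" and v: "v \<in> tangent_space (M j) (p j)" and w: "w \<in> tangent_space (M k) (p k)"
    and f: "smooth_near (prod_mfd M) p f"
  shows "v (\<lambda>q. w (\<lambda>q'. f (p(j := q, k := q')))) = w (\<lambda>q'. v (\<lambda>q. f (p(k := q', j := q))))"
proof -
  have p: "p \<in> pts (prod_mfd M)" using f by (rule smooth_near_pts)
  obtain c where c: "\<And>j. c j \<in> atlas (M j)" "\<And>j. p j \<in> fst (c j)"
    using charts_around[OF M p] by blast
  let ?C = "prod_chart M c"
  have pC: "p \<in> fst ?C" using c(2) by (simp add: fst_prod_chart)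
  obtain U where U: "p \<in> U" "smooth_on (prod_mfd M) U f"
    using f by (auto simp: smooth_near_def)
  have C: "?C \<in> atlas (prod_mfd M)" by (rule prod_chart_in_atlas[OF M c(1)])
  have "pd (j, i) (pd (k, l) (in_chart ?C f)) (snd ?C p) =
      pd (k, l) (pd (j, i) (in_chart ?C f)) (snd ?C p)"
    if "i \<in> idx (M j)" "l \<in> idx (M k)" for i l
    by (rule pd_commute[OF manifold_finite[OF manifold_prod[OF M]]
          chart_open(4)[OF manifold_prod[OF M] C smooth_on_open[OF U(2)]] smooth_onD[OF U(2) C]])
      (use U(1) pC that in \<open>auto simp: idx_prod_mfd\<close>)
  then show ?thesis
    unfolding second_partial_formula[where c = c, OF jk v w c f] second_partial_formula[where c = c, OF jk[symmetric] w v c f]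
    by (subst sum.swap) (simp add: mult_ac cong: sum.cong)
qed

text \<open>
  A derivation along factor \<open>j\<close> sees a lifted field only near \<open>p j\<close>, where the function remains smooth
  and the value of the field is given by a slice.
\<close>

lemma lift_field_slice:
  assumes p: "p \<in> pts (prod_mfd M)" and U: "p \<in> U" "smooth_on (prod_mfd M) U f" and v: "derivation_at (M j) (p j) v"
  shows "v (\<lambda>q. lift_field M k X (p(j := q)) f) = v (\<lambda>q. X ((p(j := q)) k) (\<lambda>q'. f (p(j := q, k := q'))))"
proof (rule derivation_cong[OF v open_slice[OF M smooth_on_open[OF U(2)] p]])
  show "p j \<in> {q \<in> pts (M j). p(j := q) \<in> U}"
    using U(1) p by (auto simp: pts_prod_mfd)
  fix q assume "q \<in> {q \<in> pts (M j). p(j := q) \<in> U}"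
  then have "smooth_near (prod_mfd M) (p(j := q)) f"
    using smooth_on_near[OF U(2)] by blast
  then show "lift_field M k X (p(j := q)) f = X ((p(j := q)) k) (\<lambda>q'. f (p(j := q, k := q')))"
    by (simp add: lift_field_def lift_vector_def)
qed

lemma lift_bivector_slice:
  assumes p: "p \<in> pts (prod_mfd M)" and U: "p \<in> U" "smooth_on (prod_mfd M) U f" "smooth_on (prod_mfd M) U g"
    and v: "derivation_at (M j) (p j) v"
  shows "v (\<lambda>q. lift_bivector M k A (p(j := q)) f g) =
    v (\<lambda>q. A ((p(j := q)) k) (\<lambda>q'. f (p(j := q, k := q'))) (\<lambda>q'. g (p(j := q, k := q'))))"
proof (rule derivation_cong[OF v open_slice[OF M smooth_on_open[OF U(2)] p]])
  show "p j \<in> {q \<in> pts (M j). p(j := q) \<in> U}"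
    using U(1) p by (auto simp: pts_prod_mfd)
  fix q assume "q \<in> {q \<in> pts (M j). p(j := q) \<in> U}"
  then have "smooth_near (prod_mfd M) (p(j := q)) f" "smooth_near (prod_mfd M) (p(j := q)) g"
    using smooth_on_near[OF U(2)] smooth_on_near[OF U(3)] by blast+
  then show "lift_bivector M k A (p(j := q)) f g = A ((p(j := q)) k) (\<lambda>q'. f (p(j := q, k := q'))) (\<lambda>q'. g (p(j := q, k := q')))"
    by (simp add: lift_bivector_def)
qed

lemma lift_field_lift_field:
  assumes X: "vector_field (M j) X" and Y: "vector_field (M k) Y" and f: "smooth_near (prod_mfd M) p f"
  shows "lift_field M j X p (\<lambda>q. lift_field M k Y q f) =
    X (p j) (\<lambda>q. Y ((p(j := q)) k) (\<lambda>q'. f (p(j := q, k := q'))))"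
proof -
  obtain U where U: "p \<in> U" "smooth_on (prod_mfd M) U f"
    using f by (auto simp: smooth_near_def)
  have p: "p \<in> pts (prod_mfd M)" using f by (rule smooth_near_pts)
  then have "p j \<in> pts (M j)" by (simp add: pts_prod_mfd)
  from lift_field_slice[OF p U vector_field_derivation[OF M X this]]
    vector_field_smooth[OF vector_field_lift[where M = M and j = k, OF M Y] f]
  show ?thesis by (simp add: lift_field_def[of M j] lift_vector_def)
qed

lemma lift_field_lift_bivector:
  assumes X: "vector_field (M j) X" and A: "bivector_field (M k) A"
    and f: "smooth_near (prod_mfd M) p f" and g: "smooth_near (prod_mfd M) p g"
  shows "lift_field M j X p (\<lambda>q. lift_bivector M k A q f g) =
    X (p j) (\<lambda>q. A ((p(j := q)) k) (\<lambda>q'. f (p(j := q, k := q'))) (\<lambda>q'. g (p(j := q, k := q'))))"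
proof -
  obtain U where U: "p \<in> U" "smooth_on (prod_mfd M) U f" "smooth_on (prod_mfd M) U g"
    using smooth_near2[OF f g] .
  have p: "p \<in> pts (prod_mfd M)" using f by (rule smooth_near_pts)
  then have "p j \<in> pts (M j)" by (simp add: pts_prod_mfd)
  from lift_bivector_slice[OF p U vector_field_derivation[OF M X this]]
    bivector_smooth[OF bivector_field_lift[where M = M and j = k, OF M A] f g]
  show ?thesis by (simp add: lift_field_def[of M j] lift_vector_def)
qed

lemma lift_bivector_lift_field:
  assumes X: "vector_field (M k) X" and A: "bivector_field (M j) A"
    and f: "smooth_near (prod_mfd M) p f" and g: "smooth_near (prod_mfd M) p g"
  shows "lift_bivector M j A p (\<lambda>q. lift_field M k X q f) g =
    A (p j) (\<lambda>q. X ((p(j := q)) k) (\<lambda>q'. f (p(j := q, k := q')))) (\<lambda>q. g (p(j := q)))"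
    and "lift_bivector M j A p g (\<lambda>q. lift_field M k X q f) =
    A (p j) (\<lambda>q. g (p(j := q))) (\<lambda>q. X ((p(j := q)) k) (\<lambda>q'. f (p(j := q, k := q'))))"
proof -
  obtain U where U: "p \<in> U" "smooth_on (prod_mfd M) U f"
    using f by (auto simp: smooth_near_def)
  have p: "p \<in> pts (prod_mfd M)" using f by (rule smooth_near_pts)
  then have pj: "p j \<in> pts (M j)" by (simp add: pts_prod_mfd)
  note s = vector_field_smooth[OF vector_field_lift[where M = M and j = k, OF M X] f]
  show "lift_bivector M j A p (\<lambda>q. lift_field M k X q f) g =
      A (p j) (\<lambda>q. X ((p(j := q)) k) (\<lambda>q'. f (p(j := q, k := q')))) (\<lambda>q. g (p(j := q)))"
    using lift_field_slice[OF p U bivector_derivation(2)[OF M A pj]] s g by (simp add: lift_bivector_def)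
  show "lift_bivector M j A p g (\<lambda>q. lift_field M k X q f) =
      A (p j) (\<lambda>q. g (p(j := q))) (\<lambda>q. X ((p(j := q)) k) (\<lambda>q'. f (p(j := q, k := q'))))"
    using lift_field_slice[OF p U bivector_derivation(1)[OF M A pj]] s g by (simp add: lift_bivector_def)
qed

lemma lift_bivector_lift_bivector:
  assumes A: "bivector_field (M j) A" and B: "bivector_field (M k) B"
    and f: "smooth_near (prod_mfd M) p f" and g: "smooth_near (prod_mfd M) p g" and h: "smooth_near (prod_mfd M) p h"
  shows "lift_bivector M j A p f (\<lambda>q. lift_bivector M k B q g h) =
    A (p j) (\<lambda>q. f (p(j := q))) (\<lambda>q. B ((p(j := q)) k) (\<lambda>q'. g (p(j := q, k := q'))) (\<lambda>q'. h (p(j := q, k := q'))))"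
proof -
  obtain U where U: "p \<in> U" "smooth_on (prod_mfd M) U g" "smooth_on (prod_mfd M) U h"
    using smooth_near2[OF g h] .
  have p: "p \<in> pts (prod_mfd M)" using f by (rule smooth_near_pts)
  then have "p j \<in> pts (M j)" by (simp add: pts_prod_mfd)
  from lift_bivector_slice[OF p U bivector_derivation(1)[OF M A this]]
    bivector_smooth[OF bivector_field_lift[where M = M and j = k, OF M B] g h] f
  show ?thesis by (simp add: lift_bivector_def[of M j])
qed

lemma vf_bracket_lift_same:
  assumes X: "vector_field (M j) X" and Y: "vector_field (M j) Y"
  shows "vf_bracket (prod_mfd M) (lift_field M j X) (lift_field M j Y) = lift_field M j (vf_bracket (M j) X Y)"
proof (intro ext)
  fix p f
  show "vf_bracket (prod_mfd M) (lift_field M j X) (lift_field M j Y) p f = lift_field M j (vf_bracket (M j) X Y) p f"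
  proof (cases "smooth_near (prod_mfd M) p f")
    case True
    then show ?thesis
      using lift_field_lift_field[OF X Y True] lift_field_lift_field[OF Y X True] smooth_near_slice[OF M True, of j]
      by (simp add: vf_bracket_def) (simp add: lift_field_def lift_vector_def)
  qed (simp add: vf_bracket_def lift_field_def lift_vector_def)
qed

lemma vf_bracket_lift_distinct:
  assumes jk: "j \<noteq> k" and X: "vector_field (M j) X" and Y: "vector_field (M k) Y"
  shows "vf_bracket (prod_mfd M) (lift_field M j X) (lift_field M k Y) = 0"
proof (intro ext)
  fix p f
  show "vf_bracket (prod_mfd M) (lift_field M j X) (lift_field M k Y) p f = 0 p f"
  proof (cases "smooth_near (prod_mfd M) p f")
    case True
    then have p: "p j \<in> pts (M j)" "p k \<in> pts (M k)"
      using smooth_near_pts[of "prod_mfd M" p f] by (auto simp: pts_prod_mfd)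
    from tangent_commute[OF jk vector_field_tangent[OF X p(1)] vector_field_tangent[OF Y p(2)] True]
    show ?thesis
      using True lift_field_lift_field[OF X Y True] lift_field_lift_field[OF Y X True] jk
      by (simp add: vf_bracket_def)
  qed (simp add: vf_bracket_def)
qed

text \<open>
  Along factor \<open>j\<close> the bivector at \<open>p k\<close> is constant, a sum of products of two tangent vectors that
  commute with \<open>v\<close>; what remains is the Leibniz rule.
\<close>

lemma tangent_bivector_distinct:
  assumes jk: "j \<noteq> k" and v: "v \<in> tangent_space (M j) (p j)" and A: "bivector_field (M k) A"
    and f: "smooth_near (prod_mfd M) p f" and g: "smooth_near (prod_mfd M) p g"
  shows "v (\<lambda>q. A (p k) (\<lambda>q'. f (p(j := q, k := q'))) (\<lambda>q'. g (p(j := q, k := q')))) =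
    A (p k) (\<lambda>q'. v (\<lambda>q. f (p(k := q', j := q)))) (\<lambda>q'. g (p(k := q'))) +
    A (p k) (\<lambda>q'. f (p(k := q'))) (\<lambda>q'. v (\<lambda>q. g (p(k := q', j := q))))"
proof -
  have "p \<in> pts (prod_mfd M)" using f by (rule smooth_near_pts)
  then have p: "p j \<in> pts (M j)" "p k \<in> pts (M k)" by (auto simp: pts_prod_mfd)
  obtain m :: nat and x y where xy: "\<forall>b<m. x b \<in> tangent_space (M k) (p k)" "\<forall>b<m. y b \<in> tangent_space (M k) (p k)"
    "A (p k) = (\<lambda>f g. \<Sum>b<m. x b f * y b g)"
    using bivector_decomp[OF A p(2)] .
  note dv = tangent_derivation[OF M v]
  have s: "smooth_near (M j) (p j) (\<lambda>q. x b (\<lambda>q'. f (p(j := q, k := q'))))"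
    "smooth_near (M j) (p j) (\<lambda>q. y b (\<lambda>q'. g (p(j := q, k := q'))))" if "b < m" for b
    using smooth_near_partial[OF jk _ f] smooth_near_partial[OF jk _ g] xy that by blast+
  have "v (\<lambda>q. A (p k) (\<lambda>q'. f (p(j := q, k := q'))) (\<lambda>q'. g (p(j := q, k := q')))) =
      (\<Sum>b<m. v (\<lambda>q. x b (\<lambda>q'. f (p(j := q, k := q'))) * y b (\<lambda>q'. g (p(j := q, k := q')))))"
    unfolding xy(3) by (rule derivation_sum[OF dv p(1)]) (intro smooth_near_mult s, simp_all)
  also have "\<dots> = (\<Sum>b<m. x b (\<lambda>q'. v (\<lambda>q. f (p(k := q', j := q)))) * y b (\<lambda>q'. g (p(k := q'))) +
      x b (\<lambda>q'. f (p(k := q'))) * y b (\<lambda>q'. v (\<lambda>q. g (p(k := q', j := q)))))"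
  proof (rule sum.cong[OF refl])
    fix b assume "b \<in> {..<m}"
    then have b: "b < m" by simp
    show "v (\<lambda>q. x b (\<lambda>q'. f (p(j := q, k := q'))) * y b (\<lambda>q'. g (p(j := q, k := q')))) =
        x b (\<lambda>q'. v (\<lambda>q. f (p(k := q', j := q)))) * y b (\<lambda>q'. g (p(k := q'))) +
        x b (\<lambda>q'. f (p(k := q'))) * y b (\<lambda>q'. v (\<lambda>q. g (p(k := q', j := q))))"
      using derivation_mult[OF dv s[OF b]] tangent_commute[OF jk v _ f, of "x b"] tangent_commute[OF jk v _ g, of "y b"]
        xy(1,2) b by simp
  qed
  finally show ?thesis
    by (simp add: xy(3) sum.distrib)
qed

lemma schouten12_lift_same:
  assumes X: "vector_field (M j) X" and A: "bivector_field (M j) A"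
  shows "schouten12 (prod_mfd M) (lift_field M j X) (lift_bivector M j A) = lift_bivector M j (schouten12 (M j) X A)"
proof (intro ext)
  fix p f g
  show "schouten12 (prod_mfd M) (lift_field M j X) (lift_bivector M j A) p f g = lift_bivector M j (schouten12 (M j) X A) p f g"
  proof (cases "smooth_near (prod_mfd M) p f \<and> smooth_near (prod_mfd M) p g")
    case True
    then have f: "smooth_near (prod_mfd M) p f" and g: "smooth_near (prod_mfd M) p g" by auto
    show ?thesis
      using lift_field_lift_bivector[OF X A f g] lift_bivector_lift_field(1)[OF X A f g] lift_bivector_lift_field(2)[OF X A g f]
        smooth_near_slice[OF M f, of j] smooth_near_slice[OF M g, of j] f g
      by (simp add: schouten12_def) (simp add: lift_bivector_def)
  qed (auto simp: schouten12_def lift_bivector_def)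
qed

lemma schouten12_lift_distinct:
  assumes jk: "j \<noteq> k" and X: "vector_field (M j) X" and A: "bivector_field (M k) A"
  shows "schouten12 (prod_mfd M) (lift_field M j X) (lift_bivector M k A) = 0"
proof (intro ext)
  fix p f g
  show "schouten12 (prod_mfd M) (lift_field M j X) (lift_bivector M k A) p f g = 0 p f g"
  proof (cases "smooth_near (prod_mfd M) p f \<and> smooth_near (prod_mfd M) p g")
    case True
    then have f: "smooth_near (prod_mfd M) p f" and g: "smooth_near (prod_mfd M) p g" by auto
    then have "p j \<in> pts (M j)"
      using smooth_near_pts[of "prod_mfd M" p f] by (auto simp: pts_prod_mfd)
    from tangent_bivector_distinct[OF jk vector_field_tangent[OF X this] A f g]
    show ?thesis
      using lift_field_lift_bivector[OF X A f g] lift_bivector_lift_field(1)[OF X A f g] lift_bivector_lift_field(2)[OF X A g f]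
        f g jk
      by (simp add: schouten12_def)
  qed (auto simp: schouten12_def)
qed

lemma schouten22_lift_same:
  assumes A: "bivector_field (M j) A"
  shows "schouten22 (prod_mfd M) (lift_bivector M j A) (lift_bivector M j A) =
    (\<lambda>p f g h. if smooth_near (prod_mfd M) p f \<and> smooth_near (prod_mfd M) p g \<and> smooth_near (prod_mfd M) p h
       then schouten22 (M j) A A (p j) (\<lambda>q. f (p(j := q))) (\<lambda>q. g (p(j := q))) (\<lambda>q. h (p(j := q))) else 0)"
proof (intro ext)
  fix p f g h
  show "schouten22 (prod_mfd M) (lift_bivector M j A) (lift_bivector M j A) p f g h =
    (if smooth_near (prod_mfd M) p f \<and> smooth_near (prod_mfd M) p g \<and> smooth_near (prod_mfd M) p h
       then schouten22 (M j) A A (p j) (\<lambda>q. f (p(j := q))) (\<lambda>q. g (p(j := q))) (\<lambda>q. h (p(j := q))) else 0)"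
  proof (cases "smooth_near (prod_mfd M) p f \<and> smooth_near (prod_mfd M) p g \<and> smooth_near (prod_mfd M) p h")
    case True
    then have f: "smooth_near (prod_mfd M) p f" and g: "smooth_near (prod_mfd M) p g"
      and h: "smooth_near (prod_mfd M) p h" by auto
    show ?thesis
      using lift_bivector_lift_bivector[OF A A f g h] lift_bivector_lift_bivector[OF A A g h f]
        lift_bivector_lift_bivector[OF A A h f g] smooth_near_slice[OF M f, of j] smooth_near_slice[OF M g, of j]
        smooth_near_slice[OF M h, of j] f g h
      by (simp add: schouten22_def)
  qed (auto simp: schouten22_def)
qed

lemma lift_bivector_lift_distinct:
  assumes jk: "j \<noteq> k" and A: "bivector_field (M j) A" and B: "bivector_field (M k) B"
    and w: "\<forall>a<m. w a \<in> tangent_space (M j) (p j)" and Ap: "A (p j) = (\<lambda>f g. \<Sum>a<(m::nat). v a f * w a g)"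
    and y: "\<forall>b<n. y b \<in> tangent_space (M k) (p k)" and Bp: "B (p k) = (\<lambda>f g. \<Sum>b<(n::nat). x b f * y b g)"
    and f: "smooth_near (prod_mfd M) p f" and g: "smooth_near (prod_mfd M) p g" and h: "smooth_near (prod_mfd M) p h"
  shows "lift_bivector M j A p f (\<lambda>q. lift_bivector M k B q g h) = (\<Sum>a<m. \<Sum>b<n.
      v a (\<lambda>q. f (p(j := q))) * x b (\<lambda>q. g (p(k := q))) * w a (\<lambda>q. y b (\<lambda>q'. h (p(j := q, k := q')))) -
      v a (\<lambda>q. f (p(j := q))) * x b (\<lambda>q. h (p(k := q))) * w a (\<lambda>q. y b (\<lambda>q'. g (p(j := q, k := q')))))"
proof -
  have *: "w a (\<lambda>q. B (p k) (\<lambda>q'. g (p(j := q, k := q'))) (\<lambda>q'. h (p(j := q, k := q')))) =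
      (\<Sum>b<n. x b (\<lambda>q. g (p(k := q))) * w a (\<lambda>q. y b (\<lambda>q'. h (p(j := q, k := q')))) -
        x b (\<lambda>q. h (p(k := q))) * w a (\<lambda>q. y b (\<lambda>q'. g (p(j := q, k := q')))))" if a: "a < m" for a
  proof -
    have wa: "w a \<in> tangent_space (M j) (p j)" using w a by blast
    have N: "w a (\<lambda>q. y b (\<lambda>q'. f (p(j := q, k := q')))) = y b (\<lambda>q'. w a (\<lambda>q. f (p(k := q', j := q))))"
      if "b < n" "smooth_near (prod_mfd M) p f" for b f
      using tangent_commute[OF jk wa _ that(2)] y that(1) by blast
    have "w a (\<lambda>q. B (p k) (\<lambda>q'. g (p(j := q, k := q'))) (\<lambda>q'. h (p(j := q, k := q')))) =
        B (p k) (\<lambda>q'. g (p(k := q'))) (\<lambda>q'. w a (\<lambda>q. h (p(k := q', j := q)))) -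
        B (p k) (\<lambda>q'. h (p(k := q'))) (\<lambda>q'. w a (\<lambda>q. g (p(k := q', j := q))))"
      unfolding tangent_bivector_distinct[OF jk wa B g h]
      using bivector_skew[OF B, of "p k" "\<lambda>q'. w a (\<lambda>q. g (p(k := q', j := q)))" "\<lambda>q'. h (p(k := q'))"]
      by simp
    then show ?thesis by (simp add: Bp N g h sum_subtractf)
  qed
  have "lift_bivector M j A p f (\<lambda>q. lift_bivector M k B q g h) =
      A (p j) (\<lambda>q. f (p(j := q))) (\<lambda>q. B (p k) (\<lambda>q'. g (p(j := q, k := q'))) (\<lambda>q'. h (p(j := q, k := q'))))"
    using lift_bivector_lift_bivector[OF A B f g h] jk by simp
  also have "\<dots> = (\<Sum>a<m. v a (\<lambda>q. f (p(j := q))) *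
      w a (\<lambda>q. B (p k) (\<lambda>q'. g (p(j := q, k := q'))) (\<lambda>q'. h (p(j := q, k := q')))))"
    by (simp only: Ap)
  finally show ?thesis
    by (simp add: * sum_distrib_left right_diff_distrib mult.assoc)
qed

text \<open>
  Each summand of the bracket is a difference of two terms \<open>E\<close>, which contain first derivatives of two
  of the functions and a mixed second derivative of the third one. As both bivectors are skew, every
  term occurs twice in the cyclic sum, with opposite signs.
\<close>

lemma schouten22_lift_distinct:
  assumes jk: "j \<noteq> k" and A: "bivector_field (M j) A" and B: "bivector_field (M k) B"
  shows "schouten22 (prod_mfd M) (lift_bivector M j A) (lift_bivector M k B) = 0"
proof (intro ext)
  fix p f g h
  show "schouten22 (prod_mfd M) (lift_bivector M j A) (lift_bivector M k B) p f g h = 0 p f g h"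
  proof (cases "smooth_near (prod_mfd M) p f \<and> smooth_near (prod_mfd M) p g \<and> smooth_near (prod_mfd M) p h")
    case True
    then have p: "p j \<in> pts (M j)" "p k \<in> pts (M k)"
      using smooth_near_pts[of "prod_mfd M" p f] by (auto simp: pts_prod_mfd)
    obtain m :: nat and v w where vw: "\<forall>a<m. v a \<in> tangent_space (M j) (p j)" "\<forall>a<m. w a \<in> tangent_space (M j) (p j)"
      "A (p j) = (\<lambda>f g. \<Sum>a<m. v a f * w a g)"
      using bivector_decomp[OF A p(1)] .
    obtain n :: nat and x y where xy: "\<forall>b<n. x b \<in> tangent_space (M k) (p k)" "\<forall>b<n. y b \<in> tangent_space (M k) (p k)"
      "B (p k) = (\<lambda>f g. \<Sum>b<n. x b f * y b g)"
      using bivector_decomp[OF B p(2)] .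
    define E where "E f g h = (\<Sum>a<m. \<Sum>b<n. v a (\<lambda>q. f (p(j := q))) * x b (\<lambda>q. g (p(k := q))) *
      w a (\<lambda>q. y b (\<lambda>q'. h (p(j := q, k := q')))))" for f g h
    have 1: "lift_bivector M j A p f (\<lambda>q. lift_bivector M k B q g h) = E f g h - E f h g"
      if "smooth_near (prod_mfd M) p f" "smooth_near (prod_mfd M) p g" "smooth_near (prod_mfd M) p h" for f g h
      unfolding E_def lift_bivector_lift_distinct[OF jk A B vw(2,3) xy(2,3) that] by (simp add: sum_subtractf)
    have 2: "lift_bivector M k B p f (\<lambda>q. lift_bivector M j A q g h) = E g f h - E h f g"
      if sm: "smooth_near (prod_mfd M) p f" "smooth_near (prod_mfd M) p g" "smooth_near (prod_mfd M) p h" for f g h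
    proof -
      have N: "y b (\<lambda>q. w a (\<lambda>q'. f (p(k := q, j := q')))) = w a (\<lambda>q. y b (\<lambda>q'. f (p(j := q, k := q'))))"
        if "a < m" "b < n" "smooth_near (prod_mfd M) p f" for a b f
      proof -
        have "w a \<in> tangent_space (M j) (p j)" "y b \<in> tangent_space (M k) (p k)"
          using vw(2) xy(2) that(1,2) by blast+
        from tangent_commute[OF jk this that(3)] show ?thesis by simp
      qed
      show ?thesis
        unfolding E_def sum_subtractf[symmetric]
          lift_bivector_lift_distinct[OF jk[symmetric] B A xy(2,3) vw(2,3) sm]
        by (subst sum.swap) (intro sum.cong refl, simp add: N sm mult_ac)
    qed
    show ?thesis
      using True by (simp add: schouten22_def 1 2)
  qed (auto simp: schouten22_def)
qed

end

section \<open>Tensors as forms\<close>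

text \<open>
  Contracting one leg of a tensor with a linear form leaves a vector. This turns calculations with a
  presentation \<open>\<Sum>\<^sub>i x\<^sub>i \<otimes> y\<^sub>i\<close> into calculations with brackets of vectors.
\<close>

definition left_contraction ::
    "('k::field \<Rightarrow> 'v::ab_group_add \<Rightarrow> 'v) \<Rightarrow> ('v, 'k) tensor2 \<Rightarrow> (('v \<Rightarrow> 'k) \<Rightarrow> 'v) \<Rightarrow> bool" where
  "left_contraction scl a L \<longleftrightarrow> (\<forall>\<xi> \<eta>. linear_form scl \<xi> \<and> linear_form scl \<eta> \<longrightarrow> a \<xi> \<eta> = \<xi> (L \<eta>))"

definition right_contraction ::
    "('k::field \<Rightarrow> 'v::ab_group_add \<Rightarrow> 'v) \<Rightarrow> ('v, 'k) tensor2 \<Rightarrow> (('v \<Rightarrow> 'k) \<Rightarrow> 'v) \<Rightarrow> bool" where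
  "right_contraction scl a R \<longleftrightarrow> (\<forall>\<xi> \<eta>. linear_form scl \<xi> \<and> linear_form scl \<eta> \<longrightarrow> a \<xi> \<eta> = \<eta> (R \<xi>))"

lemma left_contractionD:
  "left_contraction scl a L \<Longrightarrow> linear_form scl \<xi> \<Longrightarrow> linear_form scl \<eta> \<Longrightarrow> a \<xi> \<eta> = \<xi> (L \<eta>)"
  by (simp add: left_contraction_def)

lemma right_contractionD:
  "right_contraction scl a R \<Longrightarrow> linear_form scl \<xi> \<Longrightarrow> linear_form scl \<eta> \<Longrightarrow> a \<xi> \<eta> = \<eta> (R \<xi>)"
  by (simp add: right_contraction_def)

lemma exterior_squareD:
  assumes "a \<in> exterior_square scl"
  shows "a \<in> tensor_square scl" "a \<xi> \<eta> = - a \<eta> \<xi>"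
proof -
  show "a \<in> tensor_square scl" using assms by (simp add: exterior_square_def)
  have "flip a = - a" using assms by (simp add: exterior_square_def)
  from fun_cong[OF fun_cong[OF this, of \<eta>], of \<xi>] show "a \<xi> \<eta> = - a \<eta> \<xi>"
    by (simp add: flip_def)
qed

lemma symmetric_squareD:
  assumes "a \<in> symmetric_square scl"
  shows "a \<in> tensor_square scl" "a \<xi> \<eta> = a \<eta> \<xi>"
proof -
  show "a \<in> tensor_square scl" using assms by (simp add: symmetric_square_def)
  have "flip a = a" using assms by (simp add: symmetric_square_def)
  from fun_cong[OF fun_cong[OF this, of \<eta>], of \<xi>] show "a \<xi> \<eta> = a \<eta> \<xi>"
    by (simp add: flip_def)
qed

lemma tensor_zero:
  assumes "a \<in> tensor_square scl"
  shows "a (\<lambda>_. 0) \<eta> = 0" "a \<xi> (\<lambda>_. 0) = 0"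
  using assms by (auto simp: tensor_square_def sum_fun_apply tens2_def intro!: sum.neutral)

context vector_space
begin

lemma linear_form_iff:
  "linear_form scale \<xi> \<longleftrightarrow> (\<forall>x y. \<xi> (x + y) = \<xi> x + \<xi> y) \<and> (\<forall>c x. \<xi> (scale c x) = c * \<xi> x)"
proof
  assume "linear_form scale \<xi>"
  then interpret \<xi>: Vector_Spaces.linear scale "(*)" \<xi> .
  show "(\<forall>x y. \<xi> (x + y) = \<xi> x + \<xi> y) \<and> (\<forall>c x. \<xi> (scale c x) = c * \<xi> x)"
    by (simp add: \<xi>.add \<xi>.scale)
next
  assume "(\<forall>x y. \<xi> (x + y) = \<xi> x + \<xi> y) \<and> (\<forall>c x. \<xi> (scale c x) = c * \<xi> x)"
  then show "linear_form scale \<xi>"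
    by unfold_locales (auto simp: algebra_simps)
qed

lemma linear_form_add: "linear_form scale \<xi> \<Longrightarrow> \<xi> (x + y) = \<xi> x + \<xi> y"
  and linear_form_scale: "linear_form scale \<xi> \<Longrightarrow> \<xi> (scale c x) = c * \<xi> x"
  using linear_form_iff by blast+

lemma linear_form_zero: "linear_form scale \<xi> \<Longrightarrow> \<xi> 0 = 0"
  using linear_form_scale[of \<xi> 0 0] by simp

lemma linear_form_minus: "linear_form scale \<xi> \<Longrightarrow> \<xi> (- x) = - \<xi> x"
  using linear_form_add[of \<xi> x "- x"] linear_form_zero[of \<xi>] by (simp add: eq_neg_iff_add_eq_0 add.commute)

lemma linear_form_of_sum: "linear_form scale \<xi> \<Longrightarrow> \<xi> (\<Sum>a\<in>S. x a) = (\<Sum>a\<in>S. \<xi> (x a))"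
  by (induction S rule: infinite_finite_induct) (simp_all add: linear_form_zero linear_form_add)

lemma contractions:
  assumes "a \<in> tensor_square scale"
  obtains L R where "left_contraction scale a L" "right_contraction scale a R"
proof -
  obtain m :: nat and u v where a: "a = (\<Sum>i<m. tens2 scale (u i) (v i))"
    using assms by (auto simp: tensor_square_def)
  show ?thesis
  proof (rule that[of "\<lambda>\<eta>. \<Sum>i<m. scale (\<eta> (v i)) (u i)" "\<lambda>\<xi>. \<Sum>i<m. scale (\<xi> (u i)) (v i)"])
    show "left_contraction scale a (\<lambda>\<eta>. \<Sum>i<m. scale (\<eta> (v i)) (u i))"
      unfolding left_contraction_def
      by (simp add: a sum_fun_apply tens2_def linear_form_of_sum linear_form_scale mult.commute)
    show "right_contraction scale a (\<lambda>\<xi>. \<Sum>i<m. scale (\<xi> (u i)) (v i))"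
      unfolding right_contraction_def
      by (simp add: a sum_fun_apply tens2_def linear_form_of_sum linear_form_scale)
  qed
qed

lemma right_contraction_symmetric:
  assumes "a \<in> symmetric_square scale" "left_contraction scale a L"
  shows "right_contraction scale a L"
  unfolding right_contraction_def
  using symmetric_squareD(2)[OF assms(1)] left_contractionD[OF assms(2)] by metis

lemma right_contraction_skew:
  assumes "a \<in> exterior_square scale" "left_contraction scale a L"
  shows "right_contraction scale a (\<lambda>\<xi>. - L \<xi>)"
  unfolding right_contraction_def
proof (intro allI impI)
  fix \<xi> \<eta> assume "linear_form scale \<xi> \<and> linear_form scale \<eta>"
  then show "a \<xi> \<eta> = \<eta> (- L \<xi>)"
    using exterior_squareD(2)[OF assms(1), of \<xi> \<eta>] left_contractionD[OF assms(2), of \<eta> \<xi>] linear_form_minus[of \<eta>]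
    by simp
qed

lemma tensor_squareI: "(\<Sum>i<(m::nat). tens2 scale (u i) (v i)) \<in> tensor_square scale"
  unfolding tensor_square_def by blast

lemma tensor_square_zero: "0 \<in> tensor_square scale"
  using tensor_squareI[of _ _ 0] by simp

lemma tensor_square_tens2: "tens2 scale u v \<in> tensor_square scale"
  using tensor_squareI[of "\<lambda>_. u" "\<lambda>_. v" 1] by simp

lemma tensor_square_add:
  assumes "a \<in> tensor_square scale" "b \<in> tensor_square scale"
  shows "a + b \<in> tensor_square scale"
proof -
  obtain m :: nat and u v where a: "a = (\<Sum>i<m. tens2 scale (u i) (v i))"
    using assms(1) by (auto simp: tensor_square_def)
  obtain n :: nat and x y where b: "b = (\<Sum>i<n. tens2 scale (x i) (y i))"
    using assms(2) by (auto simp: tensor_square_def)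
  define U where "U i = (if i < m then u i else x (i - m))" for i
  define V where "V i = (if i < m then v i else y (i - m))" for i
  have split: "(\<Sum>i<m+n. F i) = (\<Sum>i<m. F i) + (\<Sum>i<n. F (i + m))" for F :: "nat \<Rightarrow> ('b, 'a) tensor2"
    by (induction n) (simp_all add: add.assoc add.commute[of _ m])
  have "a + b = (\<Sum>i<m+n. tens2 scale (U i) (V i))"
    unfolding split a b by (intro arg_cong2[where f = "(+)"] sum.cong) (auto simp: U_def V_def)
  then show ?thesis by (simp only: tensor_squareI)
qed

lemma tens2_minus: "- tens2 scale u v = tens2 scale (- u) v"
  by (auto simp: tens2_def fun_eq_iff linear_form_minus)

lemma tensor_square_minus:
  assumes "a \<in> tensor_square scale"
  shows "- a \<in> tensor_square scale"
proof -
  obtain m :: nat and u v where "a = (\<Sum>i<m. tens2 scale (u i) (v i))"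
    using assms by (auto simp: tensor_square_def)
  then have "- a = (\<Sum>i<m. tens2 scale (- u i) (v i))"
    by (simp only: sum_negf[symmetric] tens2_minus)
  then show ?thesis by (simp only: tensor_squareI)
qed

lemma tensor_square_sum:
  "(\<And>i. i \<in> S \<Longrightarrow> a i \<in> tensor_square scale) \<Longrightarrow> (\<Sum>i\<in>S. a i) \<in> tensor_square scale"
proof (induction S rule: infinite_finite_induct)
  case (insert i S)
  then show ?case
    unfolding sum.insert[OF insert.hyps] by (intro tensor_square_add) auto
qed (simp_all add: tensor_square_zero)

end

lemma ad2_apply:
  "linear_form scl \<xi> \<Longrightarrow> linear_form scl \<eta> \<Longrightarrow>
    ad2 scl brk x a \<xi> \<eta> = a (\<lambda>y. \<xi> (brk x y)) \<eta> + a \<xi> (\<lambda>y. \<eta> (brk x y))"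
  by (simp add: ad2_def tens_map_def comp_def)

section \<open>The classical Yang-Baxter expression\<close>

context lie_algebra
begin

lemma brk_skew: "brk x y = - brk y x"
proof -
  have "brk (x + y) (x + y) = brk x y + brk y x"
    unfolding brk_add_left brk_add_right by (simp add: brk_self)
  then have "brk x y + brk y x = 0" by (simp only: brk_self)
  then show ?thesis by (simp add: eq_neg_iff_add_eq_0)
qed

lemma brk_minus: "brk (- x) y = - brk x y" "brk x (- y) = - brk x y"
  using brk_scale_left[of "-1" x y] brk_scale_right[of x "-1" y] by simp_all

lemma brk_zero: "brk 0 y = 0" "brk y 0 = 0"
  using brk_scale_left[of 0 0 y] brk_scale_right[of y 0 0] by simp_all

lemma brk_sum_left: "brk (\<Sum>a\<in>S. x a) y = (\<Sum>a\<in>S. brk (x a) y)"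
  by (induction S rule: infinite_finite_induct) (simp_all add: brk_add_left brk_zero)

lemma brk_sum_right: "brk y (\<Sum>a\<in>S. x a) = (\<Sum>a\<in>S. brk y (x a))"
  by (induction S rule: infinite_finite_induct) (simp_all add: brk_add_right brk_zero)

lemma form_brk_skew: "linear_form scl \<xi> \<Longrightarrow> \<xi> (brk x y) = - \<xi> (brk y x)"
  using brk_skew[of x y] linear_form_minus[of \<xi>] by simp

lemma CYB_zero:
  assumes "a \<in> tensor_square scl"
  shows "CYB scl brk a (\<lambda>_. 0) \<eta> \<zeta> = 0" "CYB scl brk a \<xi> (\<lambda>_. 0) \<zeta> = 0" "CYB scl brk a \<xi> \<eta> (\<lambda>_. 0) = 0"
  by (simp_all add: CYB_def tensor_zero[OF assms])

text \<open>
  In each of the three brackets, two legs of the tensor are paired with forms directly; contracting them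
  leaves one bracket of two vectors.
\<close>

lemma CYB_contraction:
  assumes L: "left_contraction scl a L" and R: "right_contraction scl a R"
    and l: "linear_form scl \<xi>" "linear_form scl \<eta>" "linear_form scl \<zeta>"
  shows "CYB scl brk a \<xi> \<eta> \<zeta> = \<xi> (brk (L \<eta>) (L \<zeta>)) + \<eta> (brk (R \<xi>) (L \<zeta>)) + \<zeta> (brk (R \<xi>) (R \<eta>))"
proof -
  note L = left_contractionD[OF L] and R = right_contractionD[OF R]
  have 1: "a (\<lambda>x. a (\<lambda>x'. \<xi> (brk x x')) \<zeta>) \<eta> = \<xi> (brk (L \<eta>) (L \<zeta>))"
    using L[OF linear_form_brk(1)[OF l(1)] l(3)] L[OF linear_form_brk(2)[OF l(1)] l(2)] by simp
  have 2: "a \<xi> (\<lambda>y. a (\<lambda>x. \<eta> (brk y x)) \<zeta>) = \<eta> (brk (R \<xi>) (L \<zeta>))"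
    using L[OF linear_form_brk(1)[OF l(2)] l(3)] R[OF l(1) linear_form_brk(2)[OF l(2)]] by simp
  have 3: "a \<xi> (\<lambda>y. a \<eta> (\<lambda>y'. \<zeta> (brk y y'))) = \<zeta> (brk (R \<xi>) (R \<eta>))"
    using R[OF l(2) linear_form_brk(1)[OF l(3)]] R[OF l(1) linear_form_brk(2)[OF l(3)]] by simp
  show ?thesis using l by (simp add: CYB_def 1 2 3)
qed

lemma invariant_contraction:
  assumes s: "s \<in> symmetric_square scl" and inv: "ad_invariant scl brk s" and L: "left_contraction scl s L"
    and l: "linear_form scl \<xi>" "linear_form scl \<eta>"
  shows "\<xi> (brk x (L \<eta>)) = - \<eta> (brk x (L \<xi>))"
proof -
  have "s (\<lambda>y. \<xi> (brk x y)) \<eta> + s \<xi> (\<lambda>y. \<eta> (brk x y)) = 0"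
    using inv ad2_apply[OF l, of brk x s] by (simp add: ad_invariant_def)
  moreover have "s \<xi> (\<lambda>y. \<eta> (brk x y)) = \<eta> (brk x (L \<xi>))"
    using right_contractionD[OF right_contraction_symmetric[OF s L] l(1) linear_form_brk(1)[OF l(2)]] .
  moreover have "s (\<lambda>y. \<xi> (brk x y)) \<eta> = \<xi> (brk x (L \<eta>))"
    using left_contractionD[OF L linear_form_brk(1)[OF l(1)] l(2)] .
  ultimately show ?thesis by (simp add: eq_neg_iff_add_eq_0)
qed

text \<open>
  Invariance and symmetry move a bracket from one leg to another. Hence the three terms of \<open>CYB(s)\<close> agree
  up to sign, and any one of them represents it.
\<close>

lemma CYB_invariant:
  assumes s: "s \<in> symmetric_square scl" and inv: "ad_invariant scl brk s" and L: "left_contraction scl s L"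
    and l: "linear_form scl \<xi>" "linear_form scl \<eta>" "linear_form scl \<zeta>"
  shows "CYB scl brk s \<xi> \<eta> \<zeta> = \<xi> (brk (L \<eta>) (L \<zeta>))"
    and "CYB scl brk s \<xi> \<eta> \<zeta> = - \<eta> (brk (L \<xi>) (L \<zeta>))"
    and "CYB scl brk s \<xi> \<eta> \<zeta> = \<zeta> (brk (L \<xi>) (L \<eta>))"
proof -
  note I = invariant_contraction[OF s inv L]
  have 1: "\<xi> (brk (L \<eta>) (L \<zeta>)) = - \<eta> (brk (L \<xi>) (L \<zeta>))"
    using I[OF l(1,2), of "L \<zeta>"] form_brk_skew[OF l(1), of "L \<eta>" "L \<zeta>"] form_brk_skew[OF l(2), of "L \<zeta>" "L \<xi>"] by simp
  have 2: "\<eta> (brk (L \<xi>) (L \<zeta>)) = - \<zeta> (brk (L \<xi>) (L \<eta>))"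
    using I[OF l(2,3), of "L \<xi>"] .
  show "CYB scl brk s \<xi> \<eta> \<zeta> = \<xi> (brk (L \<eta>) (L \<zeta>))" "CYB scl brk s \<xi> \<eta> \<zeta> = - \<eta> (brk (L \<xi>) (L \<zeta>))"
    "CYB scl brk s \<xi> \<eta> \<zeta> = \<zeta> (brk (L \<xi>) (L \<eta>))"
    using CYB_contraction[OF L right_contraction_symmetric[OF s L] l] 1 2 by simp_all
qed

text \<open>
  Each of the six mixed terms contains a bracket with \<open>s\<close>, which invariance moves to another leg of \<open>s\<close>;
  after that they cancel in pairs.
\<close>

lemma CYB_split:
  assumes \<Lambda>: "\<Lambda> \<in> exterior_square scl" and s: "s \<in> symmetric_square scl" and inv: "ad_invariant scl brk s"
    and l: "linear_form scl \<xi>" "linear_form scl \<eta>" "linear_form scl \<zeta>"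
  shows "CYB scl brk (\<Lambda> + s) \<xi> \<eta> \<zeta> = CYB scl brk \<Lambda> \<xi> \<eta> \<zeta> + CYB scl brk s \<xi> \<eta> \<zeta>"
proof -
  obtain K where K: "left_contraction scl \<Lambda> K"
    using contractions[OF exterior_squareD(1)[OF \<Lambda>]] by metis
  obtain L where L: "left_contraction scl s L"
    using contractions[OF symmetric_squareD(1)[OF s]] by metis
  note K' = right_contraction_skew[OF \<Lambda> K] and L' = right_contraction_symmetric[OF s L]
  have r: "left_contraction scl (\<Lambda> + s) (\<lambda>\<eta>. K \<eta> + L \<eta>)"
    using K L by (simp add: left_contraction_def linear_form_add)
  have r': "right_contraction scl (\<Lambda> + s) (\<lambda>\<xi>. (- K \<xi>) + L \<xi>)"
    unfolding right_contraction_def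
  proof (intro allI impI)
    fix \<xi> \<eta> assume "linear_form scl \<xi> \<and> linear_form scl \<eta>"
    then have l: "linear_form scl \<xi>" "linear_form scl \<eta>" by auto
    show "(\<Lambda> + s) \<xi> \<eta> = \<eta> ((- K \<xi>) + L \<xi>)"
      unfolding linear_form_add[OF l(2)] plus_fun_apply right_contractionD[OF K' l] right_contractionD[OF L' l] ..
  qed
  note I = invariant_contraction[OF s inv L]
  have 1: "\<xi> (brk (K \<eta>) (L \<zeta>)) = \<zeta> (brk (L \<xi>) (K \<eta>))"
    using I[OF l(1,3), of "K \<eta>"] form_brk_skew[OF l(3), of "K \<eta>" "L \<xi>"] by simp
  have 2: "\<xi> (brk (L \<eta>) (K \<zeta>)) = - \<eta> (brk (L \<xi>) (K \<zeta>))"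
    using I[OF l(1,2), of "K \<zeta>"] form_brk_skew[OF l(1), of "L \<eta>" "K \<zeta>"] form_brk_skew[OF l(2), of "L \<xi>" "K \<zeta>"] by simp
  have 3: "\<eta> (brk (K \<xi>) (L \<zeta>)) = - \<zeta> (brk (K \<xi>) (L \<eta>))"
    using I[OF l(2,3), of "K \<xi>"] .
  show ?thesis
    unfolding CYB_contraction[OF r r' l] CYB_contraction[OF K K' l] CYB_contraction[OF L L' l]
      brk_add_left brk_add_right brk_minus linear_form_add[OF l(1)] linear_form_add[OF l(2)] linear_form_add[OF l(3)]
      linear_form_minus[OF l(1)] linear_form_minus[OF l(2)] linear_form_minus[OF l(3)] minus_minus 1 2 3
    by simp
qed

end

section \<open>Bivector fields defined by an action\<close>

lemma act2_apply: "act2 \<rho> a p f g = a (\<lambda>x. \<rho> x p f) (\<lambda>x. \<rho> x p g)"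
  by (simp add: act2_def)

locale acting_lie_algebra = lie_algebra scl brk
  for scl :: "'k::real_normed_field \<Rightarrow> 'g::ab_group_add \<Rightarrow> 'g" and brk +
  fixes M :: "('a, 'i, 'k) mfd" and \<rho> :: "'g \<Rightarrow> ('a, 'k) vfield"
  assumes M: "manifold M" and action: "left_action scl brk M \<rho>"
begin

lemma action_field: "vector_field M (\<rho> x)"
  and action_add: "\<rho> (x + y) = \<rho> x + \<rho> y"
  and action_scale: "\<rho> (scl c x) = (\<lambda>p f. c * \<rho> x p f)"
  and action_brk: "\<rho> (brk x y) = - vf_bracket M (\<rho> x) (\<rho> y)"
  using action by (auto simp: left_action_def)

lemma action_form: "linear_form scl (\<lambda>x. \<rho> x p f)"
  by (simp add: linear_form_iff action_add action_scale)

lemma action_not_smooth: "\<not> smooth_near M p f \<Longrightarrow> \<rho> x p f = 0"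
  by (rule vector_field_not_smooth[OF M action_field])

lemma action_brk_apply:
  "smooth_near M p f \<Longrightarrow> \<rho> (brk x y) p f = \<rho> y p (\<lambda>q. \<rho> x q f) - \<rho> x p (\<lambda>q. \<rho> y q f)"
  by (simp add: action_brk vf_bracket_def)

lemma derived_form:
  assumes D: "derivation_at M p D" and f: "smooth_near M p f"
  shows "linear_form scl (\<lambda>x. D (\<lambda>q. \<rho> x q f))"
  using derivation_add[OF D vector_field_smooth[OF action_field f] vector_field_smooth[OF action_field f]]
    derivation_cmult[OF D vector_field_smooth[OF action_field f]]
  by (simp add: linear_form_iff action_add action_scale)

lemma act2_presentation:
  "act2 \<rho> (\<Sum>i<(m::nat). tens2 scl (u i) (v i)) q f g = (\<Sum>i<m. \<rho> (u i) q f * \<rho> (v i) q g)"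
proof -
  have "vector_space scl" ..
  from act2_sum[OF this action_add action_scale, where m = m and u = u and v = v]
  show ?thesis by (simp add: fun_eq_iff)
qed

lemma derivation_act2:
  assumes D: "derivation_at M p D" and f: "smooth_near M p f" and g: "smooth_near M p g" and a: "a \<in> tensor_square scl"
  shows "D (\<lambda>q. act2 \<rho> a q f g) =
    a (\<lambda>x. D (\<lambda>q. \<rho> x q f)) (\<lambda>x. \<rho> x p g) + a (\<lambda>x. \<rho> x p f) (\<lambda>x. D (\<lambda>q. \<rho> x q g))"
proof -
  have p: "p \<in> pts M" using f by (rule smooth_near_pts)
  obtain m :: nat and u v where a: "a = (\<Sum>i<m. tens2 scl (u i) (v i))"
    using a by (auto simp: tensor_square_def)
  note s = vector_field_smooth[OF action_field f] vector_field_smooth[OF action_field g]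
  have "D (\<lambda>q. act2 \<rho> a q f g) = (\<Sum>i<m. D (\<lambda>q. \<rho> (u i) q f * \<rho> (v i) q g))"
    unfolding a act2_presentation by (rule derivation_sum[OF D p]) (intro smooth_near_mult s)
  also have "\<dots> = (\<Sum>i<m. D (\<lambda>q. \<rho> (u i) q f) * \<rho> (v i) p g + \<rho> (u i) p f * D (\<lambda>q. \<rho> (v i) q g))"
    by (intro sum.cong refl derivation_mult[OF D s])
  also have "\<dots> = a (\<lambda>x. D (\<lambda>q. \<rho> x q f)) (\<lambda>x. \<rho> x p g) + a (\<lambda>x. \<rho> x p f) (\<lambda>x. D (\<lambda>q. \<rho> x q g))"
    using derived_form[OF D f] derived_form[OF D g] action_form
    by (simp add: a sum_fun_apply tens2_def sum.distrib)
  finally show ?thesis .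
qed

lemma bivector_field_act2:
  assumes a: "a \<in> exterior_square scl"
  shows "bivector_field M (act2 \<rho> a)"
proof -
  obtain m :: nat and u v where am: "a = (\<Sum>i<m. tens2 scl (u i) (v i))"
    using exterior_squareD(1)[OF a] by (auto simp: tensor_square_def)
  have eq: "act2 \<rho> a q = (\<lambda>f g. \<Sum>i<m. \<rho> (u i) q f * \<rho> (v i) q g)" for q
    by (intro ext) (simp only: am act2_presentation)
  show ?thesis
    unfolding bivector_field_def
  proof (intro conjI ballI allI impI)
    show "\<exists>(m::nat) v w. (\<forall>i<m. v i \<in> tangent_space M p \<and> w i \<in> tangent_space M p) \<and>
        act2 \<rho> a p = (\<lambda>f g. \<Sum>i<m. v i f * w i g)" if "p \<in> pts M" for p
      using vector_field_tangent[OF action_field that] eq[of p]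
      by (intro exI[of _ m] exI[of _ "\<lambda>i. \<rho> (u i) p"] exI[of _ "\<lambda>i. \<rho> (v i) p"]) simp
    show "act2 \<rho> a p f g = - act2 \<rho> a p g f" for p f g
      unfolding act2_def by (rule exterior_squareD(2)[OF a])
    show "act2 \<rho> a p = 0" if "p \<notin> pts M" for p
      using action_field that by (auto simp: eq vector_field_def fun_eq_iff)
    show "smooth_near M p (\<lambda>q. act2 \<rho> a q f g)" if "smooth_near M p f \<and> smooth_near M p g" for p f g
      unfolding eq using that smooth_near_pts[of M p f]
      by (intro smooth_near_sum smooth_near_mult vector_field_smooth[OF action_field]) auto
  qed
qed

text \<open>The sign is due to \<open>\<rho>\<close> being an anti-homomorphism.\<close>

lemma schouten12_act2:
  assumes a: "a \<in> exterior_square scl"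
  shows "schouten12 M (\<rho> z) (act2 \<rho> a) = - act2 \<rho> (ad2 scl brk z a)"
proof (intro ext)
  fix p f g
  show "schouten12 M (\<rho> z) (act2 \<rho> a) p f g = (- act2 \<rho> (ad2 scl brk z a)) p f g"
  proof (cases "smooth_near M p f \<and> smooth_near M p g")
    case True
    then have f: "smooth_near M p f" and g: "smooth_near M p g" by auto
    have p: "p \<in> pts M" using f by (rule smooth_near_pts)
    obtain L R where L: "left_contraction scl a L" and R: "right_contraction scl a R"
      using contractions[OF exterior_squareD(1)[OF a]] .
    note L = left_contractionD[OF L] and R = right_contractionD[OF R]
    note D = vector_field_derivation[OF M action_field p, of z]
    let ?F = "\<lambda>x. \<rho> x p f" and ?G = "\<lambda>x. \<rho> x p g"
    note lF = action_form[of p f] and lG = action_form[of p g]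
    have "\<rho> z p (\<lambda>q. act2 \<rho> a q f g) = \<rho> z p (\<lambda>q. \<rho> (L ?G) q f) + \<rho> z p (\<lambda>q. \<rho> (R ?F) q g)"
      using derivation_act2[OF D f g exterior_squareD(1)[OF a]] L[OF derived_form[OF D f] lG] R[OF lF derived_form[OF D g]]
      by simp
    moreover have "act2 \<rho> a p (\<lambda>q. \<rho> z q f) g = \<rho> (L ?G) p (\<lambda>q. \<rho> z q f)"
      unfolding act2_def by (rule L[OF action_form lG])
    moreover have "act2 \<rho> a p f (\<lambda>q. \<rho> z q g) = \<rho> (R ?F) p (\<lambda>q. \<rho> z q g)"
      unfolding act2_def by (rule R[OF lF action_form])
    moreover have "act2 \<rho> (ad2 scl brk z a) p f g = ?F (brk z (L ?G)) + ?G (brk z (R ?F))"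
      unfolding act2_def ad2_apply[OF action_form action_form]
      using L[OF linear_form_brk(1)[OF lF] lG] R[OF lF linear_form_brk(1)[OF lG]] by simp
    ultimately show ?thesis
      using f g by (simp add: schouten12_def action_brk_apply)
  next
    case False
    then have "act2 \<rho> (ad2 scl brk z a) p f g = 0"
      unfolding act2_def ad2_apply[OF action_form action_form]
      by (auto simp: action_not_smooth tensor_zero[OF exterior_squareD(1)[OF a]])
    with False show ?thesis by (auto simp: schouten12_def)
  qed
qed

text \<open>
  Contracting \<open>a\<close> with the form defined by \<open>f\<close> gives a vector \<open>k f\<close> of the Lie algebra, so that the
  derivation \<open>act2 \<rho> a p f\<close> is given by the field \<open>- \<rho> (k f)\<close>. Since this field preserves \<open>A\<close>, all terms
  in the cyclic sum are values of \<open>A\<close> on one of the functions and a derivative of another one along such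
  a field, and they cancel in pairs.
\<close>

lemma schouten22_invariant_act2:
  assumes a: "a \<in> exterior_square scl" and A: "bivector_field M A" and inv: "\<And>x. schouten12 M (\<rho> x) A = 0"
  shows "schouten22 M A (act2 \<rho> a) = 0"
proof (intro ext)
  fix p f g h
  show "schouten22 M A (act2 \<rho> a) p f g h = 0 p f g h"
  proof (cases "smooth_near M p f \<and> smooth_near M p g \<and> smooth_near M p h")
    case True
    then have p: "p \<in> pts M" using smooth_near_pts[of M p f] by blast
    obtain K where K0: "left_contraction scl a K"
      using contractions[OF exterior_squareD(1)[OF a]] by metis
    note K = left_contractionD[OF K0] and K' = right_contractionD[OF right_contraction_skew[OF a K0]]
    define k where "k f = K (\<lambda>x. \<rho> x p f)" for f
    have 1: "A p f (\<lambda>q. act2 \<rho> a q g h) = A p f (\<lambda>q. \<rho> (k h) q g) - A p f (\<lambda>q. \<rho> (k g) q h)"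
      if "smooth_near M p f" "smooth_near M p g" "smooth_near M p h" for f g h
    proof -
      note D = bivector_derivation(1)[OF M A p, of f]
      show ?thesis
        using derivation_act2[OF D that(2,3) exterior_squareD(1)[OF a]]
          K[OF derived_form[OF D that(2)] action_form] K'[OF action_form derived_form[OF D that(3)]]
          linear_form_minus[OF derived_form[OF D that(3)]]
        by (simp add: k_def)
    qed
    have 2: "act2 \<rho> a p f (\<lambda>q. A q g h) = - A p (\<lambda>q. \<rho> (k f) q g) h - A p g (\<lambda>q. \<rho> (k f) q h)"
      if "smooth_near M p f" "smooth_near M p g" "smooth_near M p h" for f g h
    proof -
      have 3: "act2 \<rho> a p f (\<lambda>q. A q g h) = - \<rho> (k f) p (\<lambda>q. A q g h)"
        unfolding act2_def k_def
        using K'[OF action_form action_form] linear_form_minus[OF action_form] by metis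
      have "schouten12 M (\<rho> (k f)) A p g h = 0"
        by (simp add: inv)
      then have "\<rho> (k f) p (\<lambda>q. A q g h) = A p (\<lambda>q. \<rho> (k f) q g) h + A p g (\<lambda>q. \<rho> (k f) q h)"
        using that by (simp add: schouten12_def algebra_simps)
      then show ?thesis unfolding 3 by simp
    qed
    have sk: "A p u (\<lambda>q. \<rho> (k v) q w) = - A p (\<lambda>q. \<rho> (k v) q w) u" for u v w
      by (rule bivector_skew[OF A])
    show ?thesis
      using True by (simp add: schouten22_def 1 2 sk)
  qed (auto simp: schouten22_def)
qed

text \<open>
  With \<open>k\<close> as before, the cyclic sum consists of commutators of the fields \<open>\<rho> (k f)\<close>, \<open>\<rho> (k g)\<close>,
  \<open>\<rho> (k h)\<close>, and these come from brackets in the Lie algebra.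
\<close>

lemma schouten22_act2:
  assumes a: "a \<in> exterior_square scl"
  shows "schouten22 M (act2 \<rho> a) (act2 \<rho> a) = act3 \<rho> (phi scl brk a)"
proof (intro ext)
  fix p f g h
  obtain K where K0: "left_contraction scl a K"
    using contractions[OF exterior_squareD(1)[OF a]] by metis
  note K0' = right_contraction_skew[OF a K0]
  note K = left_contractionD[OF K0] and K' = right_contractionD[OF K0']
  define k where "k f = K (\<lambda>x. \<rho> x p f)" for f
  have neg: "\<rho> (- x) p f = - \<rho> x p f" for x f
    using linear_form_minus[OF action_form[of p f]] .
  have C: "CYB scl brk a (\<lambda>x. \<rho> x p f) (\<lambda>x. \<rho> x p g) (\<lambda>x. \<rho> x p h) =
      \<rho> (brk (k g) (k h)) p f - \<rho> (brk (k f) (k h)) p g + \<rho> (brk (k f) (k g)) p h"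
    unfolding CYB_contraction[OF K0 K0' action_form action_form action_form]
    by (simp add: k_def brk_minus neg)
  show "schouten22 M (act2 \<rho> a) (act2 \<rho> a) p f g h = act3 \<rho> (phi scl brk a) p f g h"
  proof (cases "smooth_near M p f \<and> smooth_near M p g \<and> smooth_near M p h")
    case True
    then have p: "p \<in> pts M" using smooth_near_pts[of M p f] by blast
    have 1: "act2 \<rho> a p f (\<lambda>q. act2 \<rho> a q g h) =
        \<rho> (k f) p (\<lambda>q. \<rho> (k g) q h) - \<rho> (k f) p (\<lambda>q. \<rho> (k h) q g)"
      if "smooth_near M p g" "smooth_near M p h" for f g h
    proof -
      note D = vector_field_derivation[OF M action_field p, of "k f"]
      have "act2 \<rho> a p f (\<lambda>q. act2 \<rho> a q g h) = a (\<lambda>x. \<rho> x p f) (\<lambda>x. \<rho> x p (\<lambda>q. act2 \<rho> a q g h))"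
        by (rule act2_apply)
      also have "\<dots> = - \<rho> (k f) p (\<lambda>q. act2 \<rho> a q g h)"
        unfolding k_def neg[symmetric] by (rule K'[OF action_form action_form])
      also have "\<dots> = - (\<rho> (k f) p (\<lambda>q. \<rho> (k h) q g) + \<rho> (k f) p (\<lambda>q. \<rho> (- k g) q h))"
        using derivation_act2[OF D that exterior_squareD(1)[OF a]]
          K[OF derived_form[OF D that(1)] action_form] K'[OF action_form derived_form[OF D that(2)]]
        by (simp add: k_def)
      also have "\<rho> (k f) p (\<lambda>q. \<rho> (- k g) q h) = - \<rho> (k f) p (\<lambda>q. \<rho> (k g) q h)"
        using linear_form_minus[OF derived_form[OF D that(2)]] .
      finally show ?thesis by simp
    qed
    show ?thesis
      using True by (simp add: schouten22_def act3_def phi_def 1 C action_brk_apply)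
  next
    case False
    then show ?thesis
      by (auto simp: schouten22_def act3_def phi_def action_not_smooth CYB_zero[OF exterior_squareD(1)[OF a]])
  qed
qed

end

section \<open>The equivalence of categories\<close>

context acting_lie_algebra
begin

lemma act2_minus: "act2 \<rho> (- a) = - act2 \<rho> a"
  by (auto simp: act2_def fun_eq_iff)

end

text \<open>
  Let \<open>B = \<rho>(\<Lambda>)\<close>. Invariance of \<open>s\<close> gives \<open>\<delta>(x) = ad\<^sub>x \<Lambda>\<close>, so the bracket of \<open>\<rho>(x)\<close> with \<open>B\<close> is
  \<open>- \<rho>(\<delta>(x))\<close>, and the Poisson condition on \<open>A\<close> says that \<open>A + B\<close> is invariant. In that case \<open>A + B\<close> has
  bracket 0 with \<open>B\<close>, and therefore \<open>[A + B, A + B] = [A, A] - [B, B]\<close>. Here \<open>[B, B] = - \<rho>(\<phi>)\<close>, because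
  \<open>CYB(\<Lambda>) = - CYB(s)\<close>.
\<close>

lemma to_quasi_iff:
  fixes scl :: "'k::{real_normed_field,euclidean_space} \<Rightarrow> 'g::ab_group_add \<Rightarrow> 'g"
  assumes "acting_lie_algebra scl brk M \<rho>"
    and \<Lambda>: "\<Lambda> \<in> exterior_square scl" and s: "s \<in> symmetric_square scl" and inv: "ad_invariant scl brk s"
    and cyb: "CYB scl brk (\<Lambda> + s) = 0" and A: "bivector_field M A"
  shows "(M, A, \<rho>) \<in> poisson_spaces scl brk (delta scl brk (\<Lambda> + s)) \<longleftrightarrow>
    (M, A + act2 \<rho> \<Lambda>, \<rho>) \<in> quasi_poisson_spaces scl brk (phi scl brk s)"
proof -
  interpret acting_lie_algebra scl brk M \<rho> by fact
  define B where "B = act2 \<rho> \<Lambda>"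
  have B: "bivector_field M B" unfolding B_def by (rule bivector_field_act2[OF \<Lambda>])
  have Q: "bivector_field M (A + B)" by (rule bivector_field_add[OF M A B])
  have "ad2 scl brk x (\<Lambda> + s) = ad2 scl brk x \<Lambda> + ad2 scl brk x s" for x
    by (auto simp: ad2_def tens_map_def fun_eq_iff)
  then have delta: "act2 \<rho> (delta scl brk (\<Lambda> + s) x) = act2 \<rho> (ad2 scl brk x \<Lambda>)" for x
    using inv by (simp add: delta_def ad_invariant_def)
  have "schouten12 M (\<rho> x) (A + B) = schouten12 M (\<rho> x) A - act2 \<rho> (ad2 scl brk x \<Lambda>)" for x
    unfolding schouten12_add_right[OF M action_field A B] unfolding B_def schouten12_act2[OF \<Lambda>]
    by (rule add_uminus_conv_diff)
  then have 12: "schouten12 M (\<rho> x) (A + B) = 0 \<longleftrightarrow> schouten12 M (\<rho> x) A = act2 \<rho> (delta scl brk (\<Lambda> + s) x)" for x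
    by (simp only: delta right_minus_eq)
  have "CYB scl brk \<Lambda> (\<lambda>x. \<rho> x p f) (\<lambda>x. \<rho> x p g) (\<lambda>x. \<rho> x p h) =
      - CYB scl brk s (\<lambda>x. \<rho> x p f) (\<lambda>x. \<rho> x p g) (\<lambda>x. \<rho> x p h)" for p f g h
    using CYB_split[OF \<Lambda> s inv action_form[of p f] action_form[of p g] action_form[of p h]] cyb
    by (simp add: eq_neg_iff_add_eq_0)
  then have "act3 \<rho> (phi scl brk \<Lambda>) p f g h = - act3 \<rho> (phi scl brk s) p f g h" for p f g h
    by (simp add: act3_def phi_def)
  then have BB: "schouten22 M B B = - act3 \<rho> (phi scl brk s)"
    unfolding B_def schouten22_act2[OF \<Lambda>] by (simp add: fun_eq_iff)
  have 22: "schouten22 M (A + B) (A + B) = schouten22 M A A + act3 \<rho> (phi scl brk s)"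
    if "\<And>x. schouten12 M (\<rho> x) (A + B) = 0"
  proof -
    have QB: "schouten22 M (A + B) B = 0"
      unfolding B_def by (rule schouten22_invariant_act2[OF \<Lambda> Q[unfolded B_def] that[unfolded B_def]])
    then have AB: "schouten22 M A B = act3 \<rho> (phi scl brk s)"
      unfolding schouten22_add_left[OF M A B B] BB by (metis add.right_inverse add_right_cancel)
    have "schouten22 M (A + B) (A + B) = schouten22 M A (A + B) + schouten22 M B (A + B)"
      by (rule schouten22_add_left[OF M A B Q])
    also have "schouten22 M B (A + B) = 0"
      using QB schouten22_commute[OF M] by metis
    also have "schouten22 M A (A + B) = schouten22 M (A + B) A"
      by (rule schouten22_commute[OF M])
    also have "\<dots> = schouten22 M A A + schouten22 M B A"
      by (rule schouten22_add_left[OF M A B A])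
    also have "schouten22 M B A = act3 \<rho> (phi scl brk s)"
      using AB schouten22_commute[OF M] by metis
    finally show ?thesis by (simp only: add_0_right)
  qed
  have "(M, A, \<rho>) \<in> poisson_spaces scl brk (delta scl brk (\<Lambda> + s)) \<longleftrightarrow>
      schouten22 M A A = 0 \<and> (\<forall>x. schouten12 M (\<rho> x) A = act2 \<rho> (delta scl brk (\<Lambda> + s) x))"
    using M action A by (simp add: poisson_spaces_def)
  also have "\<dots> \<longleftrightarrow> (\<forall>x. schouten12 M (\<rho> x) (A + B) = 0) \<and> schouten22 M (A + B) (A + B) = act3 \<rho> (phi scl brk s)"
    unfolding 12[symmetric] using 22 by (metis add_0_left add_right_cancel)
  also have "\<dots> \<longleftrightarrow> (M, A + B, \<rho>) \<in> quasi_poisson_spaces scl brk (phi scl brk s)"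
    using M action Q by (simp add: quasi_poisson_spaces_def)
  finally show ?thesis unfolding B_def .
qed

lemma exterior_square_minus:
  assumes "vector_space scl" "a \<in> exterior_square scl"
  shows "- a \<in> exterior_square scl"
proof -
  have "flip (- a) = - flip a" by (simp add: flip_def fun_eq_iff)
  then show ?thesis
    using vector_space.tensor_square_minus[OF assms(1)] assms(2) by (simp add: exterior_square_def)
qed

lemma to_quasi_bij:
  fixes scl :: "'k::{real_normed_field,euclidean_space} \<Rightarrow> 'g::ab_group_add \<Rightarrow> 'g"
  assumes g: "lie_algebra scl brk" and \<Lambda>: "\<Lambda> \<in> exterior_square scl" and s: "s \<in> symmetric_square scl"
    and inv: "ad_invariant scl brk s" and cyb: "CYB scl brk (\<Lambda> + s) = 0"
  shows "bij_betw (to_quasi \<Lambda>)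
    (poisson_spaces scl brk (delta scl brk (\<Lambda> + s)) :: ('a, 'i, 'k, 'g) gspace set)
    (quasi_poisson_spaces scl brk (phi scl brk s))"
  unfolding bij_betw_def
proof (intro conjI equalityI subsetI)
  interpret lie_algebra scl brk by (rule g)
  show "inj_on (to_quasi \<Lambda>) (poisson_spaces scl brk (delta scl brk (\<Lambda> + s)) :: ('a, 'i, 'k, 'g) gspace set)"
    by (rule inj_onI) (auto simp: to_quasi_def split: prod.splits)
  fix X :: "('a, 'i, 'k, 'g) gspace"
  show "X \<in> quasi_poisson_spaces scl brk (phi scl brk s)"
    if X: "X \<in> to_quasi \<Lambda> ` poisson_spaces scl brk (delta scl brk (\<Lambda> + s))"
  proof -
    obtain M A \<rho> where X: "X = (M, A + act2 \<rho> \<Lambda>, \<rho>)" "(M, A, \<rho>) \<in> poisson_spaces scl brk (delta scl brk (\<Lambda> + s))"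
      using X by (auto simp: to_quasi_def)
    then have *: "manifold M" "left_action scl brk M \<rho>" "bivector_field M A"
      by (auto simp: poisson_spaces_def)
    interpret acting_lie_algebra scl brk M \<rho> by unfold_locales (rule *)+
    show ?thesis using to_quasi_iff[OF acting_lie_algebra_axioms \<Lambda> s inv cyb *(3)] X by simp
  qed
  show "X \<in> to_quasi \<Lambda> ` poisson_spaces scl brk (delta scl brk (\<Lambda> + s))"
    if "X \<in> quasi_poisson_spaces scl brk (phi scl brk s)"
  proof -
    obtain M Q \<rho> where X: "X = (M, Q, \<rho>)" by (cases X)
    then have *: "manifold M" "left_action scl brk M \<rho>" "bivector_field M Q"
      using that by (auto simp: quasi_poisson_spaces_def)
    interpret acting_lie_algebra scl brk M \<rho> by unfold_locales (rule *)+
    define A where "A = Q + act2 \<rho> (- \<Lambda>)"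
    have A: "bivector_field M A"
      unfolding A_def by (intro bivector_field_add * bivector_field_act2 exterior_square_minus \<Lambda> vector_space_axioms)
    have QA: "Q = A + act2 \<rho> \<Lambda>" by (simp only: A_def act2_minus add.assoc add.left_inverse add_0_right)
    then have "(M, A, \<rho>) \<in> poisson_spaces scl brk (delta scl brk (\<Lambda> + s))"
      using to_quasi_iff[OF acting_lie_algebra_axioms \<Lambda> s inv cyb A] that X by simp
    moreover have "X = to_quasi \<Lambda> (M, A, \<rho>)"
      unfolding X to_quasi_def using QA by simp
    ultimately show ?thesis by blast
  qed
qed

text \<open>An equivariant map relates the bivector fields that \<open>\<Lambda>\<close> defines on its source and on its target.\<close>

lemma to_quasi_hom: "gspace_hom (to_quasi \<Lambda> X) (to_quasi \<Lambda> X') = gspace_hom X X'"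
proof -
  obtain M A \<rho> M' A' \<rho>' where X: "X = (M, A, \<rho>)" "X' = (M', A', \<rho>')"
    by (cases X; cases X') auto
  have "(\<forall>x. \<rho> x p (f \<circ> F) = \<rho>' x (F p) f) \<and> (A + act2 \<rho> \<Lambda>) p (f \<circ> F) (g \<circ> F) = (A' + act2 \<rho>' \<Lambda>) (F p) f g \<longleftrightarrow>
      (\<forall>x. \<rho> x p (f \<circ> F) = \<rho>' x (F p) f) \<and> A p (f \<circ> F) (g \<circ> F) = A' (F p) f g"
    if "\<forall>x. \<rho> x p (g \<circ> F) = \<rho>' x (F p) g" for p f g F
    using that by (auto simp: act2_def)
  note * = this
  show ?thesis
    unfolding X to_quasi_def gspace_hom_def prod.case
  proof (intro Collect_cong conj_cong refl iffI ballI allI impI)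
    fix F p f g
    assume F: "\<forall>p\<in>pts M. \<forall>f g. smooth_near M' (F p) f \<and> smooth_near M' (F p) g \<longrightarrow>
        (\<forall>x. \<rho> x p (f \<circ> F) = \<rho>' x (F p) f) \<and> (A + act2 \<rho> \<Lambda>) p (f \<circ> F) (g \<circ> F) = (A' + act2 \<rho>' \<Lambda>) (F p) f g"
      and p: "p \<in> pts M" and s: "smooth_near M' (F p) f \<and> smooth_near M' (F p) g"
    have "\<forall>x. \<rho> x p (g \<circ> F) = \<rho>' x (F p) g" using F p s by blast
    from *[OF this, of f] show "(\<forall>x. \<rho> x p (f \<circ> F) = \<rho>' x (F p) f) \<and> A p (f \<circ> F) (g \<circ> F) = A' (F p) f g"
      using F p s by blast
  next
    fix F p f g
    assume F: "\<forall>p\<in>pts M. \<forall>f g. smooth_near M' (F p) f \<and> smooth_near M' (F p) g \<longrightarrow>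
        (\<forall>x. \<rho> x p (f \<circ> F) = \<rho>' x (F p) f) \<and> A p (f \<circ> F) (g \<circ> F) = A' (F p) f g"
      and p: "p \<in> pts M" and s: "smooth_near M' (F p) f \<and> smooth_near M' (F p) g"
    have "\<forall>x. \<rho> x p (g \<circ> F) = \<rho>' x (F p) g" using F p s by blast
    from *[OF this, of f] show "(\<forall>x. \<rho> x p (f \<circ> F) = \<rho>' x (F p) f) \<and>
        (A + act2 \<rho> \<Lambda>) p (f \<circ> F) (g \<circ> F) = (A' + act2 \<rho>' \<Lambda>) (F p) f g"
      using F p s by blast
  qed
qed

section \<open>Powers of a Lie algebra\<close>

definition pow_brk :: "('g \<Rightarrow> 'g \<Rightarrow> 'g) \<Rightarrow> ('n \<Rightarrow> 'g) \<Rightarrow> ('n \<Rightarrow> 'g) \<Rightarrow> 'n \<Rightarrow> 'g" where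
  "pow_brk brk x y = (\<lambda>j. brk (x j) (y j))"

definition component_form :: "'n \<Rightarrow> (('n \<Rightarrow> 'g::zero) \<Rightarrow> 'k) \<Rightarrow> 'g \<Rightarrow> 'k" where
  "component_form j F = (\<lambda>x. F (summand j x))"

text \<open>For symmetric \<open>s\<close>, this is the coefficient of \<open>s\<close> in the summands \<open>j\<close> and \<open>k\<close> of \<open>Mix(s)\<close>.\<close>

definition order_sign :: "'n::linorder \<Rightarrow> 'n \<Rightarrow> 'k::ring_1" where
  "order_sign j k = (if j < k then 1 else if k < j then - 1 else 0)"

lemma vector_space_pow:
  assumes "vector_space scl"
  shows "vector_space (pow_scale scl :: 'k::field \<Rightarrow> ('n \<Rightarrow> 'g::ab_group_add) \<Rightarrow> 'n \<Rightarrow> 'g)"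
proof -
  interpret vector_space scl by fact
  show ?thesis
    by unfold_locales (auto simp: pow_scale_def fun_eq_iff scale_left_distrib scale_right_distrib)
qed

lemma sum_summand: "(\<Sum>j\<in>UNIV. summand j (x j)) = (x :: 'n::finite \<Rightarrow> 'g::comm_monoid_add)"
  by (auto simp: fun_eq_iff sum_fun_apply summand_def)

lemma summand_add: "summand j (x + y) = summand j x + summand j (y :: 'g::ab_group_add)"
  by (auto simp: summand_def fun_eq_iff)

lemma (in vector_space) summand_scale: "summand j (scale c x) = pow_scale scale c (summand j x)"
  by (auto simp: summand_def pow_scale_def fun_eq_iff)

lemma lie_algebra_pow:
  fixes scl :: "'k::field \<Rightarrow> 'g::ab_group_add \<Rightarrow> 'g"
  assumes "lie_algebra scl brk"
  shows "lie_algebra (pow_scale scl :: 'k \<Rightarrow> ('n::finite \<Rightarrow> 'g) \<Rightarrow> 'n \<Rightarrow> 'g) (pow_brk brk)"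
proof -
  interpret lie_algebra scl brk by fact
  interpret pow: vector_space "pow_scale scl :: 'k \<Rightarrow> ('n \<Rightarrow> 'g) \<Rightarrow> 'n \<Rightarrow> 'g"
    by (rule vector_space_pow[OF vector_space_axioms])
  obtain B where B: "finite B" "span B = UNIV" using finite_dim by blast
  define B' where "B' = (\<Union>j. summand j ` B :: ('n \<Rightarrow> 'g) set)"
  have "summand j v \<in> pow.span B'" for j v
  proof -
    have "v \<in> span B" using B by simp
    then show ?thesis
    proof (induction v rule: span_induct)
      case base
      show ?case
        unfolding subspace_def
        by (auto simp: summand_add summand_scale pow.span_add pow.span_scale)
          (metis pow.span_zero summand_scale pow.scale_zero_left scale_zero_left)
    next
      case (step v)
      then show ?case by (intro pow.span_base) (auto simp: B'_def)
    qed
  qed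
  then have "(\<Sum>j\<in>UNIV. summand j (x j)) \<in> pow.span B'" for x
    by (intro pow.span_sum)
  then have "pow.span B' = UNIV"
    by (auto simp: sum_summand)
  moreover have "finite B'" using B by (simp add: B'_def)
  ultimately show ?thesis
    by unfold_locales
      (auto simp: pow_brk_def pow_scale_def fun_eq_iff brk_add_left brk_add_right brk_scale_left brk_scale_right brk_self jacobi)
qed

context lie_algebra
begin

lemma component_form_linear:
  "linear_form (pow_scale scl) F \<Longrightarrow> linear_form scl (component_form j F)"
proof -
  interpret pow: vector_space "pow_scale scl :: 'k \<Rightarrow> ('n \<Rightarrow> 'g) \<Rightarrow> 'n \<Rightarrow> 'g"
    by (rule vector_space_pow[OF vector_space_axioms])
  show "linear_form (pow_scale scl) F \<Longrightarrow> linear_form scl (component_form j F)"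
    by (simp add: linear_form_iff component_form_def summand_add summand_scale pow.linear_form_add pow.linear_form_scale)
qed

lemma form_components:
  fixes F :: "('n::finite \<Rightarrow> 'g) \<Rightarrow> 'k"
  assumes "linear_form (pow_scale scl) F"
  shows "F x = (\<Sum>j\<in>UNIV. component_form j F (x j))"
proof -
  interpret pow: vector_space "pow_scale scl :: 'k \<Rightarrow> ('n \<Rightarrow> 'g) \<Rightarrow> 'n \<Rightarrow> 'g"
    by (rule vector_space_pow[OF vector_space_axioms])
  have "F x = F (\<Sum>j\<in>UNIV. summand j (x j))" by (simp only: sum_summand)
  also have "\<dots> = (\<Sum>j\<in>UNIV. component_form j F (x j))"
    by (simp only: pow.linear_form_of_sum[OF assms] component_form_def)
  finally show ?thesis .
qed

end

lemma sum_pairs_less: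
  fixes X :: "'n::{finite,linorder} \<Rightarrow> 'n \<Rightarrow> 'k::comm_monoid_add"
  shows "(\<Sum>(j, k) | j < k. X j k) = (\<Sum>j\<in>UNIV. \<Sum>k\<in>UNIV. if j < k then X j k else 0)"
proof -
  have "(\<Sum>(j, k) | j < k. X j k) = (\<Sum>p\<in>{p \<in> UNIV \<times> UNIV. fst p < snd p}. X (fst p) (snd p))"
    by (intro sum.cong) auto
  also have "\<dots> = (\<Sum>p\<in>UNIV \<times> UNIV. if fst p < snd p then X (fst p) (snd p) else 0)"
    by (rule sum.inter_filter) simp
  also have "\<dots> = (\<Sum>j\<in>UNIV. \<Sum>k\<in>UNIV. if j < k then X j k else 0)"
    unfolding sum.cartesian_product by (intro sum.cong) auto
  finally show ?thesis .
qed

lemma Mix_apply: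
  assumes "linear_form (pow_scale scl) F" "linear_form (pow_scale scl) G"
  shows "Mix scl a F G = (\<Sum>j\<in>UNIV. \<Sum>k\<in>UNIV. if j < k
    then a (component_form k G) (component_form j F) - a (component_form k F) (component_form j G) else 0)"
proof -
  have "Mix scl a F G = (\<Sum>(j, k) | j < k. a (component_form k G) (component_form j F) - a (component_form k F) (component_form j G))"
    using assms unfolding Mix_def sum_fun_apply
    by (intro sum.cong refl) (auto simp: tens_map_def flip_def component_form_def comp_def)
  then show ?thesis by (simp only: sum_pairs_less)
qed

lemma Mix_swap: "Mix scl a F G = - Mix scl a G F"
  unfolding Mix_def sum_fun_apply sum_negf[symmetric]
  by (intro sum.cong refl) (auto simp: tens_map_def flip_def)

lemma Mix_exterior:
  fixes a :: "('g::ab_group_add, 'k::field) tensor2"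
  assumes "vector_space scl" "a \<in> tensor_square scl"
  shows "(Mix scl a :: ('n::{finite,linorder} \<Rightarrow> 'g, 'k) tensor2) \<in> exterior_square (pow_scale scl)"
proof -
  interpret pow: vector_space "pow_scale scl :: 'k \<Rightarrow> ('n \<Rightarrow> 'g) \<Rightarrow> 'n \<Rightarrow> 'g"
    by (rule vector_space_pow[OF assms(1)])
  obtain m :: nat and u v where a: "a = (\<Sum>i<m. tens2 scl (u i) (v i))"
    using assms(2) by (auto simp: tensor_square_def)
  have "wedge (pow_scale scl) x y \<in> tensor_square (pow_scale scl)" for x y :: "'n \<Rightarrow> 'g"
    unfolding wedge_def diff_conv_add_uminus
    by (intro pow.tensor_square_add pow.tensor_square_minus pow.tensor_square_tens2)
  then have "(Mix scl a :: ('n \<Rightarrow> 'g, 'k) tensor2) \<in> tensor_square (pow_scale scl)"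
    unfolding a Mix_sum[OF assms(1)] by (intro pow.tensor_square_sum) (auto intro: pow.tensor_square_sum)
  moreover have "flip (Mix scl a) = - (Mix scl a :: ('n \<Rightarrow> 'g, 'k) tensor2)"
    unfolding flip_def fun_eq_iff uminus_apply by (intro allI Mix_swap)
  ultimately show ?thesis by (simp add: exterior_square_def)
qed

lemma Mix_symmetric:
  fixes F G :: "('n::{finite,linorder} \<Rightarrow> 'g::ab_group_add) \<Rightarrow> 'k::field"
  assumes s: "s \<in> symmetric_square scl" and l: "linear_form (pow_scale scl) F" "linear_form (pow_scale scl) G"
  shows "Mix scl s F G = (\<Sum>j\<in>UNIV. \<Sum>k\<in>UNIV. order_sign j k * s (component_form j F) (component_form k G))"
proof -
  define X where "X j k = s (component_form j F) (component_form k G)" for j k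
  have "Mix scl s F G = (\<Sum>j\<in>UNIV. \<Sum>k\<in>UNIV. (if j < k then X j k else 0) - (if j < k then X k j else 0))"
    unfolding Mix_apply[OF l] X_def
    by (intro sum.cong refl) (simp add: symmetric_squareD(2)[OF s, of "component_form _ G"])
  also have "\<dots> = (\<Sum>j\<in>UNIV. \<Sum>k\<in>UNIV. if j < k then X j k else 0) - (\<Sum>k\<in>UNIV. \<Sum>j\<in>UNIV. if j < k then X k j else 0)"
    unfolding sum_subtractf by (subst (2) sum.swap) (rule refl)
  also have "\<dots> = (\<Sum>j\<in>UNIV. \<Sum>k\<in>UNIV. order_sign j k * X j k)"
    unfolding sum_subtractf[symmetric] by (intro sum.cong refl) (auto simp: order_sign_def)
  finally show ?thesis by (simp only: X_def)
qed

lemma Mix_skew: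
  fixes F G :: "('n::{finite,linorder} \<Rightarrow> 'g::ab_group_add) \<Rightarrow> 'k::field"
  assumes \<Lambda>: "\<Lambda> \<in> exterior_square scl" and l: "linear_form (pow_scale scl) F" "linear_form (pow_scale scl) G"
  shows "Mix scl \<Lambda> F G = - (\<Sum>j\<in>UNIV. \<Sum>k\<in>UNIV. if j = k then 0 else \<Lambda> (component_form j F) (component_form k G))"
proof -
  define X where "X j k = \<Lambda> (component_form j F) (component_form k G)" for j k
  have "Mix scl \<Lambda> F G = (\<Sum>j\<in>UNIV. \<Sum>k\<in>UNIV. - (if j < k then X j k else 0) - (if j < k then X k j else 0))"
    unfolding Mix_apply[OF l] X_def
    by (intro sum.cong refl) (simp add: exterior_squareD(2)[OF \<Lambda>, of "component_form _ G" "component_form _ F"])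
  also have "\<dots> = (\<Sum>j\<in>UNIV. \<Sum>k\<in>UNIV. - (if j < k then X j k else 0)) - (\<Sum>k\<in>UNIV. \<Sum>j\<in>UNIV. if j < k then X k j else 0)"
    unfolding sum_subtractf by (subst (2) sum.swap) (rule refl)
  also have "\<dots> = - (\<Sum>j\<in>UNIV. \<Sum>k\<in>UNIV. if j = k then 0 else X j k)"
    unfolding sum_subtractf[symmetric] sum_negf[symmetric] by (intro sum.cong refl) auto
  finally show ?thesis by (simp only: X_def)
qed

context lie_algebra
begin

text \<open>The diagonal acts on each component of \<open>Mix(s)\<close> as it acts on \<open>s\<close>.\<close>

lemma ad2_Mix_invariant:
  fixes s :: "('g, 'k) tensor2"
  assumes s: "s \<in> symmetric_square scl" and inv: "ad_invariant scl brk s"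
  shows "ad2 (pow_scale scl) (pow_brk brk) (\<lambda>_. x) (Mix scl s :: ('n::{finite,linorder} \<Rightarrow> 'g, 'k) tensor2) = 0"
proof (intro ext)
  interpret pow: lie_algebra "pow_scale scl :: 'k \<Rightarrow> ('n \<Rightarrow> 'g) \<Rightarrow> 'n \<Rightarrow> 'g" "pow_brk brk"
    by (rule lie_algebra_pow) unfold_locales
  fix F G :: "('n \<Rightarrow> 'g) \<Rightarrow> 'k"
  show "ad2 (pow_scale scl) (pow_brk brk) (\<lambda>_. x) (Mix scl s) F G = 0 F G"
  proof (cases "linear_form (pow_scale scl) F \<and> linear_form (pow_scale scl) G")
    case True
    then have l: "linear_form (pow_scale scl) F" "linear_form (pow_scale scl) G" by auto
    have c: "component_form j (\<lambda>y. F (pow_brk brk (\<lambda>_. x) y)) = (\<lambda>y. component_form j F (brk x y))" for j and F :: "('n \<Rightarrow> 'g) \<Rightarrow> 'k"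
    proof -
      have "pow_brk brk (\<lambda>_. x) (summand j y) = summand j (brk x y)" for y
        by (auto simp: pow_brk_def summand_def fun_eq_iff brk_zero)
      then show ?thesis by (simp add: component_form_def)
    qed
    have "s (\<lambda>y. \<xi> (brk x y)) \<eta> + s \<xi> (\<lambda>y. \<eta> (brk x y)) = 0" if "linear_form scl \<xi>" "linear_form scl \<eta>" for \<xi> \<eta>
      using inv ad2_apply[OF that, of brk x s] by (simp add: ad_invariant_def)
    then have "(\<Sum>j\<in>UNIV. \<Sum>k\<in>UNIV. order_sign j k *
        (s (\<lambda>y. component_form j F (brk x y)) (component_form k G) + s (component_form j F) (\<lambda>y. component_form k G (brk x y)))) = 0"
      by (simp add: component_form_linear[OF l(1)] component_form_linear[OF l(2)])
    then show ?thesis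
      unfolding ad2_apply[OF l] Mix_symmetric[OF s pow.linear_form_brk(1)[OF l(1)] l(2)]
        Mix_symmetric[OF s l(1) pow.linear_form_brk(1)[OF l(2)]] c
      by (simp add: distrib_left sum.distrib)
  qed (auto simp: ad2_def tens_map_def)
qed

lemma form_brk_sums:
  assumes "linear_form scl \<xi>"
  shows "\<xi> (brk (\<Sum>k\<in>S. scl (c k) (x k)) (\<Sum>l\<in>T. scl (d l) (y l))) = (\<Sum>k\<in>S. \<Sum>l\<in>T. c k * d l * \<xi> (brk (x k) (y l)))"
  unfolding brk_sum_left
  by (simp add: brk_sum_right brk_scale_left brk_scale_right linear_form_of_sum[OF assms]
      linear_form_scale[OF assms] sum_distrib_left mult_ac)

text \<open>
  Two of three distinct elements lie on the same side of the third one exactly if it is not the middle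
  one, so two products are 1 and one is -1. If just two of the elements are equal, only one product is not 0.
\<close>

lemma order_sign_identity:
  fixes j k l :: "'n::linorder"
  shows "order_sign j k * order_sign j l + order_sign k j * order_sign k l + order_sign l j * order_sign l k =
    (if j = k \<and> k = l then 0 else 1 :: 'k)"
  by (auto simp: order_sign_def)

text \<open>
  The component of \<open>Mix(s)\<close> in the summands \<open>j\<close> and \<open>k\<close> is \<open>s\<close> up to the sign \<open>order_sign j k\<close>. The three
  terms of the Yang-Baxter expression contribute to the component in the summands \<open>j\<close>, \<open>k\<close>, \<open>l\<close> the same
  tensor \<open>CYB(s)\<close> by invariance, with products of two signs as coefficients, whose sum is the identity above.
\<close>

lemma CYB_Mix:
  fixes F G H :: "('n::{finite,linorder} \<Rightarrow> 'g) \<Rightarrow> 'k"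
  assumes s: "s \<in> symmetric_square scl" and inv: "ad_invariant scl brk s"
    and l: "linear_form (pow_scale scl) F" "linear_form (pow_scale scl) G" "linear_form (pow_scale scl) H"
  shows "CYB (pow_scale scl) (pow_brk brk) (Mix scl s) F G H = (\<Sum>j\<in>UNIV. \<Sum>k\<in>UNIV. \<Sum>l\<in>UNIV.
    if j = k \<and> k = l then 0 else CYB scl brk s (component_form j F) (component_form k G) (component_form l H))"
proof -
  interpret pow: lie_algebra "pow_scale scl :: 'k \<Rightarrow> ('n \<Rightarrow> 'g) \<Rightarrow> 'n \<Rightarrow> 'g" "pow_brk brk"
    by (rule lie_algebra_pow) unfold_locales
  obtain L where L: "left_contraction scl s L"
    using contractions[OF symmetric_squareD(1)[OF s]] by metis
  \<comment> \<open>The contraction of \<open>Mix(s)\<close>, which is skew, so that \<open>- L'\<close> contracts the other leg.\<close>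
  define L' where "L' G = (\<lambda>j. \<Sum>k\<in>UNIV. scl (order_sign j k) (L (component_form k G)))" for G :: "('n \<Rightarrow> 'g) \<Rightarrow> 'k"
  have L': "left_contraction (pow_scale scl) (Mix scl s) L'"
    unfolding left_contraction_def
  proof (intro allI impI)
    fix F G :: "('n \<Rightarrow> 'g) \<Rightarrow> 'k" assume "linear_form (pow_scale scl) F \<and> linear_form (pow_scale scl) G"
    then have l: "linear_form (pow_scale scl) F" "linear_form (pow_scale scl) G" by auto
    show "Mix scl s F G = F (L' G)"
      unfolding Mix_symmetric[OF s l] form_components[OF l(1), of "L' G"]
      unfolding L'_def
      by (simp add: linear_form_of_sum[OF component_form_linear[OF l(1)]] linear_form_scale[OF component_form_linear[OF l(1)]]
          left_contractionD[OF L component_form_linear[OF l(1)] component_form_linear[OF l(2)]])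
  qed
  have "Mix scl s \<in> exterior_square (pow_scale scl :: 'k \<Rightarrow> ('n \<Rightarrow> 'g) \<Rightarrow> 'n \<Rightarrow> 'g)"
    by (rule Mix_exterior[OF vector_space_axioms symmetric_squareD(1)[OF s]])
  note R' = pow.right_contraction_skew[OF this L']
  define T where "T j k l = CYB scl brk s (component_form j F) (component_form k G) (component_form l H)" for j k l
  note c = component_form_linear[OF l(1)] component_form_linear[OF l(2)] component_form_linear[OF l(3)]
  note C = CYB_invariant[OF s inv L c]
  have brk: "U (pow_brk brk (L' V) (L' W)) = (\<Sum>j\<in>UNIV. \<Sum>k\<in>UNIV. \<Sum>l\<in>UNIV. order_sign j k * order_sign j l *
      component_form j U (brk (L (component_form k V)) (L (component_form l W))))"
    if "linear_form (pow_scale scl) U" for U V W :: "('n \<Rightarrow> 'g) \<Rightarrow> 'k"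
    unfolding form_components[OF that, of "pow_brk brk (L' V) (L' W)"]
    unfolding pow_brk_def L'_def
    by (intro sum.cong refl form_brk_sums component_form_linear that)
  have 1: "F (pow_brk brk (L' G) (L' H)) = (\<Sum>j\<in>UNIV. \<Sum>k\<in>UNIV. \<Sum>l\<in>UNIV. order_sign j k * order_sign j l * T j k l)"
    unfolding brk[OF l(1)] T_def C(1) ..
  have "G (pow_brk brk (L' F) (L' H)) = (\<Sum>k\<in>UNIV. \<Sum>j\<in>UNIV. \<Sum>l\<in>UNIV. - (order_sign k j * order_sign k l * T j k l))"
    unfolding brk[OF l(2)] T_def C(2) by simp
  also have "\<dots> = - (\<Sum>j\<in>UNIV. \<Sum>k\<in>UNIV. \<Sum>l\<in>UNIV. order_sign k j * order_sign k l * T j k l)"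
    unfolding sum_negf by (subst sum.swap) (rule refl)
  finally have 2: "G (pow_brk brk (L' F) (L' H)) = - (\<Sum>j\<in>UNIV. \<Sum>k\<in>UNIV. \<Sum>l\<in>UNIV. order_sign k j * order_sign k l * T j k l)" .
  have "H (pow_brk brk (L' F) (L' G)) = (\<Sum>l\<in>UNIV. \<Sum>j\<in>UNIV. \<Sum>k\<in>UNIV. order_sign l j * order_sign l k * T j k l)"
    unfolding brk[OF l(3)] T_def C(3) ..
  also have "\<dots> = (\<Sum>j\<in>UNIV. \<Sum>l\<in>UNIV. \<Sum>k\<in>UNIV. order_sign l j * order_sign l k * T j k l)"
    by (rule sum.swap)
  also have "\<dots> = (\<Sum>j\<in>UNIV. \<Sum>k\<in>UNIV. \<Sum>l\<in>UNIV. order_sign l j * order_sign l k * T j k l)"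
    by (intro sum.cong refl sum.swap)
  finally have 3: "H (pow_brk brk (L' F) (L' G)) = (\<Sum>j\<in>UNIV. \<Sum>k\<in>UNIV. \<Sum>l\<in>UNIV. order_sign l j * order_sign l k * T j k l)" .
  have "CYB (pow_scale scl) (pow_brk brk) (Mix scl s) F G H =
      F (pow_brk brk (L' G) (L' H)) - G (pow_brk brk (L' F) (L' H)) + H (pow_brk brk (L' F) (L' G))"
    unfolding pow.CYB_contraction[OF L' R' l] pow.brk_minus
    by (simp only: pow.linear_form_minus[OF l(2)] minus_minus add_uminus_conv_diff)
  also have "\<dots> = (\<Sum>j\<in>UNIV. \<Sum>k\<in>UNIV. \<Sum>l\<in>UNIV.
      (order_sign j k * order_sign j l + order_sign k j * order_sign k l + order_sign l j * order_sign l k) * T j k l)"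
    unfolding 1 2 3 by (simp add: distrib_right sum.distrib)
  also have "\<dots> = (\<Sum>j\<in>UNIV. \<Sum>k\<in>UNIV. \<Sum>l\<in>UNIV. if j = k \<and> k = l then 0 else T j k l)"
    unfolding order_sign_identity by (intro sum.cong refl) simp
  finally show ?thesis by (simp only: T_def)
qed

lemma CYB_of_sums:
  fixes J :: "'c set"
  assumes s: "s \<in> symmetric_square scl" and inv: "ad_invariant scl brk s"
    and l: "\<And>j. j \<in> J \<Longrightarrow> linear_form scl (F j)" "\<And>j. j \<in> J \<Longrightarrow> linear_form scl (G j)" "\<And>j. j \<in> J \<Longrightarrow> linear_form scl (H j)"
  shows "CYB scl brk s (\<lambda>x. \<Sum>j\<in>J. F j x) (\<lambda>x. \<Sum>j\<in>J. G j x) (\<lambda>x. \<Sum>j\<in>J. H j x) =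
    (\<Sum>j\<in>J. \<Sum>k\<in>J. \<Sum>l\<in>J. CYB scl brk s (F j) (G k) (H l))"
proof -
  obtain L where L: "left_contraction scl s L"
    using contractions[OF symmetric_squareD(1)[OF s]] by metis
  have sum: "linear_form scl (\<lambda>x. \<Sum>j\<in>J. F j x)" if "\<And>j. j \<in> J \<Longrightarrow> linear_form scl (F j)" for F :: "'c \<Rightarrow> 'g \<Rightarrow> 'k"
    using that by (simp add: linear_form_iff sum.distrib sum_distrib_left)
  note C = CYB_invariant[OF s inv L]
  have "CYB scl brk s (\<lambda>x. \<Sum>j\<in>J. F j x) (\<lambda>x. \<Sum>j\<in>J. G j x) (\<lambda>x. \<Sum>j\<in>J. H j x) =
      (\<Sum>j\<in>J. CYB scl brk s (F j) (\<lambda>x. \<Sum>j\<in>J. G j x) (\<lambda>x. \<Sum>j\<in>J. H j x))"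
    using C(1)[OF sum[OF l(1)] sum[OF l(2)] sum[OF l(3)]] C(1)[OF l(1) sum[OF l(2)] sum[OF l(3)]] by simp
  also have "\<dots> = (\<Sum>j\<in>J. \<Sum>k\<in>J. CYB scl brk s (F j) (G k) (\<lambda>x. \<Sum>j\<in>J. H j x))"
    using C(2)[OF l(1) sum[OF l(2)] sum[OF l(3)]] C(2)[OF l(1) l(2) sum[OF l(3)]]
    by (intro sum.cong refl) (simp add: sum_negf)
  also have "\<dots> = (\<Sum>j\<in>J. \<Sum>k\<in>J. \<Sum>l\<in>J. CYB scl brk s (F j) (G k) (H l))"
    using C(3)[OF l(1) l(2) sum[OF l(3)]] C(3)[OF l(1) l(2) l(3)] by (intro sum.cong refl) simp
  finally show ?thesis .
qed

end

section \<open>Fusion products\<close>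

locale acting_family = lie_algebra scl brk
  for scl :: "'k::real_normed_field \<Rightarrow> 'g::ab_group_add \<Rightarrow> 'g" and brk +
  fixes M :: "'n::{finite,linorder} \<Rightarrow> ('a, 'i, 'k) mfd" and \<rho> :: "'n \<Rightarrow> 'g \<Rightarrow> ('a, 'k) vfield"
  assumes M: "\<And>j. manifold (M j)" and action: "\<And>j. left_action scl brk (M j) (\<rho> j)"
begin

lemma factor: "acting_lie_algebra scl brk (M j) (\<rho> j)"
  by unfold_locales (rule M action)+

lemma factor_field: "vector_field (M j) (\<rho> j x)"
  using acting_lie_algebra.action_field[OF factor] .

lemma prod_action_lift: "prod_action M \<rho> x = (\<Sum>j\<in>UNIV. lift_field M j (\<rho> j (x j)))"
proof (intro ext)
  fix p f
  show "prod_action M \<rho> x p f = (\<Sum>j\<in>UNIV. lift_field M j (\<rho> j (x j))) p f"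
    unfolding sum_fun_apply
    using smooth_near_pts[of "prod_mfd M" p f]
    by (cases "smooth_near (prod_mfd M) p f") (simp_all add: prod_action_def lift_field_def lift_vector_def)
qed

text \<open>Fields on different factors commute, so only the brackets within one factor contribute.\<close>

lemma prod_action_brk:
  "prod_action M \<rho> (pow_brk brk x y) = - vf_bracket (prod_mfd M) (prod_action M \<rho> x) (prod_action M \<rho> y)"
proof -
  note P = manifold_prod[OF M]
  note V = vector_field_lift[OF M factor_field]
  have 1: "vf_bracket (prod_mfd M) (lift_field M j (\<rho> j (x j))) (lift_field M k (\<rho> k (y k))) =
      (if k = j then - lift_field M j (\<rho> j (brk (x j) (y j))) else 0)" for j k
  proof (cases "k = j")
    case True
    have "lift_field M j (\<rho> j (brk (x j) (y j))) = - lift_field M j (vf_bracket (M j) (\<rho> j (x j)) (\<rho> j (y j)))"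
      unfolding acting_lie_algebra.action_brk[OF factor] by (auto simp: lift_field_def lift_vector_def fun_eq_iff)
    then show ?thesis
      using True vf_bracket_lift_same[where M = M and j = j, OF M factor_field factor_field] by simp
  next
    case False
    then show ?thesis
      using vf_bracket_lift_distinct[where M = M and j = j and k = k, OF M _ factor_field factor_field] by simp
  qed
  have "vf_bracket (prod_mfd M) (prod_action M \<rho> x) (prod_action M \<rho> y) =
      (\<Sum>j\<in>UNIV. vf_bracket (prod_mfd M) (lift_field M j (\<rho> j (x j))) (prod_action M \<rho> y))"
    unfolding prod_action_lift[of x] prod_action_lift[of y]
    by (intro vf_bracket_sum_left P V vector_field_sum)
  also have "\<dots> = (\<Sum>j\<in>UNIV. \<Sum>k\<in>UNIV. vf_bracket (prod_mfd M) (lift_field M j (\<rho> j (x j))) (lift_field M k (\<rho> k (y k))))"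
    unfolding prod_action_lift[of y] by (intro sum.cong refl vf_bracket_sum_right P V)
  also have "\<dots> = (\<Sum>j\<in>UNIV. - lift_field M j (\<rho> j (brk (x j) (y j))))"
    unfolding 1 by (simp only: sum.delta' sum.delta finite UNIV_I if_True)
  finally show ?thesis
    unfolding prod_action_lift[of "pow_brk brk x y"] unfolding pow_brk_def by (simp only: sum_negf minus_minus)
qed

lemma prod_action_linear:
  "prod_action M \<rho> (x + y) = prod_action M \<rho> x + prod_action M \<rho> y"
  "prod_action M \<rho> (pow_scale scl c x) = (\<lambda>p f. c * prod_action M \<rho> x p f)"
  using acting_lie_algebra.action_add[OF factor] acting_lie_algebra.action_scale[OF factor]
  by (auto simp: prod_action_def pow_scale_def fun_eq_iff sum.distrib sum_distrib_left)

lemma vector_field_prod_action: "vector_field (prod_mfd M) (prod_action M \<rho> x)"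
  unfolding prod_action_lift
  by (intro vector_field_sum manifold_prod[OF M] vector_field_lift[OF M factor_field])

lemma power: "acting_lie_algebra (pow_scale scl) (pow_brk brk) (prod_mfd M) (prod_action M \<rho>)"
proof -
  interpret pow: lie_algebra "pow_scale scl :: 'k \<Rightarrow> ('n \<Rightarrow> 'g) \<Rightarrow> 'n \<Rightarrow> 'g" "pow_brk brk"
    by (rule lie_algebra_pow) unfold_locales
  show ?thesis
  proof unfold_locales
    show "manifold (prod_mfd M)" by (rule manifold_prod[OF M])
    show "left_action (pow_scale scl) (pow_brk brk) (prod_mfd M) (prod_action M \<rho>)"
      unfolding left_action_def
      by (intro conjI allI vector_field_prod_action prod_action_linear prod_action_brk)
  qed
qed

lemma diagonal: "acting_lie_algebra scl brk (prod_mfd M) (diag_action M \<rho>)"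
proof unfold_locales
  show "manifold (prod_mfd M)" by (rule manifold_prod[OF M])
  have "diag_action M \<rho> (x + y) = diag_action M \<rho> x + diag_action M \<rho> y" for x y
    using prod_action_linear(1)[of "\<lambda>_. x" "\<lambda>_. y"] by (simp add: diag_action_def plus_fun_def)
  moreover have "diag_action M \<rho> (scl c x) = (\<lambda>p f. c * diag_action M \<rho> x p f)" for c x
    using prod_action_linear(2)[of c "\<lambda>_. x"] by (simp add: diag_action_def pow_scale_def)
  moreover have "diag_action M \<rho> (brk x y) = - vf_bracket (prod_mfd M) (diag_action M \<rho> x) (diag_action M \<rho> y)" for x y
    using prod_action_brk[of "\<lambda>_. x" "\<lambda>_. y"] by (simp add: diag_action_def pow_brk_def)
  ultimately show "left_action scl brk (prod_mfd M) (diag_action M \<rho>)"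
    using vector_field_prod_action by (simp add: left_action_def diag_action_def)
qed

lemma prod_field2_lift: "prod_field2 M A = (\<Sum>j\<in>UNIV. lift_bivector M j (A j))"
proof (intro ext)
  fix p f g
  show "prod_field2 M A p f g = (\<Sum>j\<in>UNIV. lift_bivector M j (A j)) p f g"
    unfolding sum_fun_apply
    using smooth_near_pts[of "prod_mfd M" p f]
    by (cases "smooth_near (prod_mfd M) p f \<and> smooth_near (prod_mfd M) p g") (auto simp: prod_field2_def lift_bivector_def)
qed

text \<open>The linear forms on \<open>\<gg>\<^sup>n\<close> and on \<open>\<gg>\<close> that a function \<open>f\<close> and a point \<open>p\<close> of the product define.\<close>

definition factor_form :: "('n \<Rightarrow> 'a) \<Rightarrow> (('n \<Rightarrow> 'a) \<Rightarrow> 'k) \<Rightarrow> 'n \<Rightarrow> 'g \<Rightarrow> 'k" where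
  "factor_form p f j x = \<rho> j x (p j) (\<lambda>q. f (p(j := q)))"

lemma factor_form_linear: "linear_form scl (factor_form p f j)"
  unfolding factor_form_def[abs_def] by (rule acting_lie_algebra.action_form[OF factor])

lemma component_form_prod_action:
  assumes "smooth_near (prod_mfd M) p f"
  shows "component_form j (\<lambda>x. prod_action M \<rho> x p f) = factor_form p f j"
proof
  fix x
  have z: "\<rho> k 0 q h = 0" for k q h
    using acting_lie_algebra.action_scale[OF factor, of k 0 0] by (simp add: fun_eq_iff)
  have "prod_action M \<rho> (summand j x) p f = (\<Sum>k\<in>UNIV. \<rho> k (summand j x k) (p k) (\<lambda>q. f (p(k := q))))"
    using assms smooth_near_pts[OF assms] by (simp add: prod_action_def)
  also have "\<dots> = (\<Sum>k\<in>UNIV. if k = j then factor_form p f j x else 0)"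
    by (intro sum.cong refl) (auto simp: summand_def z factor_form_def)
  finally show "component_form j (\<lambda>x. prod_action M \<rho> x p f) x = factor_form p f j x"
    by (simp add: component_form_def)
qed

lemma diag_action_form:
  assumes "smooth_near (prod_mfd M) p f"
  shows "diag_action M \<rho> x p f = (\<Sum>j\<in>UNIV. factor_form p f j x)"
  using assms smooth_near_pts[OF assms] by (simp add: diag_action_def prod_action_def factor_form_def)

lemma prod_field2_invariant:
  assumes A: "\<And>j. bivector_field (M j) (A j)" and inv: "\<And>j x. schouten12 (M j) (\<rho> j x) (A j) = 0"
  shows "schouten12 (prod_mfd M) (prod_action M \<rho> x) (prod_field2 M A) = 0"
proof -
  note P = manifold_prod[OF M]
  note V = vector_field_lift[OF M factor_field] and L = bivector_field_lift[OF M A]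
  have 1: "schouten12 (prod_mfd M) (lift_field M j (\<rho> j (x j))) (lift_bivector M k (A k)) = 0" for j k
  proof (cases "j = k")
    case True
    have "lift_bivector M j 0 = 0" by (auto simp: lift_bivector_def fun_eq_iff)
    then show ?thesis
      using True schouten12_lift_same[where M = M and j = j, OF M factor_field A] inv by simp
  next
    case False
    then show ?thesis
      using schouten12_lift_distinct[where M = M and j = j and k = k, OF M _ factor_field A] by simp
  qed
  have "schouten12 (prod_mfd M) (prod_action M \<rho> x) (prod_field2 M A) =
      (\<Sum>j\<in>UNIV. schouten12 (prod_mfd M) (lift_field M j (\<rho> j (x j))) (prod_field2 M A))"
    unfolding prod_action_lift prod_field2_lift
    by (intro schouten12_sum_left P V bivector_field_sum L)
  also have "\<dots> = (\<Sum>j\<in>UNIV. \<Sum>k\<in>UNIV. schouten12 (prod_mfd M) (lift_field M j (\<rho> j (x j))) (lift_bivector M k (A k)))"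
    unfolding prod_field2_lift by (intro sum.cong refl schouten12_sum_right P V L)
  also have "\<dots> = 0" unfolding 1 by (simp only: sum.neutral_const)
  finally show ?thesis .
qed

lemma prod_field2_schouten:
  assumes A: "\<And>j. bivector_field (M j) (A j)" and sq: "\<And>j. schouten22 (M j) (A j) (A j) = act3 (\<rho> j) \<phi>"
    and s: "smooth_near (prod_mfd M) p f" "smooth_near (prod_mfd M) p g" "smooth_near (prod_mfd M) p h"
  shows "schouten22 (prod_mfd M) (prod_field2 M A) (prod_field2 M A) p f g h =
    (\<Sum>j\<in>UNIV. \<phi> (factor_form p f j) (factor_form p g j) (factor_form p h j))"
proof -
  note P = manifold_prod[OF M] and L = bivector_field_lift[OF M A]
  have 1: "schouten22 (prod_mfd M) (lift_bivector M j (A j)) (lift_bivector M k (A k)) p f g h =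
      (if k = j then \<phi> (factor_form p f j) (factor_form p g j) (factor_form p h j) else 0)" for j k
  proof (cases "k = j")
    case True
    then show ?thesis
      using s schouten22_lift_same[where M = M and j = j, OF M A] by (simp add: sq act3_def factor_form_def[abs_def])
  next
    case False
    then show ?thesis
      using schouten22_lift_distinct[where M = M and j = j and k = k, OF M _ A A] by simp
  qed
  have "schouten22 (prod_mfd M) (prod_field2 M A) (prod_field2 M A) =
      (\<Sum>j\<in>UNIV. \<Sum>k\<in>UNIV. schouten22 (prod_mfd M) (lift_bivector M j (A j)) (lift_bivector M k (A k)))"
    unfolding prod_field2_lift by (intro schouten22_sum P L)
  then have "schouten22 (prod_mfd M) (prod_field2 M A) (prod_field2 M A) p f g h =
      (\<Sum>j\<in>UNIV. \<Sum>k\<in>UNIV. schouten22 (prod_mfd M) (lift_bivector M j (A j)) (lift_bivector M k (A k)) p f g h)"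
    by (simp only: sum_fun_apply)
  then show ?thesis unfolding 1 by simp
qed

end

text \<open>
  The sum \<open>B\<close> of the given bivector fields is invariant under all of \<open>\<gg>\<^sup>n\<close> and therefore has bracket 0 with
  the mixing term \<open>C\<close>. In \<open>[B, B] + [C, C]\<close>, the first summand is the sum of the fields \<open>\<rho>\<^sub>j(\<phi>)\<close>, the part
  of \<open>\<rho>(\<phi>)\<close> for the diagonal action in which all three legs of \<open>\<phi>\<close> act on the same factor, and the second
  one is the rest by \<open>CYB_Mix\<close>.
\<close>

lemma fusion_quasi_poisson:
  fixes scl :: "'k::{real_normed_field,euclidean_space} \<Rightarrow> 'g::ab_group_add \<Rightarrow> 'g"
    and Z :: "'n::{finite,linorder} \<Rightarrow> ('a, 'i, 'k, 'g) gspace"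
  assumes g: "lie_algebra scl brk" and s: "s \<in> symmetric_square scl" and inv: "ad_invariant scl brk s"
    and Z: "\<And>j. Z j \<in> quasi_poisson_spaces scl brk (phi scl brk s)"
  shows "fusion scl s Z \<in> quasi_poisson_spaces scl brk (phi scl brk s)"
proof -
  interpret lie_algebra scl brk by (rule g)
  define M where "M j = fst (Z j)" for j
  define A where "A j = fst (snd (Z j))" for j
  define \<rho> where "\<rho> j = snd (snd (Z j))" for j
  have q: "manifold (M j)" "left_action scl brk (M j) (\<rho> j)" "bivector_field (M j) (A j)"
    "schouten12 (M j) (\<rho> j x) (A j) = 0" "schouten22 (M j) (A j) (A j) = act3 (\<rho> j) (phi scl brk s)" for j x
    using Z[of j] unfolding M_def A_def \<rho>_def by (auto simp: quasi_poisson_spaces_def)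
  interpret fam: acting_family scl brk M \<rho>
    by unfold_locales (rule q)+
  interpret pow: acting_lie_algebra "pow_scale scl :: 'k \<Rightarrow> ('n \<Rightarrow> 'g) \<Rightarrow> 'n \<Rightarrow> 'g" "pow_brk brk" "prod_mfd M" "prod_action M \<rho>"
    by (rule fam.power)
  interpret diag: acting_lie_algebra scl brk "prod_mfd M" "diag_action M \<rho>"
    by (rule fam.diagonal)
  define B where "B = prod_field2 M A"
  define X where "X = (Mix scl s :: ('n \<Rightarrow> 'g, 'k) tensor2)"
  define C where "C = act2 (prod_action M \<rho>) X"
  note P = pow.M
  have X: "X \<in> exterior_square (pow_scale scl)"
    unfolding X_def by (rule Mix_exterior[OF vector_space_axioms symmetric_squareD(1)[OF s]])
  have B: "bivector_field (prod_mfd M) B"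
    unfolding B_def fam.prod_field2_lift by (intro bivector_field_sum P bivector_field_lift fam.M q(3))
  have C: "bivector_field (prod_mfd M) C"
    unfolding C_def by (rule pow.bivector_field_act2[OF X])
  have BC: "bivector_field (prod_mfd M) (B + C)"
    by (rule bivector_field_add[OF P B C])
  have Binv: "schouten12 (prod_mfd M) (prod_action M \<rho> x) B = 0" for x
    unfolding B_def by (rule fam.prod_field2_invariant[OF q(3,4)])
  have "schouten12 (prod_mfd M) (diag_action M \<rho> x) (B + C) = 0" for x
  proof -
    have "schouten12 (prod_mfd M) (diag_action M \<rho> x) C = - act2 (prod_action M \<rho>) 0"
      unfolding C_def diag_action_def pow.schouten12_act2[OF X] unfolding X_def ad2_Mix_invariant[OF s inv] ..
    also have "\<dots> = 0" by (simp add: act2_def fun_eq_iff)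
    finally show ?thesis
      unfolding schouten12_add_right[OF P diag.action_field B C] using Binv[of "\<lambda>_. x"]
      by (simp only: diag_action_def add_0_right)
  qed
  moreover have "schouten22 (prod_mfd M) (B + C) (B + C) = act3 (diag_action M \<rho>) (phi scl brk s)"
  proof (intro ext)
    fix p f g h
    show "schouten22 (prod_mfd M) (B + C) (B + C) p f g h = act3 (diag_action M \<rho>) (phi scl brk s) p f g h"
    proof (cases "smooth_near (prod_mfd M) p f \<and> smooth_near (prod_mfd M) p g \<and> smooth_near (prod_mfd M) p h")
      case True
      then have sm: "smooth_near (prod_mfd M) p f" "smooth_near (prod_mfd M) p g" "smooth_near (prod_mfd M) p h" by auto
      have BC0: "schouten22 (prod_mfd M) B C = 0"
        unfolding C_def by (rule pow.schouten22_invariant_act2[OF X B Binv])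
      have "schouten22 (prod_mfd M) (B + C) (B + C) = schouten22 (prod_mfd M) B (B + C) + schouten22 (prod_mfd M) C (B + C)"
        by (rule schouten22_add_left[OF P B C BC])
      also have "\<dots> = schouten22 (prod_mfd M) (B + C) B + schouten22 (prod_mfd M) (B + C) C"
        by (intro arg_cong2[where f = "(+)"] schouten22_commute[OF P])
      also have "\<dots> = schouten22 (prod_mfd M) B B + schouten22 (prod_mfd M) C C"
        unfolding schouten22_add_left[OF P B C B] schouten22_add_left[OF P B C C] schouten22_commute[OF P, of C B] BC0
        by (simp only: add_0_right add_0_left)
      finally have "schouten22 (prod_mfd M) (B + C) (B + C) p f g h =
          schouten22 (prod_mfd M) B B p f g h + schouten22 (prod_mfd M) C C p f g h"
        by (simp only: plus_fun_apply)
      moreover define T where "T j k l = phi scl brk s (fam.factor_form p f j) (fam.factor_form p g k) (fam.factor_form p h l)" for j k l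
      have "schouten22 (prod_mfd M) B B p f g h = (\<Sum>j\<in>UNIV. T j j j)"
        unfolding B_def T_def by (rule fam.prod_field2_schouten[OF q(3,5) sm])
      moreover have "schouten22 (prod_mfd M) C C p f g h = (\<Sum>j\<in>UNIV. \<Sum>k\<in>UNIV. \<Sum>l\<in>UNIV. if j = k \<and> k = l then 0 else T j k l)"
      proof -
        have "schouten22 (prod_mfd M) C C p f g h =
            - 2 * CYB (pow_scale scl) (pow_brk brk) X (\<lambda>x. prod_action M \<rho> x p f) (\<lambda>x. prod_action M \<rho> x p g) (\<lambda>x. prod_action M \<rho> x p h)"
          unfolding C_def pow.schouten22_act2[OF X] act3_def phi_def ..
        then show ?thesis
          unfolding X_def CYB_Mix[OF s inv pow.action_form pow.action_form pow.action_form] fam.component_form_prod_action[OF sm(1)]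
            fam.component_form_prod_action[OF sm(2)] fam.component_form_prod_action[OF sm(3)] sum_distrib_left T_def phi_def
          by (simp add: if_distrib cong: if_cong)
      qed
      moreover have "act3 (diag_action M \<rho>) (phi scl brk s) p f g h = (\<Sum>j\<in>UNIV. \<Sum>k\<in>UNIV. \<Sum>l\<in>UNIV. T j k l)"
        unfolding act3_def phi_def fam.diag_action_form[OF sm(1)] fam.diag_action_form[OF sm(2)] fam.diag_action_form[OF sm(3)]
          CYB_of_sums[OF s inv fam.factor_form_linear fam.factor_form_linear fam.factor_form_linear] T_def
        by (simp only: sum_distrib_left)
      moreover have "(\<Sum>j\<in>UNIV. \<Sum>k\<in>UNIV. \<Sum>l\<in>UNIV. T j k l) =
          (\<Sum>j\<in>UNIV. T j j j) + (\<Sum>j\<in>UNIV. \<Sum>k\<in>UNIV. \<Sum>l\<in>UNIV. if j = k \<and> k = l then 0 else T j k l)"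
      proof -
        have "(\<Sum>k\<in>UNIV. \<Sum>l\<in>UNIV. if j = k \<and> k = l then T j k l else 0) = T j j j" for j
        proof -
          have "(\<Sum>l\<in>UNIV. if j = k \<and> k = l then T j k l else 0) = (if k = j then T j j j else 0)" for k
            by (cases "k = j") (auto simp: sum.delta)
          then show ?thesis by simp
        qed
        then have "(\<Sum>j\<in>UNIV. T j j j) = (\<Sum>j\<in>UNIV. \<Sum>k\<in>UNIV. \<Sum>l\<in>UNIV. if j = k \<and> k = l then T j k l else 0)"
          by simp
        then show ?thesis
          by (simp only: sum.distrib[symmetric]) (intro sum.cong refl, simp)
      qed
      ultimately show ?thesis by simp
    next
      case False
      then show ?thesis
        by (auto simp: schouten22_def act3_def phi_def diag.action_not_smooth CYB_zero[OF symmetric_squareD(1)[OF s]])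
    qed
  qed
  moreover have "fusion scl s Z = (prod_mfd M, B + C, diag_action M \<rho>)"
    by (simp only: fusion_def Let_def M_def[abs_def] A_def[abs_def] \<rho>_def[abs_def] B_def C_def X_def)
  ultimately show ?thesis
    using P diag.action BC by (simp add: quasi_poisson_spaces_def)
qed

text \<open>
  Under the diagonal action, \<open>\<Lambda>\<close> acts on all pairs of factors. Its action on each single factor turns
  \<open>A j\<close> into the bivector field of \<open>to_quasi \<Lambda> (M j, A j, \<rho> j)\<close>, while its action on pairs of distinct
  factors cancels \<open>Mix(\<Lambda>)\<close>, which reduces \<open>Mix(\<Lambda> + s)\<close> to \<open>Mix(s)\<close>.
\<close>

lemma fusion_to_quasi:
  fixes scl :: "'k::real_normed_field \<Rightarrow> 'g::ab_group_add \<Rightarrow> 'g"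
    and M :: "'n::{finite,linorder} \<Rightarrow> ('a, 'i, 'k) mfd"
  assumes g: "lie_algebra scl brk" and \<Lambda>: "\<Lambda> \<in> exterior_square scl" and s: "s \<in> symmetric_square scl"
    and q: "\<And>j. manifold (M j)" "\<And>j. left_action scl brk (M j) (\<rho> j)"
  shows "fusion scl s (\<lambda>j. to_quasi \<Lambda> (M j, A j, \<rho> j)) = to_quasi \<Lambda> (fusion scl (\<Lambda> + s) (\<lambda>j. (M j, A j, \<rho> j)))"
proof -
  interpret lie_algebra scl brk by (rule g)
  interpret fam: acting_family scl brk M \<rho>
    by unfold_locales (rule q)+
  interpret pow: acting_lie_algebra "pow_scale scl :: 'k \<Rightarrow> ('n \<Rightarrow> 'g) \<Rightarrow> 'n \<Rightarrow> 'g" "pow_brk brk" "prod_mfd M" "prod_action M \<rho>"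
    by (rule fam.power)
  interpret diag: acting_lie_algebra scl brk "prod_mfd M" "diag_action M \<rho>"
    by (rule fam.diagonal)
  have "prod_field2 M (\<lambda>j. A j + act2 (\<rho> j) \<Lambda>) p f g + act2 (prod_action M \<rho>) (Mix scl s) p f g =
      prod_field2 M A p f g + act2 (prod_action M \<rho>) (Mix scl (\<Lambda> + s)) p f g + act2 (diag_action M \<rho>) \<Lambda> p f g" for p f g
  proof (cases "smooth_near (prod_mfd M) p f \<and> smooth_near (prod_mfd M) p g")
    case True
    then have sm: "smooth_near (prod_mfd M) p f" "smooth_near (prod_mfd M) p g" by auto
    have p: "p \<in> pts (prod_mfd M)" using sm(1) by (rule smooth_near_pts)
    define X where "X j k = \<Lambda> (fam.factor_form p f j) (fam.factor_form p g k)" for j k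
    have 1: "prod_field2 M (\<lambda>j. A j + act2 (\<rho> j) \<Lambda>) p f g = prod_field2 M A p f g + (\<Sum>j\<in>UNIV. X j j)"
      using sm p by (simp add: prod_field2_def act2_def sum.distrib X_def fam.factor_form_def[abs_def])
    have add: "Mix scl (\<Lambda> + s) F G = Mix scl \<Lambda> F G + Mix scl s F G"
      if "linear_form (pow_scale scl) F" "linear_form (pow_scale scl) G" for F G :: "('n \<Rightarrow> 'g) \<Rightarrow> 'k"
      unfolding Mix_apply[OF that] sum.distrib[symmetric] by (intro sum.cong refl) simp
    have 2: "act2 (prod_action M \<rho>) (Mix scl (\<Lambda> + s)) p f g =
        - (\<Sum>j\<in>UNIV. \<Sum>k\<in>UNIV. if j = k then 0 else X j k) + act2 (prod_action M \<rho>) (Mix scl s) p f g"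
      unfolding X_def fam.component_form_prod_action[OF sm(1), symmetric] fam.component_form_prod_action[OF sm(2), symmetric]
        Mix_skew[OF \<Lambda> pow.action_form pow.action_form, symmetric] act2_apply
      by (intro add pow.action_form)
    obtain L R where L: "left_contraction scl \<Lambda> L" and R: "right_contraction scl \<Lambda> R"
      using contractions[OF exterior_squareD(1)[OF \<Lambda>]] .
    have sum: "linear_form scl (\<lambda>x. \<Sum>j\<in>UNIV. fam.factor_form p g j x)"
      using diag.action_form[of p g] by (simp add: fam.diag_action_form[OF sm(2)])
    have sum': "linear_form scl (\<lambda>x. \<Sum>j\<in>UNIV. fam.factor_form p f j x)"
      using diag.action_form[of p f] by (simp add: fam.diag_action_form[OF sm(1)])
    have "act2 (diag_action M \<rho>) \<Lambda> p f g = \<Lambda> (\<lambda>x. \<Sum>j\<in>UNIV. fam.factor_form p f j x) (\<lambda>x. \<Sum>j\<in>UNIV. fam.factor_form p g j x)"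
      by (simp only: act2_apply fam.diag_action_form[OF sm(1)] fam.diag_action_form[OF sm(2)])
    also have "\<dots> = (\<Sum>j\<in>UNIV. \<Lambda> (fam.factor_form p f j) (\<lambda>x. \<Sum>j\<in>UNIV. fam.factor_form p g j x))"
      unfolding left_contractionD[OF L sum' sum] left_contractionD[OF L fam.factor_form_linear sum] ..
    also have "\<dots> = (\<Sum>j\<in>UNIV. \<Sum>k\<in>UNIV. X j k)"
      unfolding X_def right_contractionD[OF R fam.factor_form_linear sum]
        right_contractionD[OF R fam.factor_form_linear fam.factor_form_linear] ..
    also have "\<dots> = (\<Sum>j\<in>UNIV. \<Sum>k\<in>UNIV. (if k = j then X j k else 0) + (if j = k then 0 else X j k))"
      by (intro sum.cong refl) simp
    also have "\<dots> = (\<Sum>j\<in>UNIV. X j j) + (\<Sum>j\<in>UNIV. \<Sum>k\<in>UNIV. if j = k then 0 else X j k)"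
      unfolding sum.distrib by simp
    finally show ?thesis unfolding 1 2 by simp
  next
    case False
    have M: "Mix scl a \<in> tensor_square (pow_scale scl :: 'k \<Rightarrow> ('n \<Rightarrow> 'g) \<Rightarrow> 'n \<Rightarrow> 'g)" if "a \<in> tensor_square scl" for a
      by (rule exterior_squareD(1)[OF Mix_exterior[OF vector_space_axioms that]])
    note t = exterior_squareD(1)[OF \<Lambda>] symmetric_squareD(1)[OF s]
    have "act2 (prod_action M \<rho>) (Mix scl a) p f g = 0" if "a \<in> tensor_square scl" for a
      using False by (auto simp: act2_apply pow.action_not_smooth tensor_zero[OF M[OF that]])
    moreover have "act2 (diag_action M \<rho>) \<Lambda> p f g = 0"
      using False by (auto simp: act2_apply diag.action_not_smooth tensor_zero[OF t(1)])
    moreover have "prod_field2 M A p f g = 0" for A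
      using False by (auto simp: prod_field2_def)
    ultimately show ?thesis
      using t tensor_square_add[OF t] by simp
  qed
  then have "prod_field2 M (\<lambda>j. A j + act2 (\<rho> j) \<Lambda>) + act2 (prod_action M \<rho>) (Mix scl s) =
      prod_field2 M A + act2 (prod_action M \<rho>) (Mix scl (\<Lambda> + s)) + act2 (diag_action M \<rho>) \<Lambda>"
    by (simp add: fun_eq_iff)
  then show ?thesis
    by (simp only: fusion_def Let_def to_quasi_def prod.case fst_conv snd_conv)
qed

theorem corollary6p18:
  fixes scl :: "'k::{real_normed_field,euclidean_space} \<Rightarrow> 'g::ab_group_add \<Rightarrow> 'g"
    and brk :: "'g \<Rightarrow> 'g \<Rightarrow> 'g"
    and r \<Lambda> s :: "('g, 'k) tensor2"
  assumes "lie_algebra scl brk"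
    and "quasitriangular scl brk r"
    and "r = \<Lambda> + s"
    and "\<Lambda> \<in> exterior_square scl"
    and "s \<in> symmetric_square scl" and "ad_invariant scl brk s"
    and "CARD('n::{finite,linorder}) \<ge> 2"
  shows
    \<comment> \<open>the equivalence: bijective on objects and the identity on morphisms\<close>
    "bij_betw (to_quasi \<Lambda>)
       (poisson_spaces scl brk (delta scl brk r) :: ('a, 'i, 'k, 'g) gspace set)
       (quasi_poisson_spaces scl brk (phi scl brk s))
     \<and> (\<forall>X \<in> (poisson_spaces scl brk (delta scl brk r) :: ('a, 'i, 'k, 'g) gspace set).
         \<forall>X' \<in> (poisson_spaces scl brk (delta scl brk r) :: ('b, 'j, 'k, 'g) gspace set).
           gspace_hom X X' = gspace_hom (to_quasi \<Lambda> X) (to_quasi \<Lambda> X'))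
     \<comment> \<open>it takes fusion products to fusion products\<close>
     \<and> (\<forall>(Y :: 'n \<Rightarrow> ('a, 'i, 'k, 'g) gspace) Z.
         (\<forall>j. Y j \<in> poisson_spaces scl brk (delta scl brk r)
            \<and> Z j \<in> quasi_poisson_spaces scl brk (phi scl brk s)
            \<and> Z j = to_quasi \<Lambda> (Y j)) \<longrightarrow>
         fusion scl r Y \<in> poisson_spaces scl brk (delta scl brk r)
         \<and> fusion scl s Z \<in> quasi_poisson_spaces scl brk (phi scl brk s)
         \<and> fusion scl s Z = to_quasi \<Lambda> (fusion scl r Y))"
proof (intro conjI ballI allI impI)
  note g = assms(1) and r = assms(3) and \<Lambda> = assms(4) and s = assms(5,6)
  interpret lie_algebra scl brk by (rule g)
  have cyb: "CYB scl brk (\<Lambda> + s) = 0"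
    using assms(2) r by (simp add: quasitriangular_def)
  show "bij_betw (to_quasi \<Lambda>)
      (poisson_spaces scl brk (delta scl brk r) :: ('a, 'i, 'k, 'g) gspace set)
      (quasi_poisson_spaces scl brk (phi scl brk s))"
    unfolding r by (rule to_quasi_bij[OF g \<Lambda> s cyb])
  show "gspace_hom X X' = gspace_hom (to_quasi \<Lambda> X) (to_quasi \<Lambda> X')"
    for X :: "('a, 'i, 'k, 'g) gspace" and X' :: "('b, 'j, 'k, 'g) gspace"
    by (rule to_quasi_hom[symmetric])
  fix Y Z :: "'n \<Rightarrow> ('a, 'i, 'k, 'g) gspace"
  assume YZ: "\<forall>j. Y j \<in> poisson_spaces scl brk (delta scl brk r)
            \<and> Z j \<in> quasi_poisson_spaces scl brk (phi scl brk s)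
            \<and> Z j = to_quasi \<Lambda> (Y j)"
  show FZ: "fusion scl s Z \<in> quasi_poisson_spaces scl brk (phi scl brk s)"
    using YZ by (intro fusion_quasi_poisson[OF g s]) blast
  define M where "M j = fst (Y j)" for j
  define A where "A j = fst (snd (Y j))" for j
  define \<rho> where "\<rho> j = snd (snd (Y j))" for j
  have Y: "Y = (\<lambda>j. (M j, A j, \<rho> j))" by (simp add: M_def A_def \<rho>_def)
  have "manifold (M j)" "left_action scl brk (M j) (\<rho> j)" for j
    using YZ[rule_format, of j] unfolding Y by (auto simp: poisson_spaces_def)
  from fusion_to_quasi[OF g \<Lambda> s(1) this]
  have "fusion scl s (\<lambda>j. to_quasi \<Lambda> (Y j)) = to_quasi \<Lambda> (fusion scl r Y)"
    unfolding Y r .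
  moreover have "Z = (\<lambda>j. to_quasi \<Lambda> (Y j))" using YZ by auto
  ultimately show FY: "fusion scl s Z = to_quasi \<Lambda> (fusion scl r Y)" by simp
  \<comment> \<open>The fusion product of the \<open>Y j\<close> is the unique triple that \<open>to_quasi \<Lambda>\<close> takes to that of the \<open>Z j\<close>.\<close>
  have "to_quasi \<Lambda> ` poisson_spaces scl brk (delta scl brk (\<Lambda> + s)) =
      (quasi_poisson_spaces scl brk (phi scl brk s) :: ('n \<Rightarrow> 'a, 'n \<times> 'i, 'k, 'g) gspace set)"
    by (rule bij_betw_imp_surj_on[OF to_quasi_bij[OF g \<Lambda> s cyb]])
  with FZ have "fusion scl s Z \<in> to_quasi \<Lambda> ` poisson_spaces scl brk (delta scl brk r)"
    by (simp only: r)
  then obtain X where X: "to_quasi \<Lambda> (fusion scl r Y) = to_quasi \<Lambda> X" "X \<in> poisson_spaces scl brk (delta scl brk r)"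
    unfolding FY by (rule imageE)
  then have "X = fusion scl r Y"
    by (cases X; cases "fusion scl r Y") (simp add: to_quasi_def)
  with X show "fusion scl r Y \<in> poisson_spaces scl brk (delta scl brk r)" by simp
qed

end
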